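(* Let $G$ be a second countable locally compact group, and let $B_{\rho}(G)$ be its reduced Fourier-Stieltjes algebra, regarded as the dual Banach space $C^{*}_{\rho}(G)^{*}$ of the reduced group C*-algebra. If $B_{\rho}(G)$ has the asymptotic center property, then $G$ is compact.
   Context: Locally compact groups are Hausdorff, with a fixed left Haar measure. The left regular representation is $\rho: L^{1}(G)\to \mathcal{B}(L^{2}(G))$, $\rho(f)(h)=f\ast h$ (convolution). The reduced group C*-algebra $C^{*}_{\rho}(G)$ is the norm closure of $\rho(L^{1}(G))$ in $\mathcal{B}(L^{2}(G))$. The reduced Fourier-Stieltjes algebra $B_{\rho}(G)$ is the dual Banach space $C^{*}_{\rho}(G)^{*}$, with the dual norm; its weak* topology is $\sigma(B_{\rho}(G),C^{*}_{\rho}(G))$. Let $C$ be a non-empty subset of a Banach space $E$ and let $\{W_{\alpha}:\alpha\in A\}$ be a decreasing net of non-empty bounded subsets of $E$ ($A$ a directed set, $W_{\beta}\subseteq W_{\alpha}$ whenever $\alpha\leq\beta$). For $c\in C$ and $\alpha\in A$ put $r_{\alpha}(c)=\sup\{\|w-c\|: w\in W_{\alpha}\}$, $r(c)=\inf\{r_{\alpha}(c):\alpha\in A\}$, and $r=\inf\{r(c):c\in C\}$. The asymptotic center of $\{W_{\alpha}\}$ in $C$ is $AC(\{W_{\alpha}:\alpha\in A\},C)=\{c\in C: r(c)=r\}$. A dual Banach space $E$ (with a fixed predual) has the asymptotic center property if for every non-empty weak* closed convex subset $C$ of $E$ and every decreasing net $\{W_{\alpha}:\alpha\in A\}$ of non-empty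 bounded subsets of $C$, the set $AC(\{W_{\alpha}:\alpha\in A\},C)$ is a non-empty norm compact convex subset of $C$. *)

theory Defs
  imports "HOL-Analysis.Analysis"
begin

section \<open>Complex normed spaces and bounded complex-linear maps\<close>

class complex_normed_vector = real_normed_vector +
  fixes scaleC :: "complex \<Rightarrow> 'a \<Rightarrow> 'a"  (infixr \<open>*\<^sub>C\<close> 75)
  assumes scaleC_add_right: "c *\<^sub>C (x + y) = c *\<^sub>C x + c *\<^sub>C y"
    and scaleC_add_left: "(c + d) *\<^sub>C x = c *\<^sub>C x + d *\<^sub>C x"
    and scaleC_scaleC: "c *\<^sub>C (d *\<^sub>C x) = (c * d) *\<^sub>C x"
    and scaleR_scaleC: "r *\<^sub>R x = complex_of_real r *\<^sub>C x"
    and norm_scaleC: "norm (c *\<^sub>C x) = cmod c * norm x"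

lemma bounded_linear_scaleC: "bounded_linear (\<lambda>x::'a::complex_normed_vector. c *\<^sub>C x)"
proof (rule bounded_linear_intro)
  show "c *\<^sub>C (x + y) = c *\<^sub>C x + c *\<^sub>C y" for x y :: 'a
    by (rule scaleC_add_right)
  show "c *\<^sub>C (r *\<^sub>R x) = r *\<^sub>R (c *\<^sub>C x)" for r and x :: 'a
    by (simp add: scaleR_scaleC scaleC_scaleC mult.commute)
  show "norm (c *\<^sub>C x) \<le> norm x * cmod c" for x :: 'a
    by (simp add: norm_scaleC mult.commute)
qed

lemma scaleC_zero_right: "c *\<^sub>C (0::'a::complex_normed_vector) = 0"
  by (rule linear_simps(3)[OF bounded_linear_scaleC])

lemma scaleC_minus_right: "c *\<^sub>C (- x) = - (c *\<^sub>C (x::'a::complex_normed_vector))"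
  by (rule linear_simps(4)[OF bounded_linear_scaleC])

lemma scaleC_diff_right: "c *\<^sub>C (x - y) = c *\<^sub>C x - c *\<^sub>C (y::'a::complex_normed_vector)"
  by (rule linear_simps(2)[OF bounded_linear_scaleC])

instantiation complex :: complex_normed_vector
begin
definition scaleC_complex :: "complex \<Rightarrow> complex \<Rightarrow> complex" where
  "scaleC_complex c x = c * x"
instance
  by standard (auto simp: scaleC_complex_def algebra_simps norm_mult scaleR_conv_of_real)
end

text \<open>The norm is the operator norm inherited from the real bounded linear maps.\<close>

typedef (overloaded) ('a, 'b) cblinfun =
  "{T :: 'a::complex_normed_vector \<Rightarrow>\<^sub>L 'b::complex_normed_vector.
     \<forall>c x. blinfun_apply T (c *\<^sub>C x) = c *\<^sub>C blinfun_apply T x}"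
  morphisms blinfun_of_cblinfun Abs_cblinfun
  by (rule exI[of _ 0]) (simp add: scaleC_zero_right)

setup_lifting type_definition_cblinfun

lift_definition cblinfun_apply ::
  "('a::complex_normed_vector, 'b::complex_normed_vector) cblinfun \<Rightarrow> 'a \<Rightarrow> 'b"
  is blinfun_apply .

lemma Blinfun_scaleC_apply:
  fixes T :: "'a::complex_normed_vector \<Rightarrow>\<^sub>L 'b::complex_normed_vector"
  shows "blinfun_apply (Blinfun (\<lambda>x. c *\<^sub>C blinfun_apply T x)) y = c *\<^sub>C blinfun_apply T y"
  by (subst bounded_linear_Blinfun_apply)
    (auto intro!: bounded_linear_compose[OF bounded_linear_scaleC] blinfun.bounded_linear_right)

lemma norm_Blinfun_scaleC:
  fixes T :: "'a::complex_normed_vector \<Rightarrow>\<^sub>L 'b::complex_normed_vector"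
  shows "norm (Blinfun (\<lambda>x. c *\<^sub>C blinfun_apply T x)) = cmod c * norm T"
proof -
  have le: "norm (Blinfun (\<lambda>x. c *\<^sub>C blinfun_apply T x)) \<le> cmod c * norm T"
    for c and T :: "'a \<Rightarrow>\<^sub>L 'b"
  proof (rule norm_blinfun_bound)
    fix x
    have "cmod c * norm (blinfun_apply T x) \<le> cmod c * (norm T * norm x)"
      by (intro mult_left_mono norm_blinfun norm_ge_zero)
    then show "norm (blinfun_apply (Blinfun (\<lambda>x. c *\<^sub>C blinfun_apply T x)) x) \<le> cmod c * norm T * norm x"
      by (simp only: Blinfun_scaleC_apply norm_scaleC mult.assoc)
  qed (intro mult_nonneg_nonneg norm_ge_zero)
  show ?thesis
  proof (cases "c = 0")
    case True
    have "norm (Blinfun (\<lambda>x. c *\<^sub>C blinfun_apply T x)) \<le> 0"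
      using le[of c T] unfolding True by simp
    then show ?thesis unfolding True by simp
  next
    case False
    let ?S = "Blinfun (\<lambda>x. c *\<^sub>C blinfun_apply T x)"
    have one: "1 *\<^sub>C x = x" for x :: 'b
      using scaleR_scaleC[of 1 x] by simp
    have "Blinfun (\<lambda>x. inverse c *\<^sub>C blinfun_apply ?S x) = T"
    proof (rule blinfun_eqI)
      fix i
      have "inverse c * c = 1" using False by simp
      then show "blinfun_apply (Blinfun (\<lambda>x. inverse c *\<^sub>C blinfun_apply ?S x)) i = blinfun_apply T i"
        by (simp only: Blinfun_scaleC_apply scaleC_scaleC one blinfun_apply_inverse)
    qed
    then have "norm T \<le> inverse (cmod c) * norm ?S"
      using le[of "inverse c" ?S] by (simp only: norm_inverse)
    then have "cmod c * norm T \<le> cmod c * (inverse (cmod c) * norm ?S)"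
      by (rule mult_left_mono) simp
    also have "\<dots> = norm ?S" using False by (simp add: mult.assoc[symmetric])
    finally show ?thesis using le[of c T] by linarith
  qed
qed

instantiation cblinfun :: (complex_normed_vector, complex_normed_vector) complex_normed_vector
begin

lift_definition zero_cblinfun :: "('a, 'b) cblinfun" is 0
  by (simp add: scaleC_zero_right)
lift_definition plus_cblinfun :: "('a, 'b) cblinfun \<Rightarrow> ('a, 'b) cblinfun \<Rightarrow> ('a, 'b) cblinfun" is "(+)"
  by (simp add: blinfun.add_left scaleC_add_right)
lift_definition minus_cblinfun :: "('a, 'b) cblinfun \<Rightarrow> ('a, 'b) cblinfun \<Rightarrow> ('a, 'b) cblinfun" is "(-)"
  by (simp add: blinfun.diff_left scaleC_diff_right)
lift_definition uminus_cblinfun :: "('a, 'b) cblinfun \<Rightarrow> ('a, 'b) cblinfun" is uminus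
  by (simp add: blinfun.minus_left scaleC_minus_right)
lift_definition scaleR_cblinfun :: "real \<Rightarrow> ('a, 'b) cblinfun \<Rightarrow> ('a, 'b) cblinfun" is "scaleR"
  by (simp add: blinfun.scaleR_left scaleR_scaleC scaleC_scaleC mult.commute)
lift_definition scaleC_cblinfun :: "complex \<Rightarrow> ('a, 'b) cblinfun \<Rightarrow> ('a, 'b) cblinfun"
  is "\<lambda>c T. Blinfun (\<lambda>x. c *\<^sub>C blinfun_apply T x)"
  by (simp add: Blinfun_scaleC_apply scaleC_scaleC mult.commute)
lift_definition norm_cblinfun :: "('a, 'b) cblinfun \<Rightarrow> real" is norm .

definition dist_cblinfun :: "('a, 'b) cblinfun \<Rightarrow> ('a, 'b) cblinfun \<Rightarrow> real" where
  "dist_cblinfun S T = norm (S - T)"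
definition sgn_cblinfun :: "('a, 'b) cblinfun \<Rightarrow> ('a, 'b) cblinfun" where
  "sgn_cblinfun T = inverse (norm T) *\<^sub>R T"
definition uniformity_cblinfun :: "(('a, 'b) cblinfun \<times> ('a, 'b) cblinfun) filter" where
  "uniformity_cblinfun = (INF e\<in>{0 <..}. principal {(S, T). dist S T < e})"
definition open_cblinfun :: "('a, 'b) cblinfun set \<Rightarrow> bool" where
  "open_cblinfun U = (\<forall>S\<in>U. \<forall>\<^sub>F (S', T) in uniformity. S' = S \<longrightarrow> T \<in> U)"

instance
proof
  fix S T U :: "('a, 'b) cblinfun" and r s :: real and c d :: complex
  show "S + T + U = S + (T + U)" "S + T = T + S" "0 + S = S" "- S + S = 0" "S - T = S + - T"
    "r *\<^sub>R (S + T) = r *\<^sub>R S + r *\<^sub>R T" "(r + s) *\<^sub>R S = r *\<^sub>R S + s *\<^sub>R S"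
    "r *\<^sub>R s *\<^sub>R S = (r * s) *\<^sub>R S" "1 *\<^sub>R S = S"
    by (transfer, simp add: algebra_simps)+
  show "dist S T = norm (S - T)" by (rule dist_cblinfun_def)
  show "sgn S = inverse (norm S) *\<^sub>R S" by (rule sgn_cblinfun_def)
  show "(uniformity :: (('a, 'b) cblinfun \<times> ('a, 'b) cblinfun) filter)
      = (INF e\<in>{0 <..}. principal {(S, T). dist S T < e})"
    by (rule uniformity_cblinfun_def)
  show "open V \<longleftrightarrow> (\<forall>S\<in>V. \<forall>\<^sub>F (S', T) in uniformity. S' = S \<longrightarrow> T \<in> V)"
    for V :: "('a, 'b) cblinfun set"
    by (rule open_cblinfun_def)
  show "norm S = 0 \<longleftrightarrow> S = 0" by transfer simp
  show "norm (S + T) \<le> norm S + norm T" by transfer (rule norm_triangle_ineq)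
  show "norm (r *\<^sub>R S) = \<bar>r\<bar> * norm S" by transfer simp
  show "c *\<^sub>C (S + T) = c *\<^sub>C S + c *\<^sub>C T"
    by transfer (rule blinfun_eqI, simp only: Blinfun_scaleC_apply,
        simp only: Blinfun_scaleC_apply blinfun.add_left scaleC_add_right)
  show "(c + d) *\<^sub>C S = c *\<^sub>C S + d *\<^sub>C S"
    by transfer (rule blinfun_eqI, simp only: Blinfun_scaleC_apply,
        simp only: Blinfun_scaleC_apply blinfun.add_left scaleC_add_left)
  show "c *\<^sub>C d *\<^sub>C S = (c * d) *\<^sub>C S"
    by transfer (rule blinfun_eqI, simp only: Blinfun_scaleC_apply scaleC_scaleC)
  show "r *\<^sub>R S = complex_of_real r *\<^sub>C S"
    by transfer (rule blinfun_eqI,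
        simp only: Blinfun_scaleC_apply blinfun.scaleR_left scaleR_scaleC)
  show "norm (c *\<^sub>C S) = cmod c * norm S"
    by transfer (rule norm_Blinfun_scaleC)
qed

end

type_synonym 'a cdual = "('a, complex) cblinfun"

definition weak_star_topology :: "'a::complex_normed_vector cdual topology" where
  "weak_star_topology =
     topology_generated_by {{\<phi>. cblinfun_apply \<phi> x \<in> U} | x U. open U}"


section \<open>Asymptotic centers\<close>

definition directed_on :: "'i set \<Rightarrow> ('i \<Rightarrow> 'i \<Rightarrow> bool) \<Rightarrow> bool" where
  "directed_on A le \<longleftrightarrow> A \<noteq> {} \<and> reflp_on A le \<and> transp_on A le \<and>
     (\<forall>\<alpha>\<in>A. \<forall>\<beta>\<in>A. \<exists>\<gamma>\<in>A. le \<alpha> \<gamma> \<and> le \<beta> \<gamma>)"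

definition decreasing_net :: "'i set \<Rightarrow> ('i \<Rightarrow> 'i \<Rightarrow> bool) \<Rightarrow> ('i \<Rightarrow> 'e set) \<Rightarrow> bool" where
  "decreasing_net A le W \<longleftrightarrow> directed_on A le \<and>
     (\<forall>\<alpha>\<in>A. \<forall>\<beta>\<in>A. le \<alpha> \<beta> \<longrightarrow> W \<beta> \<subseteq> W \<alpha>)"

definition radius_at :: "('i \<Rightarrow> 'e::real_normed_vector set) \<Rightarrow> 'i \<Rightarrow> 'e \<Rightarrow> real" where
  "radius_at W \<alpha> c = (SUP w\<in>W \<alpha>. norm (w - c))"

definition asymptotic_radius_at :: "'i set \<Rightarrow> ('i \<Rightarrow> 'e::real_normed_vector set) \<Rightarrow> 'e \<Rightarrow> real" where
  "asymptotic_radius_at A W c = (INF \<alpha>\<in>A. radius_at W \<alpha> c)"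

definition asymptotic_radius :: "'i set \<Rightarrow> ('i \<Rightarrow> 'e::real_normed_vector set) \<Rightarrow> 'e set \<Rightarrow> real" where
  "asymptotic_radius A W C = (INF c\<in>C. asymptotic_radius_at A W c)"

definition asymptotic_center :: "'i set \<Rightarrow> ('i \<Rightarrow> 'e::real_normed_vector set) \<Rightarrow> 'e set \<Rightarrow> 'e set" where
  "asymptotic_center A W C = {c \<in> C. asymptotic_radius_at A W c = asymptotic_radius A W C}"

text \<open>
  HOL cannot quantify over the index types of nets inside a formula. The index sets below are
  subsets of the type of subsets of the dual space; since the asymptotic center depends only on
  the family of the sets \<open>W \<alpha>\<close>, this covers nets over arbitrary directed sets, as
  \<open>asymptotic_center_property_net\<close> shows.
\<close>

definition asymptotic_center_property :: "'a::complex_normed_vector cdual itself \<Rightarrow> bool" where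
  "asymptotic_center_property _ \<longleftrightarrow>
     (\<forall>C :: 'a cdual set. C \<noteq> {} \<and> closedin weak_star_topology C \<and> convex C \<longrightarrow>
       (\<forall>(A :: 'a cdual set set) le W.
          decreasing_net A le W \<and> (\<forall>\<alpha>\<in>A. W \<alpha> \<noteq> {} \<and> bounded (W \<alpha>) \<and> W \<alpha> \<subseteq> C) \<longrightarrow>
          asymptotic_center A W C \<noteq> {} \<and> compact (asymptotic_center A W C) \<and>
          convex (asymptotic_center A W C)))"

lemma asymptotic_center_property_net:
  fixes C :: "'a::complex_normed_vector cdual set" and A :: "'i set"
  assumes acp: "asymptotic_center_property TYPE('a cdual)"
    and C: "C \<noteq> {}" "closedin weak_star_topology C" "convex C"
    and net: "decreasing_net A le W"
    and W: "\<And>\<alpha>. \<alpha> \<in> A \<Longrightarrow> W \<alpha> \<noteq> {} \<and> bounded (W \<alpha>) \<and> W \<alpha> \<subseteq> C"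
  shows "asymptotic_center A W C \<noteq> {} \<and> compact (asymptotic_center A W C) \<and>
    convex (asymptotic_center A W C)"
proof -
  have "asymptotic_radius_at (W ` A) id c = asymptotic_radius_at A W c" for c
    by (simp add: asymptotic_radius_at_def radius_at_def image_image)
  then have "asymptotic_center (W ` A) id C = asymptotic_center A W C"
    by (simp add: asymptotic_center_def asymptotic_radius_def)
  moreover have "decreasing_net (W ` A) (\<lambda>X Y. Y \<subseteq> X) id"
    unfolding decreasing_net_def directed_on_def
  proof (intro conjI ballI impI)
    show "W ` A \<noteq> {}"
      using net by (simp add: decreasing_net_def directed_on_def)
    show "reflp_on (W ` A) (\<lambda>X Y. Y \<subseteq> X)" "transp_on (W ` A) (\<lambda>X Y. Y \<subseteq> X)"
      by (auto simp: reflp_on_def transp_on_def)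
    show "id Y \<subseteq> id X" if "Y \<subseteq> X" for X Y :: "'a cdual set"
      using that by simp
    fix X Y
    assume "X \<in> W ` A" "Y \<in> W ` A"
    then obtain \<alpha> \<beta> where \<alpha>\<beta>: "\<alpha> \<in> A" "\<beta> \<in> A" "X = W \<alpha>" "Y = W \<beta>" by blast
    then obtain \<gamma> where \<gamma>: "\<gamma> \<in> A" "le \<alpha> \<gamma>" "le \<beta> \<gamma>"
      using net unfolding decreasing_net_def directed_on_def by blast
    have "W \<gamma> \<subseteq> X" "W \<gamma> \<subseteq> Y"
      using net \<alpha>\<beta> \<gamma> unfolding decreasing_net_def by simp_all
    then show "\<exists>Z\<in>W ` A. Z \<subseteq> X \<and> Z \<subseteq> Y"
      using \<gamma>(1) by blast
  qed
  moreover have "\<forall>X\<in>W ` A. id X \<noteq> {} \<and> bounded (id X) \<and> id X \<subseteq> C"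
    using W by simp
  ultimately show ?thesis
    using acp[unfolded asymptotic_center_property_def, rule_format, of C "W ` A" "\<lambda>X Y. Y \<subseteq> X" id] C
    by simp
qed


section \<open>Locally compact groups\<close>

text \<open>
  The group operation is written additively because the library's topological groups are;
  \<^class>\<open>topological_group_add\<close> does not assume commutativity.
  The parameter \<open>haar\<close> is the fixed left Haar measure: a nonzero left-invariant Radon measure on
  the Borel sets, which are spelled out because \<open>borel\<close> cannot be used in the class axioms.
\<close>

class locally_compact_group = topological_group_add + t2_space +
  fixes haar :: "'a measure"
  assumes locally_compact: "\<exists>U K. open U \<and> compact K \<and> x \<in> U \<and> U \<subseteq> K"
    and sets_haar_sigma: "sets haar = sigma_sets UNIV {U. open U}"
    and haar_nonzero: "emeasure haar UNIV \<noteq> 0"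
    and haar_compact_finite: "compact K \<Longrightarrow> emeasure haar K < \<infinity>"
    and haar_left_invariant: "B \<in> sets haar \<Longrightarrow> emeasure haar ((+) g ` B) = emeasure haar B"
    and haar_outer_regular:
      "B \<in> sets haar \<Longrightarrow> emeasure haar B = (INF U\<in>{U. open U \<and> B \<subseteq> U}. emeasure haar U)"
    and haar_inner_regular:
      "open U \<Longrightarrow> emeasure haar U = (SUP K\<in>{K. compact K \<and> K \<subseteq> U}. emeasure haar K)"

lemma sets_haar [measurable_cong, simp]:
  "sets (haar :: 'g::locally_compact_group measure) = sets borel"
  by (simp add: sets_haar_sigma borel_def)

lemma space_haar [simp]: "space (haar :: 'g::locally_compact_group measure) = UNIV"
  using sets_eq_imp_space_eq[OF sets_haar] by simp

lemma continuous_left_translation: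
  "continuous_on UNIV (\<lambda>p. - fst p + snd p :: 'g::locally_compact_group)"
proof -
  have "(fst \<longlongrightarrow> fst p) (at p)" "(snd \<longlongrightarrow> snd p) (at p)" for p :: "'g \<times> 'g"
    using tendsto_fst[OF tendsto_ident_at] tendsto_snd[OF tendsto_ident_at] by blast+
  then show ?thesis
    unfolding continuous_on_def by (auto intro!: tendsto_add tendsto_minus)
qed

lemma measurable_left_translation:
  "(\<lambda>x. - y + x) \<in> measurable haar (haar :: 'g::locally_compact_group measure)"
proof -
  have "continuous_on UNIV (\<lambda>x. - y + x)"
    unfolding continuous_on_def by (intro ballI tendsto_add tendsto_const tendsto_ident_at)
  then have "(\<lambda>x. - y + x) \<in> borel_measurable borel"
    by (rule borel_measurable_continuous_onI)
  then show ?thesis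
    by (simp add: measurable_cong_sets[OF sets_haar sets_haar])
qed

lemma distr_haar: "distr haar haar (\<lambda>x. - y + x) = (haar :: 'g::locally_compact_group measure)"
proof (rule measure_eqI)
  note m = measurable_left_translation[of y]
  fix B :: "'g set" assume B: "B \<in> sets (distr haar haar (\<lambda>x. - y + x))"
  have "(\<lambda>x. - y + x) -` B = (+) y ` B"
    by (auto simp: image_iff add.assoc[symmetric] intro!: bexI[of _ "- y + _"])
  then show "emeasure (distr haar haar (\<lambda>x. - y + x)) B = emeasure haar B"
    using B m by (simp add: emeasure_distr haar_left_invariant)
qed simp

lemma nn_integral_haar_translate:
  fixes u :: "'g::locally_compact_group \<Rightarrow> ennreal"
  assumes [measurable]: "u \<in> borel_measurable borel"
  shows "(\<integral>\<^sup>+x. u (- y + x) \<partial>haar) = (\<integral>\<^sup>+x. u x \<partial>haar)"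
proof -
  note m = measurable_left_translation[of y]
  have "(\<integral>\<^sup>+x. u x \<partial>haar) = (\<integral>\<^sup>+x. u x \<partial>(distr haar haar (\<lambda>x. - y + x)))"
    by (simp only: distr_haar)
  also have "\<dots> = (\<integral>\<^sup>+x. u (- y + x) \<partial>haar)"
    by (rule nn_integral_distr[OF m]) simp
  finally show ?thesis by simp
qed

lemma sigma_finite_haar:
  "sigma_finite_measure
     (haar :: 'g::{locally_compact_group, second_countable_topology} measure)"
proof -
  define F where "F = {U :: 'g set. open U \<and> (\<exists>K. compact K \<and> U \<subseteq> K)}"
  have F_open: "\<And>U. U \<in> F \<Longrightarrow> open U" by (auto simp: F_def)
  then obtain F' where F': "F' \<subseteq> F" "countable F'" "\<Union>F' = \<Union>F"
    by (rule Lindelof)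
  have "\<Union>F = UNIV"
    using locally_compact by (fastforce simp: F_def)
  moreover have "emeasure haar U \<noteq> \<infinity>" if "U \<in> F" for U
  proof -
    from that obtain K where K: "compact K" "U \<subseteq> K" unfolding F_def by blast
    then have "emeasure haar U \<le> emeasure haar K"
      by (intro emeasure_mono) (auto simp: compact_imp_closed)
    then show ?thesis using haar_compact_finite[OF K(1)] by (auto simp: top_unique)
  qed
  ultimately show ?thesis
    using F' by unfold_locales (intro exI[of _ F'], auto simp: F_open)
qed


section \<open>The space \<open>L\<^sup>2(G)\<close>\<close>

definition square_integrable :: "('g::locally_compact_group \<Rightarrow> complex) \<Rightarrow> bool" where
  "square_integrable f \<longleftrightarrow> f \<in> borel_measurable haar \<and> integrable haar (\<lambda>x. (cmod (f x))\<^sup>2)"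

lemma square_integrable_zero: "square_integrable (\<lambda>_. 0)"
  by (simp add: square_integrable_def)

lemma square_integrable_add:
  assumes "square_integrable f" "square_integrable g"
  shows "square_integrable (\<lambda>x. f x + g x)"
proof -
  have [measurable]: "f \<in> borel_measurable haar" "g \<in> borel_measurable haar"
    using assms by (auto simp: square_integrable_def)
  have "integrable haar (\<lambda>x. (cmod (f x + g x))\<^sup>2)"
  proof (rule Bochner_Integration.integrable_bound)
    show "integrable haar (\<lambda>x. 2 * (cmod (f x))\<^sup>2 + 2 * (cmod (g x))\<^sup>2)"
      using assms by (simp add: square_integrable_def)
    have "(cmod (a + b))\<^sup>2 \<le> 2 * (cmod a)\<^sup>2 + 2 * (cmod b)\<^sup>2" for a b :: complex
    proof -
      have "(cmod (a + b))\<^sup>2 \<le> (cmod a + cmod b)\<^sup>2"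
        by (simp add: norm_triangle_ineq power_mono)
      also have "\<dots> \<le> 2 * (cmod a)\<^sup>2 + 2 * (cmod b)\<^sup>2"
        using sum_squares_bound[of "cmod a" "cmod b"] by (simp add: power2_sum)
      finally show ?thesis .
    qed
    then show "AE x in haar. norm ((cmod (f x + g x))\<^sup>2)
        \<le> norm (2 * (cmod (f x))\<^sup>2 + 2 * (cmod (g x))\<^sup>2)"
      by simp
  qed measurable
  then show ?thesis by (simp add: square_integrable_def)
qed

lemma square_integrable_mult:
  "square_integrable f \<Longrightarrow> square_integrable (\<lambda>x. c * f x)"
  by (auto simp: square_integrable_def norm_mult power_mult_distrib intro: borel_measurable_times)

lemma square_integrable_uminus:
  "square_integrable f \<Longrightarrow> square_integrable (\<lambda>x. - f x)"
  by (simp add: square_integrable_def)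

lemmas square_integrable_intros =
  square_integrable_zero square_integrable_add square_integrable_mult square_integrable_uminus

lemma integrable_inner_L2:
  assumes "square_integrable f" "square_integrable g"
  shows "integrable haar (\<lambda>x. inner (f x) (g x))"
proof (rule Bochner_Integration.integrable_bound)
  have [measurable]: "f \<in> borel_measurable haar" "g \<in> borel_measurable haar"
    using assms by (auto simp: square_integrable_def)
  show "(\<lambda>x. inner (f x) (g x)) \<in> borel_measurable haar" by measurable
  show "integrable haar (\<lambda>x. (cmod (f x))\<^sup>2 + (cmod (g x))\<^sup>2)"
    using assms by (simp add: square_integrable_def)
  have "\<bar>inner a b\<bar> \<le> (cmod a)\<^sup>2 + (cmod b)\<^sup>2" for a b :: complex
  proof -
    have "\<bar>inner a b\<bar> \<le> cmod a * cmod b" by (rule Cauchy_Schwarz_ineq2)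
    also have "\<dots> \<le> (cmod a)\<^sup>2 + (cmod b)\<^sup>2"
      using sum_squares_bound[of "cmod a" "cmod b"]
        mult_nonneg_nonneg[OF norm_ge_zero norm_ge_zero, of a b] by linarith
    finally show ?thesis .
  qed
  then show "AE x in haar. norm (inner (f x) (g x)) \<le> norm ((cmod (f x))\<^sup>2 + (cmod (g x))\<^sup>2)"
    by simp
qed

definition L2_rel :: "('g::locally_compact_group \<Rightarrow> complex) \<Rightarrow> ('g \<Rightarrow> complex) \<Rightarrow> bool" where
  "L2_rel f g \<longleftrightarrow> square_integrable f \<and> square_integrable g \<and> (AE x in haar. f x = g x)"

lemma L2_relI:
  "\<lbrakk>square_integrable f; square_integrable g; AE x in haar. f x = g x\<rbrakk> \<Longrightarrow> L2_rel f g"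
  by (simp add: L2_rel_def)

lemma L2_relD:
  assumes "L2_rel f g"
  shows "square_integrable f" "square_integrable g" "AE x in haar. f x = g x"
    "f \<in> borel_measurable haar" "g \<in> borel_measurable haar"
  using assms by (auto simp: L2_rel_def square_integrable_def)

lemma L2_rel_pointwiseI:
  "\<lbrakk>square_integrable f; \<And>x. f x = g x\<rbrakk> \<Longrightarrow> L2_rel f g"
  by (simp add: L2_rel_def ext[of f g])

lemma square_integrable_L2_rel: "L2_rel f f \<Longrightarrow> square_integrable f"
  by (rule L2_relD(1))

quotient_type (overloaded) 'g L2 = "'g::locally_compact_group \<Rightarrow> complex" / partial: L2_rel
proof (rule part_equivpI)
  show "\<exists>f :: 'g \<Rightarrow> complex. L2_rel f f"
    by (rule exI[of _ "\<lambda>_. 0"]) (simp add: L2_rel_def square_integrable_zero)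
  show "symp (L2_rel :: ('g \<Rightarrow> complex) \<Rightarrow> _)"
    by (simp add: symp_def L2_rel_def eq_commute)
  show "transp (L2_rel :: ('g \<Rightarrow> complex) \<Rightarrow> _)"
  proof (rule transpI)
    fix f g h :: "'g \<Rightarrow> complex"
    assume r: "L2_rel f g" "L2_rel g h"
    have "AE x in haar. f x = h x"
      using L2_relD(3)[OF r(1)] L2_relD(3)[OF r(2)] by eventually_elim simp
    then show "L2_rel f h"
      by (rule L2_relI[OF L2_relD(1)[OF r(1)] L2_relD(2)[OF r(2)]])
  qed
qed

instantiation L2 :: (locally_compact_group) real_inner
begin

lift_definition zero_L2 :: "'a L2" is "\<lambda>_. 0"
  by (simp add: L2_rel_def square_integrable_zero)
lift_definition plus_L2 :: "'a L2 \<Rightarrow> 'a L2 \<Rightarrow> 'a L2" is "\<lambda>f g x. f x + g x"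
proof -
  fix f g f' g' :: "'a \<Rightarrow> complex"
  assume r: "L2_rel f f'" "L2_rel g g'"
  have "AE x in haar. f x + g x = f' x + g' x"
    using L2_relD(3)[OF r(1)] L2_relD(3)[OF r(2)] by eventually_elim simp
  with r show "L2_rel (\<lambda>x. f x + g x) (\<lambda>x. f' x + g' x)"
    by (simp add: L2_rel_def square_integrable_add)
qed
lift_definition uminus_L2 :: "'a L2 \<Rightarrow> 'a L2" is "\<lambda>f x. - f x"
proof -
  fix f g :: "'a \<Rightarrow> complex"
  assume r: "L2_rel f g"
  have "AE x in haar. - f x = - g x"
    using L2_relD(3)[OF r] by eventually_elim simp
  with r show "L2_rel (\<lambda>x. - f x) (\<lambda>x. - g x)"
    by (simp add: L2_rel_def square_integrable_uminus)
qed
definition minus_L2 :: "'a L2 \<Rightarrow> 'a L2 \<Rightarrow> 'a L2" where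
  "minus_L2 f g = f + - g"
lift_definition scaleR_L2 :: "real \<Rightarrow> 'a L2 \<Rightarrow> 'a L2" is "\<lambda>r f x. complex_of_real r * f x"
proof -
  fix r :: real and f g :: "'a \<Rightarrow> complex"
  assume r: "L2_rel f g"
  have "AE x in haar. complex_of_real r * f x = complex_of_real r * g x"
    using L2_relD(3)[OF r] by eventually_elim simp
  with r show "L2_rel (\<lambda>x. complex_of_real r * f x) (\<lambda>x. complex_of_real r * g x)"
    by (simp add: L2_rel_def square_integrable_mult)
qed

text \<open>The real part of the complex inner product.\<close>

lift_definition inner_L2 :: "'a L2 \<Rightarrow> 'a L2 \<Rightarrow> real" is "\<lambda>f g. \<integral>x. inner (f x) (g x) \<partial>haar"
proof -
  fix f g f' g' :: "'a \<Rightarrow> complex"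
  assume r: "L2_rel f g" "L2_rel f' g'"
  note [measurable] = L2_relD(4,5)[OF r(1)] L2_relD(4,5)[OF r(2)]
  show "(\<integral>x. inner (f x) (f' x) \<partial>haar) = (\<integral>x. inner (g x) (g' x) \<partial>haar)"
  proof (rule integral_cong_AE)
    show "AE x in haar. inner (f x) (f' x) = inner (g x) (g' x)"
      using L2_relD(3)[OF r(1)] L2_relD(3)[OF r(2)] by eventually_elim simp
  qed measurable
qed
lift_definition norm_L2 :: "'a L2 \<Rightarrow> real" is "\<lambda>f. sqrt (\<integral>x. (cmod (f x))\<^sup>2 \<partial>haar)"
proof -
  fix f g :: "'a \<Rightarrow> complex"
  assume r: "L2_rel f g"
  note [measurable] = L2_relD(4,5)[OF r]
  have "(\<integral>x. (cmod (f x))\<^sup>2 \<partial>haar) = (\<integral>x. (cmod (g x))\<^sup>2 \<partial>haar)"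
  proof (rule integral_cong_AE)
    show "AE x in haar. (cmod (f x))\<^sup>2 = (cmod (g x))\<^sup>2"
      using L2_relD(3)[OF r] by eventually_elim simp
  qed measurable
  then show "sqrt (\<integral>x. (cmod (f x))\<^sup>2 \<partial>haar) = sqrt (\<integral>x. (cmod (g x))\<^sup>2 \<partial>haar)"
    by (simp only:)
qed
definition dist_L2 :: "'a L2 \<Rightarrow> 'a L2 \<Rightarrow> real" where
  "dist_L2 f g = norm (f - g)"
definition sgn_L2 :: "'a L2 \<Rightarrow> 'a L2" where
  "sgn_L2 f = inverse (norm f) *\<^sub>R f"
definition uniformity_L2 :: "('a L2 \<times> 'a L2) filter" where
  "uniformity_L2 = (INF e\<in>{0 <..}. principal {(f, g). dist f g < e})"
definition open_L2 :: "'a L2 set \<Rightarrow> bool" where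
  "open_L2 U = (\<forall>f\<in>U. \<forall>\<^sub>F (f', g) in uniformity. f' = f \<longrightarrow> g \<in> U)"

instance
proof
  fix f g h :: "'a L2" and r s :: real
  show "f + g + h = f + (g + h)"
    by (transfer, rule L2_rel_pointwiseI,
      simp add: square_integrable_intros square_integrable_L2_rel, simp add: algebra_simps)
  show "f + g = g + f"
    by (transfer, rule L2_rel_pointwiseI,
      simp add: square_integrable_intros square_integrable_L2_rel, simp add: algebra_simps)
  show "0 + f = f"
    by (transfer, rule L2_rel_pointwiseI,
      simp add: square_integrable_intros square_integrable_L2_rel, simp add: algebra_simps)
  show "- f + f = 0"
    by (transfer, rule L2_rel_pointwiseI,
      simp add: square_integrable_intros square_integrable_L2_rel, simp add: algebra_simps)
  show "r *\<^sub>R (f + g) = r *\<^sub>R f + r *\<^sub>R g"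
    by (transfer, rule L2_rel_pointwiseI,
      simp add: square_integrable_intros square_integrable_L2_rel, simp add: algebra_simps)
  show "(r + s) *\<^sub>R f = r *\<^sub>R f + s *\<^sub>R f"
    by (transfer, rule L2_rel_pointwiseI,
      simp add: square_integrable_intros square_integrable_L2_rel, simp add: algebra_simps)
  show "r *\<^sub>R s *\<^sub>R f = (r * s) *\<^sub>R f"
    by (transfer, rule L2_rel_pointwiseI,
      simp add: square_integrable_intros square_integrable_L2_rel, simp add: algebra_simps)
  show "1 *\<^sub>R f = f"
    by (transfer, rule L2_rel_pointwiseI,
      simp add: square_integrable_intros square_integrable_L2_rel, simp add: algebra_simps)
  show "f - g = f + - g" by (rule minus_L2_def)
  show "dist f g = norm (f - g)" by (rule dist_L2_def)
  show "sgn f = inverse (norm f) *\<^sub>R f" by (rule sgn_L2_def)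
  show "(uniformity :: ('a L2 \<times> 'a L2) filter)
      = (INF e\<in>{0 <..}. principal {(f, g). dist f g < e})"
    by (rule uniformity_L2_def)
  show "open U \<longleftrightarrow> (\<forall>f\<in>U. \<forall>\<^sub>F (f', g) in uniformity. f' = f \<longrightarrow> g \<in> U)" for U :: "'a L2 set"
    by (rule open_L2_def)
  show "inner f g = inner g f"
    by transfer (simp add: inner_commute)
  show "inner (f + g) h = inner f h + inner g h"
    by transfer (simp add: inner_add_left integrable_inner_L2 L2_relD(1))
  show "inner (r *\<^sub>R f) g = r * inner f g"
    by transfer (simp flip: scaleR_conv_of_real)
  show "0 \<le> inner f f"
    by transfer simp
  show "inner f f = 0 \<longleftrightarrow> f = 0"
  proof transfer
    fix f :: "'a \<Rightarrow> complex"
    assume f: "L2_rel f f"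
    then have "integrable haar (\<lambda>x. (cmod (f x))\<^sup>2)"
      by (simp add: L2_rel_def square_integrable_def)
    then have "(\<integral>x. (cmod (f x))\<^sup>2 \<partial>haar) = 0 \<longleftrightarrow> (AE x in haar. (cmod (f x))\<^sup>2 = 0)"
      by (rule integral_nonneg_eq_0_iff_AE) simp
    then show "(\<integral>x. inner (f x) (f x) \<partial>haar) = 0 \<longleftrightarrow> L2_rel f (\<lambda>_. 0)"
      using f by (simp add: power2_norm_eq_inner L2_rel_def square_integrable_zero)
  qed
  show "norm f = sqrt (inner f f)"
    by transfer (simp add: power2_norm_eq_inner)
qed

end

instantiation L2 :: (locally_compact_group) complex_normed_vector
begin

lift_definition scaleC_L2 :: "complex \<Rightarrow> 'a L2 \<Rightarrow> 'a L2" is "\<lambda>c f x. c * f x"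
proof -
  fix c :: complex and f g :: "'a \<Rightarrow> complex"
  assume r: "L2_rel f g"
  have "AE x in haar. c * f x = c * g x"
    using L2_relD(3)[OF r] by eventually_elim simp
  with r show "L2_rel (\<lambda>x. c * f x) (\<lambda>x. c * g x)"
    by (simp add: L2_rel_def square_integrable_mult)
qed

instance
proof
  fix f g :: "'a L2" and r :: real and c d :: complex
  show "c *\<^sub>C (f + g) = c *\<^sub>C f + c *\<^sub>C g"
    by (transfer, rule L2_rel_pointwiseI,
      simp add: square_integrable_intros square_integrable_L2_rel, simp add: algebra_simps)
  show "(c + d) *\<^sub>C f = c *\<^sub>C f + d *\<^sub>C f"
    by (transfer, rule L2_rel_pointwiseI,
      simp add: square_integrable_intros square_integrable_L2_rel, simp add: algebra_simps)
  show "c *\<^sub>C d *\<^sub>C f = (c * d) *\<^sub>C f"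
    by (transfer, rule L2_rel_pointwiseI,
      simp add: square_integrable_intros square_integrable_L2_rel, simp add: algebra_simps)
  show "r *\<^sub>R f = complex_of_real r *\<^sub>C f"
    by (transfer, rule L2_rel_pointwiseI,
      simp add: square_integrable_intros square_integrable_L2_rel, simp add: algebra_simps)
  show "norm (c *\<^sub>C f) = cmod c * norm f"
    by transfer (simp add: norm_mult power_mult_distrib real_sqrt_mult)
qed

end

section \<open>Convolution and the left regular representation\<close>

text \<open>In multiplicative notation, \<open>(f * h)(x) = \<integral> f(y) h(y\<^sup>-\<^sup>1 x) dy\<close>.\<close>

definition convolution ::
  "('g::locally_compact_group \<Rightarrow> complex) \<Rightarrow> ('g \<Rightarrow> complex) \<Rightarrow> 'g \<Rightarrow> complex" where
  "convolution f h x = (\<integral>y. f y * h (- y + x) \<partial>haar)"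

lemma measurable_translate_pair [measurable (raw)]:
  fixes h :: "'g::{locally_compact_group, second_countable_topology} \<Rightarrow> 'b::topological_space"
  assumes "h \<in> borel_measurable haar" "a \<in> measurable M haar" "b \<in> measurable M haar"
  shows "(\<lambda>p. h (- a p + b p)) \<in> borel_measurable M"
proof -
  have h: "h \<in> borel_measurable borel"
    using assms(1) by (simp add: measurable_cong_sets[OF sets_haar refl])
  have t: "(\<lambda>p. - fst p + snd p) \<in> borel_measurable (borel \<Otimes>\<^sub>M (borel :: 'g measure))"
    unfolding borel_prod by (rule borel_measurable_continuous_onI[OF continuous_left_translation])
  have ab: "(\<lambda>p. (a p, b p)) \<in> measurable M (borel \<Otimes>\<^sub>M borel)"
    using assms(2,3) by (intro measurable_Pair) (simp_all add: measurable_cong_sets[OF refl sets_haar])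
  show ?thesis
    using measurable_compose[OF measurable_compose[OF ab t] h] by simp
qed

context
  fixes f h :: "'g::{locally_compact_group, second_countable_topology} \<Rightarrow> complex"
  assumes f [measurable]: "f \<in> borel_measurable haar"
    and h [measurable]: "h \<in> borel_measurable haar"
begin

lemma convolution_nn_bound:
  "(\<integral>\<^sup>+x. (\<integral>\<^sup>+y. ennreal (cmod (f y * h (- y + x))) \<partial>haar)\<^sup>2 \<partial>haar)
    \<le> (\<integral>\<^sup>+y. ennreal (cmod (f y)) \<partial>haar)\<^sup>2 * (\<integral>\<^sup>+x. ennreal ((cmod (h x))\<^sup>2) \<partial>haar)"
    (is "?L \<le> ?F\<^sup>2 * ?H")
proof -
  interpret haar: sigma_finite_measure "haar :: 'g measure" by (rule sigma_finite_haar)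
  interpret P: pair_sigma_finite "haar :: 'g measure" "haar :: 'g measure" ..
  have CS: "(\<integral>\<^sup>+y. ennreal (cmod (f y * h (- y + x))) \<partial>haar)\<^sup>2
      \<le> ?F * (\<integral>\<^sup>+y. ennreal (cmod (f y) * (cmod (h (- y + x)))\<^sup>2) \<partial>haar)" for x
  proof -
    have "(\<integral>\<^sup>+y. ennreal (cmod (f y * h (- y + x))) \<partial>haar)
        = (\<integral>\<^sup>+y. ennreal (sqrt (cmod (f y))) * ennreal (sqrt (cmod (f y)) * cmod (h (- y + x))) \<partial>haar)"
      by (intro nn_integral_cong)
        (simp add: norm_mult ennreal_mult[symmetric] mult.assoc[symmetric])
    also have "\<dots>\<^sup>2 \<le> (\<integral>\<^sup>+y. (ennreal (sqrt (cmod (f y))))\<^sup>2 \<partial>haar)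
        * (\<integral>\<^sup>+y. (ennreal (sqrt (cmod (f y)) * cmod (h (- y + x))))\<^sup>2 \<partial>haar)"
      by (rule Cauchy_Schwarz_nn_integral) measurable
    also have "\<dots> = ?F * (\<integral>\<^sup>+y. ennreal (cmod (f y) * (cmod (h (- y + x)))\<^sup>2) \<partial>haar)"
      by (simp add: ennreal_power power_mult_distrib)
    finally show ?thesis .
  qed
  have "?L \<le> (\<integral>\<^sup>+x. ?F * (\<integral>\<^sup>+y. ennreal (cmod (f y) * (cmod (h (- y + x)))\<^sup>2) \<partial>haar) \<partial>haar)"
    by (intro nn_integral_mono CS)
  also have "\<dots> = ?F * (\<integral>\<^sup>+x. \<integral>\<^sup>+y. ennreal (cmod (f y) * (cmod (h (- y + x)))\<^sup>2) \<partial>haar \<partial>haar)"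
    by (rule nn_integral_cmult) measurable
  also have "(\<integral>\<^sup>+x. \<integral>\<^sup>+y. ennreal (cmod (f y) * (cmod (h (- y + x)))\<^sup>2) \<partial>haar \<partial>haar)
      = (\<integral>\<^sup>+y. \<integral>\<^sup>+x. ennreal (cmod (f y) * (cmod (h (- y + x)))\<^sup>2) \<partial>haar \<partial>haar)"
    by (rule P.Fubini') measurable
  also have "\<dots> = (\<integral>\<^sup>+y. ennreal (cmod (f y)) * ?H \<partial>haar)"
  proof (rule nn_integral_cong)
    fix y
    have hb: "(\<lambda>x. ennreal ((cmod (h x))\<^sup>2)) \<in> borel_measurable borel"
      using h by (simp add: measurable_cong_sets[OF sets_haar refl])
    have "(\<integral>\<^sup>+x. ennreal (cmod (f y) * (cmod (h (- y + x)))\<^sup>2) \<partial>haar)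
        = (\<integral>\<^sup>+x. ennreal (cmod (f y)) * ennreal ((cmod (h (- y + x)))\<^sup>2) \<partial>haar)"
      by (simp add: ennreal_mult)
    also have "\<dots> = ennreal (cmod (f y)) * (\<integral>\<^sup>+x. ennreal ((cmod (h (- y + x)))\<^sup>2) \<partial>haar)"
      by (rule nn_integral_cmult) measurable
    also have "(\<integral>\<^sup>+x. ennreal ((cmod (h (- y + x)))\<^sup>2) \<partial>haar) = ?H"
      by (rule nn_integral_haar_translate[OF hb])
    finally show "(\<integral>\<^sup>+x. ennreal (cmod (f y) * (cmod (h (- y + x)))\<^sup>2) \<partial>haar)
        = ennreal (cmod (f y)) * ?H" .
  qed
  also have "\<dots> = ?F * ?H"
    by (rule nn_integral_multc) measurable
  finally show ?thesis
    by (simp add: power2_eq_square mult.assoc)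
qed

lemma measurable_convolution: "convolution f h \<in> borel_measurable haar"
proof -
  interpret haar: sigma_finite_measure "haar :: 'g measure" by (rule sigma_finite_haar)
  show ?thesis unfolding convolution_def[abs_def] by measurable
qed

lemma convolution_le_nn:
  "ennreal (cmod (convolution f h x)) \<le> (\<integral>\<^sup>+y. ennreal (cmod (f y * h (- y + x))) \<partial>haar)"
proof (cases "integrable haar (\<lambda>y. f y * h (- y + x))")
  case True
  then show ?thesis unfolding convolution_def by (rule integral_norm_bound_ennreal)
next
  case False
  then show ?thesis by (simp add: convolution_def not_integrable_integral_eq)
qed

end

context
  fixes f h :: "'g::{locally_compact_group, second_countable_topology} \<Rightarrow> complex"
  assumes f: "integrable haar f" and h: "square_integrable h"
begin

lemma nn_bound_convolution_sq:
  "(\<integral>\<^sup>+x. (\<integral>\<^sup>+y. ennreal (cmod (f y * h (- y + x))) \<partial>haar)\<^sup>2 \<partial>haar)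
    \<le> ennreal ((\<integral>y. cmod (f y) \<partial>haar)\<^sup>2 * (\<integral>x. (cmod (h x))\<^sup>2 \<partial>haar))"
proof -
  have "(\<integral>\<^sup>+y. ennreal (cmod (f y)) \<partial>haar) = ennreal (\<integral>y. cmod (f y) \<partial>haar)"
    by (rule nn_integral_eq_integral) (use f in simp_all)
  moreover have "(\<integral>\<^sup>+x. ennreal ((cmod (h x))\<^sup>2) \<partial>haar) = ennreal (\<integral>x. (cmod (h x))\<^sup>2 \<partial>haar)"
    by (rule nn_integral_eq_integral) (use h in \<open>simp_all add: square_integrable_def\<close>)
  ultimately show ?thesis
    using convolution_nn_bound[of f h] f h
    by (simp add: square_integrable_def borel_measurable_integrable ennreal_power ennreal_mult)
qed

lemma AE_integrable_convolution: "AE x in haar. integrable haar (\<lambda>y. f y * h (- y + x))"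
proof -
  interpret haar: sigma_finite_measure "haar :: 'g measure" by (rule sigma_finite_haar)
  have [measurable]: "f \<in> borel_measurable haar" "h \<in> borel_measurable haar"
    using f h by (auto simp: square_integrable_def)
  have "AE x in haar. (\<integral>\<^sup>+y. ennreal (cmod (f y * h (- y + x))) \<partial>haar)\<^sup>2 \<noteq> \<infinity>"
  proof (rule nn_integral_PInf_AE)
    show "(\<integral>\<^sup>+x. (\<integral>\<^sup>+y. ennreal (cmod (f y * h (- y + x))) \<partial>haar)\<^sup>2 \<partial>haar) \<noteq> \<infinity>"
      using nn_bound_convolution_sq by (auto simp: top_unique)
  qed measurable
  then show ?thesis
  proof eventually_elim
    fix x
    assume "(\<integral>\<^sup>+y. ennreal (cmod (f y * h (- y + x))) \<partial>haar)\<^sup>2 \<noteq> \<infinity>"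
    then have "(\<integral>\<^sup>+y. ennreal (cmod (f y * h (- y + x))) \<partial>haar) < \<infinity>"
      by (auto simp: less_top[symmetric] power_eq_top_ennreal)
    moreover have "(\<lambda>y. f y * h (- y + x)) \<in> borel_measurable haar" by measurable
    ultimately show "integrable haar (\<lambda>y. f y * h (- y + x))"
      by (simp add: integrable_iff_bounded)
  qed
qed

lemma nn_convolution_sq:
  "(\<integral>\<^sup>+x. ennreal ((cmod (convolution f h x))\<^sup>2) \<partial>haar)
    \<le> ennreal ((\<integral>y. cmod (f y) \<partial>haar)\<^sup>2 * (\<integral>x. (cmod (h x))\<^sup>2 \<partial>haar))"
proof -
  have m: "f \<in> borel_measurable haar" "h \<in> borel_measurable haar"
    using f h by (auto simp: square_integrable_def)
  have "(\<integral>\<^sup>+x. ennreal ((cmod (convolution f h x))\<^sup>2) \<partial>haar)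
      \<le> (\<integral>\<^sup>+x. (\<integral>\<^sup>+y. ennreal (cmod (f y * h (- y + x))) \<partial>haar)\<^sup>2 \<partial>haar)"
    unfolding ennreal_power[OF norm_ge_zero, symmetric]
    by (intro nn_integral_mono power_mono convolution_le_nn m) simp
  also note nn_bound_convolution_sq
  finally show ?thesis .
qed

lemma square_integrable_convolution: "square_integrable (convolution f h)"
proof -
  have [measurable]: "convolution f h \<in> borel_measurable haar"
    using f h by (intro measurable_convolution) (auto simp: square_integrable_def)
  have "integrable haar (\<lambda>x. (cmod (convolution f h x))\<^sup>2)"
    unfolding integrable_iff_bounded
    using le_less_trans[OF nn_convolution_sq ennreal_less_top] by simp
  then show ?thesis by (simp add: square_integrable_def)
qed

lemma integral_convolution_sq:
  "(\<integral>x. (cmod (convolution f h x))\<^sup>2 \<partial>haar)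
    \<le> (\<integral>y. cmod (f y) \<partial>haar)\<^sup>2 * (\<integral>x. (cmod (h x))\<^sup>2 \<partial>haar)"
proof -
  have "(\<integral>\<^sup>+x. ennreal ((cmod (convolution f h x))\<^sup>2) \<partial>haar)
      = ennreal (\<integral>x. (cmod (convolution f h x))\<^sup>2 \<partial>haar)"
    by (rule nn_integral_eq_integral)
      (use square_integrable_convolution in \<open>simp_all add: square_integrable_def\<close>)
  then show ?thesis
    using nn_convolution_sq by (simp add: ennreal_le_iff)
qed

end

lemma convolution_mult_right: "convolution f (\<lambda>x. c * h x) x = c * convolution f h x"
  by (simp add: convolution_def mult.left_commute[of _ c])

lemma convolution_mult_left: "convolution (\<lambda>x. c * f x) h x = c * convolution f h x"
  by (simp add: convolution_def mult.assoc)

lemma convolution_add_right: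
  fixes f :: "'g::{locally_compact_group, second_countable_topology} \<Rightarrow> complex"
  assumes "integrable haar f" "square_integrable h" "square_integrable k"
  shows "AE x in haar. convolution f (\<lambda>x. h x + k x) x = convolution f h x + convolution f k x"
  using AE_integrable_convolution[OF assms(1,2)] AE_integrable_convolution[OF assms(1,3)]
  by eventually_elim (simp add: convolution_def distrib_left)

lemma convolution_add_left:
  fixes f :: "'g::{locally_compact_group, second_countable_topology} \<Rightarrow> complex"
  assumes "integrable haar f" "integrable haar g" "square_integrable h"
  shows "AE x in haar. convolution (\<lambda>x. f x + g x) h x = convolution f h x + convolution g h x"
  using AE_integrable_convolution[OF assms(1,3)] AE_integrable_convolution[OF assms(2,3)]
  by eventually_elim (simp add: convolution_def distrib_right)

lemma L2_rel_convolution: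
  fixes f :: "'g::{locally_compact_group, second_countable_topology} \<Rightarrow> complex"
  assumes f: "integrable haar f" and r: "L2_rel h k"
  shows "L2_rel (convolution f h) (convolution f k)"
proof -
  note h = L2_relD(1)[OF r] and k = L2_relD(2)[OF r]
  define d where "d x = h x + (- 1) * k x" for x
  have d: "square_integrable d"
    unfolding d_def[abs_def] by (intro square_integrable_add square_integrable_mult h k)
  have "AE x in haar. (cmod (d x))\<^sup>2 = 0"
    using L2_relD(3)[OF r] by eventually_elim (simp add: d_def)
  then have "(\<integral>x. (cmod (d x))\<^sup>2 \<partial>haar) = 0"
    by (rule integral_eq_zero_AE)
  then have "(\<integral>x. (cmod (convolution f d x))\<^sup>2 \<partial>haar) \<le> 0"
    using integral_convolution_sq[OF f d] by simp
  then have "(\<integral>x. (cmod (convolution f d x))\<^sup>2 \<partial>haar) = 0"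
    by (intro antisym integral_nonneg_AE) simp_all
  then have zero: "AE x in haar. (cmod (convolution f d x))\<^sup>2 = 0"
    using square_integrable_convolution[OF f d]
    by (subst (asm) integral_nonneg_eq_0_iff_AE) (simp_all add: square_integrable_def)
  have "(\<lambda>x. d x + k x) = h"
    by (simp add: d_def fun_eq_iff)
  then have sum: "AE x in haar. convolution f h x = convolution f d x + convolution f k x"
    using convolution_add_right[OF f d k] by (simp only:)
  from zero sum have "AE x in haar. convolution f h x = convolution f k x"
    by eventually_elim simp
  then show ?thesis
    by (intro L2_relI square_integrable_convolution f h k)
qed

text \<open>The value for non-integrable \<open>f\<close> is immaterial: only \<open>L\<^sup>1\<close> functions are used.\<close>

lift_definition convolve_L2 ::
  "('g::{locally_compact_group, second_countable_topology} \<Rightarrow> complex) \<Rightarrow> 'g L2 \<Rightarrow> 'g L2"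
  is "\<lambda>f h. if integrable haar f then convolution f h else (\<lambda>_. 0)"
proof -
  fix f h k :: "'g \<Rightarrow> complex"
  assume r: "L2_rel h k"
  show "L2_rel (if integrable haar f then convolution f h else (\<lambda>_. 0))
      (if integrable haar f then convolution f k else (\<lambda>_. 0))"
  proof (cases "integrable haar f")
    case True
    then show ?thesis by (simp only: if_True) (rule L2_rel_convolution[OF True r])
  next
    case False
    then show ?thesis
      by (simp only: if_False) (rule L2_rel_pointwiseI[OF square_integrable_zero refl])
  qed
qed

lemma convolve_L2_add:
  "convolve_L2 f (h + k) = convolve_L2 f h + convolve_L2 f k"
proof (cases "integrable haar f")
  case True
  then show ?thesis
  proof transfer
    fix f h k :: "'a \<Rightarrow> complex"
    assume f: "integrable haar f" and "L2_rel h h" "L2_rel k k"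
    then have hk: "square_integrable h" "square_integrable k"
      by (simp_all add: square_integrable_L2_rel)
    have "L2_rel (convolution f (\<lambda>x. h x + k x)) (\<lambda>x. convolution f h x + convolution f k x)"
      by (rule L2_relI[OF square_integrable_convolution[OF f square_integrable_add[OF hk]]
            square_integrable_add[OF square_integrable_convolution[OF f hk(1)]
              square_integrable_convolution[OF f hk(2)]]
            convolution_add_right[OF f hk]])
    with f show "L2_rel (if integrable haar f then convolution f (\<lambda>x. h x + k x) else (\<lambda>_. 0))
        (\<lambda>x. (if integrable haar f then convolution f h else (\<lambda>_. 0)) x +
             (if integrable haar f then convolution f k else (\<lambda>_. 0)) x)"
      by (simp only: if_True)
  qed
next
  case False
  then show ?thesis
  proof transfer
    fix f h k :: "'a \<Rightarrow> complex"
    assume "\<not> integrable haar f"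
    then show "L2_rel (if integrable haar f then convolution f (\<lambda>x. h x + k x) else (\<lambda>_. 0))
        (\<lambda>x. (if integrable haar f then convolution f h else (\<lambda>_. 0)) x +
             (if integrable haar f then convolution f k else (\<lambda>_. 0)) x)"
      by (simp only: if_False add_0_left) (rule L2_rel_pointwiseI[OF square_integrable_zero refl])
  qed
qed

lemma convolve_L2_scaleC:
  "convolve_L2 f (c *\<^sub>C h) = c *\<^sub>C convolve_L2 f h"
proof transfer
  fix f h :: "'a \<Rightarrow> complex" and c :: complex
  assume "L2_rel h h"
  then have h: "square_integrable h" by (rule square_integrable_L2_rel)
  show "L2_rel (if integrable haar f then convolution f (\<lambda>x. c * h x) else (\<lambda>_. 0))
      (\<lambda>x. c * (if integrable haar f then convolution f h else (\<lambda>_. 0)) x)"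
  proof (rule L2_rel_pointwiseI)
    show "square_integrable (if integrable haar f then convolution f (\<lambda>x. c * h x) else (\<lambda>_. 0))"
      using square_integrable_convolution[OF _ square_integrable_mult[OF h]]
      by (simp add: square_integrable_zero)
  qed (simp add: convolution_mult_right)
qed

lemma norm_convolve_L2:
  "norm (convolve_L2 f h) \<le> norm h * (\<integral>x. cmod (f x) \<partial>haar)"
proof transfer
  fix f h :: "'a \<Rightarrow> complex"
  assume h: "L2_rel h h"
  show "sqrt (\<integral>x. (cmod ((if integrable haar f then convolution f h else (\<lambda>_. 0)) x))\<^sup>2 \<partial>haar)
      \<le> sqrt (\<integral>x. (cmod (h x))\<^sup>2 \<partial>haar) * (\<integral>x. cmod (f x) \<partial>haar)"
  proof (cases "integrable haar f")
    case True
    have "sqrt (\<integral>x. (cmod (convolution f h x))\<^sup>2 \<partial>haar)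
        \<le> sqrt ((\<integral>y. cmod (f y) \<partial>haar)\<^sup>2 * (\<integral>x. (cmod (h x))\<^sup>2 \<partial>haar))"
      by (intro real_sqrt_le_mono integral_convolution_sq True L2_relD(1)[OF h])
    also have "\<dots> = sqrt (\<integral>x. (cmod (h x))\<^sup>2 \<partial>haar) * (\<integral>x. cmod (f x) \<partial>haar)"
      by (simp add: real_sqrt_mult)
    finally show ?thesis using True by simp
  next
    case False
    then show ?thesis by simp
  qed
qed

lemma bounded_linear_convolve_L2: "bounded_linear (convolve_L2 f)"
  by (rule bounded_linear_intro[OF convolve_L2_add _ norm_convolve_L2])
    (simp add: scaleR_scaleC convolve_L2_scaleC)

lift_definition left_regular ::
  "('g::{locally_compact_group, second_countable_topology} \<Rightarrow> complex) \<Rightarrow> ('g L2, 'g L2) cblinfun"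
  is "\<lambda>f. Blinfun (convolve_L2 f)"
  by (simp add: bounded_linear_Blinfun_apply bounded_linear_convolve_L2 convolve_L2_scaleC)

lemma left_regular_apply: "cblinfun_apply (left_regular f) h = convolve_L2 f h"
  by transfer (simp add: bounded_linear_Blinfun_apply bounded_linear_convolve_L2)

lemma cblinfun_eqI: "(\<And>x. cblinfun_apply S x = cblinfun_apply T x) \<Longrightarrow> S = T"
  by transfer (rule blinfun_eqI)

lemma cblinfun_add_apply: "cblinfun_apply (S + T) x = cblinfun_apply S x + cblinfun_apply T x"
  by transfer (rule blinfun.add_left)

lemma cblinfun_scaleC_apply: "cblinfun_apply (c *\<^sub>C S) x = c *\<^sub>C cblinfun_apply S x"
  by transfer (rule Blinfun_scaleC_apply)

lemma left_regular_add:
  assumes "integrable haar f" "integrable haar g"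
  shows "left_regular (\<lambda>x. f x + g x) = left_regular f + left_regular g"
proof (rule cblinfun_eqI)
  fix h
  have "convolve_L2 (\<lambda>x. f x + g x) h = convolve_L2 f h + convolve_L2 g h"
    using assms
  proof transfer
    fix f g h :: "'a \<Rightarrow> complex"
    assume f: "integrable haar f" and g: "integrable haar g" and "L2_rel h h"
    then have h: "square_integrable h" by (simp add: square_integrable_L2_rel)
    have fg: "integrable haar (\<lambda>x. f x + g x)"
      by (rule Bochner_Integration.integrable_add[OF f g])
    have "L2_rel (convolution (\<lambda>x. f x + g x) h) (\<lambda>x. convolution f h x + convolution g h x)"
      by (rule L2_relI[OF square_integrable_convolution[OF fg h]
            square_integrable_add[OF square_integrable_convolution[OF f h]
              square_integrable_convolution[OF g h]]
            convolution_add_left[OF f g h]])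
    with f g fg
    show "L2_rel (if integrable haar (\<lambda>x. f x + g x) then convolution (\<lambda>x. f x + g x) h else (\<lambda>_. 0))
        (\<lambda>x. (if integrable haar f then convolution f h else (\<lambda>_. 0)) x +
             (if integrable haar g then convolution g h else (\<lambda>_. 0)) x)"
      by (simp only: if_True)
  qed
  then show "cblinfun_apply (left_regular (\<lambda>x. f x + g x)) h
      = cblinfun_apply (left_regular f + left_regular g) h"
    by (simp only: left_regular_apply cblinfun_add_apply)
qed

lemma left_regular_mult:
  assumes "integrable haar f"
  shows "left_regular (\<lambda>x. c * f x) = c *\<^sub>C left_regular f"
proof (rule cblinfun_eqI)
  fix h
  have "convolve_L2 (\<lambda>x. c * f x) h = c *\<^sub>C convolve_L2 f h"
    using assms
  proof transfer
    fix f h :: "'a \<Rightarrow> complex" and c :: complex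
    assume f: "integrable haar f" and "L2_rel h h"
    then have h: "square_integrable h" by (simp add: square_integrable_L2_rel)
    have cf: "integrable haar (\<lambda>x. c * f x)"
      by (rule integrable_mult_right[OF f])
    have "L2_rel (convolution (\<lambda>x. c * f x) h) (\<lambda>x. c * convolution f h x)"
      by (rule L2_rel_pointwiseI[OF square_integrable_convolution[OF cf h] convolution_mult_left])
    with f cf
    show "L2_rel (if integrable haar (\<lambda>x. c * f x) then convolution (\<lambda>x. c * f x) h else (\<lambda>_. 0))
        (\<lambda>x. c * (if integrable haar f then convolution f h else (\<lambda>_. 0)) x)"
      by (simp only: if_True)
  qed
  then show "cblinfun_apply (left_regular (\<lambda>x. c * f x)) h
      = cblinfun_apply (c *\<^sub>C left_regular f) h"
    by (simp only: left_regular_apply cblinfun_scaleC_apply)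
qed


section \<open>The reduced group C*-algebra and the reduced Fourier--Stieltjes algebra\<close>

definition reduced_cstar_operators ::
  "('g::{locally_compact_group, second_countable_topology} L2, 'g L2) cblinfun set" where
  "reduced_cstar_operators = closure (left_regular ` {f. integrable haar f})"

lemma reduced_cstar_zero: "0 \<in> reduced_cstar_operators"
proof -
  have "left_regular (\<lambda>x. 0 * 0) = 0 *\<^sub>C left_regular (\<lambda>_. 0)"
    by (rule left_regular_mult) simp
  also have "\<dots> = 0"
    using scaleR_scaleC[of 0 "left_regular (\<lambda>_. 0)"] by simp
  finally have "left_regular (\<lambda>_. 0) = 0" by simp
  then have "0 \<in> left_regular ` {f. integrable haar f}"
    by (intro image_eqI[of _ _ "\<lambda>_. 0"]) simp_all
  then show ?thesis
    unfolding reduced_cstar_operators_def by (rule subsetD[OF closure_subset])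
qed

lemma reduced_cstar_add:
  assumes "S \<in> reduced_cstar_operators" "T \<in> reduced_cstar_operators"
  shows "S + T \<in> reduced_cstar_operators"
proof -
  obtain s t where s: "\<And>n. s n \<in> left_regular ` {f. integrable haar f}" "s \<longlonglongrightarrow> S"
    and t: "\<And>n. t n \<in> left_regular ` {f. integrable haar f}" "t \<longlonglongrightarrow> T"
    using assms unfolding reduced_cstar_operators_def closure_sequential by blast
  have "s n + t n \<in> left_regular ` {f. integrable haar f}" for n
  proof -
    obtain f g where "integrable haar f" "s n = left_regular f" "integrable haar g" "t n = left_regular g"
      using s(1)[of n] t(1)[of n] by blast
    then show ?thesis
      by (intro image_eqI[of _ _ "\<lambda>x. f x + g x"]) (simp_all add: left_regular_add)
  qed
  moreover have "(\<lambda>n. s n + t n) \<longlonglongrightarrow> S + T"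
    by (rule tendsto_add[OF s(2) t(2)])
  ultimately have "\<exists>u. (\<forall>n. u n \<in> left_regular ` {f. integrable haar f}) \<and> u \<longlonglongrightarrow> S + T"
    by (intro exI[of _ "\<lambda>n. s n + t n"] conjI allI)
  then show ?thesis
    unfolding reduced_cstar_operators_def closure_sequential .
qed

lemma reduced_cstar_scaleC:
  assumes "S \<in> reduced_cstar_operators"
  shows "c *\<^sub>C S \<in> reduced_cstar_operators"
proof -
  obtain s where s: "\<And>n. s n \<in> left_regular ` {f. integrable haar f}" "s \<longlonglongrightarrow> S"
    using assms unfolding reduced_cstar_operators_def closure_sequential by blast
  have "c *\<^sub>C s n \<in> left_regular ` {f. integrable haar f}" for n
  proof -
    obtain f where "integrable haar f" "s n = left_regular f"
      using s(1)[of n] by blast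
    then show ?thesis
      by (intro image_eqI[of _ _ "\<lambda>x. c * f x"]) (simp_all add: left_regular_mult)
  qed
  moreover have "(\<lambda>n. c *\<^sub>C s n) \<longlonglongrightarrow> c *\<^sub>C S"
    by (rule bounded_linear.tendsto[OF bounded_linear_scaleC s(2)])
  ultimately have "\<exists>u. (\<forall>n. u n \<in> left_regular ` {f. integrable haar f}) \<and> u \<longlonglongrightarrow> c *\<^sub>C S"
    by (intro exI[of _ "\<lambda>n. c *\<^sub>C s n"] conjI allI)
  then show ?thesis
    unfolding reduced_cstar_operators_def closure_sequential .
qed

lemma reduced_cstar_scaleR:
  "S \<in> reduced_cstar_operators \<Longrightarrow> r *\<^sub>R S \<in> reduced_cstar_operators"
  unfolding scaleR_scaleC by (rule reduced_cstar_scaleC)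

lemma reduced_cstar_uminus:
  "S \<in> reduced_cstar_operators \<Longrightarrow> - S \<in> reduced_cstar_operators"
  using reduced_cstar_scaleR[of S "- 1"] by simp

lemma reduced_cstar_minus:
  "S \<in> reduced_cstar_operators \<Longrightarrow> T \<in> reduced_cstar_operators \<Longrightarrow> S - T \<in> reduced_cstar_operators"
  unfolding diff_conv_add_uminus by (intro reduced_cstar_add reduced_cstar_uminus)

typedef (overloaded) 'g reduced_cstar =
  "reduced_cstar_operators ::
     ('g::{locally_compact_group, second_countable_topology} L2, 'g L2) cblinfun set"
  using reduced_cstar_zero by blast

setup_lifting type_definition_reduced_cstar

instantiation reduced_cstar ::
  ("{locally_compact_group, second_countable_topology}") complex_normed_vector
begin

lift_definition zero_reduced_cstar :: "'a reduced_cstar" is 0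
  by (rule reduced_cstar_zero)
lift_definition plus_reduced_cstar ::
  "'a reduced_cstar \<Rightarrow> 'a reduced_cstar \<Rightarrow> 'a reduced_cstar" is "(+)"
  by (rule reduced_cstar_add)
lift_definition minus_reduced_cstar ::
  "'a reduced_cstar \<Rightarrow> 'a reduced_cstar \<Rightarrow> 'a reduced_cstar" is "(-)"
  by (rule reduced_cstar_minus)
lift_definition uminus_reduced_cstar :: "'a reduced_cstar \<Rightarrow> 'a reduced_cstar" is uminus
  by (rule reduced_cstar_uminus)
lift_definition scaleR_reduced_cstar ::
  "real \<Rightarrow> 'a reduced_cstar \<Rightarrow> 'a reduced_cstar" is scaleR
  by (rule reduced_cstar_scaleR)
lift_definition scaleC_reduced_cstar ::
  "complex \<Rightarrow> 'a reduced_cstar \<Rightarrow> 'a reduced_cstar" is scaleC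
  by (rule reduced_cstar_scaleC)
lift_definition norm_reduced_cstar :: "'a reduced_cstar \<Rightarrow> real" is norm .

definition dist_reduced_cstar :: "'a reduced_cstar \<Rightarrow> 'a reduced_cstar \<Rightarrow> real" where
  "dist_reduced_cstar S T = norm (S - T)"
definition sgn_reduced_cstar :: "'a reduced_cstar \<Rightarrow> 'a reduced_cstar" where
  "sgn_reduced_cstar S = inverse (norm S) *\<^sub>R S"
definition uniformity_reduced_cstar :: "('a reduced_cstar \<times> 'a reduced_cstar) filter" where
  "uniformity_reduced_cstar = (INF e\<in>{0 <..}. principal {(S, T). dist S T < e})"
definition open_reduced_cstar :: "'a reduced_cstar set \<Rightarrow> bool" where
  "open_reduced_cstar U = (\<forall>S\<in>U. \<forall>\<^sub>F (S', T) in uniformity. S' = S \<longrightarrow> T \<in> U)"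

instance
proof
  fix S T U :: "'a reduced_cstar" and r s :: real and c d :: complex
  show "S + T + U = S + (T + U)" by transfer (rule add.assoc)
  show "S + T = T + S" by transfer (rule add.commute)
  show "0 + S = S" by transfer (rule add_0)
  show "- S + S = 0" by transfer (rule left_minus)
  show "S - T = S + - T" by transfer (rule diff_conv_add_uminus)
  show "r *\<^sub>R (S + T) = r *\<^sub>R S + r *\<^sub>R T" by transfer (rule scaleR_add_right)
  show "(r + s) *\<^sub>R S = r *\<^sub>R S + s *\<^sub>R S" by transfer (rule scaleR_add_left)
  show "r *\<^sub>R s *\<^sub>R S = (r * s) *\<^sub>R S" by transfer (rule scaleR_scaleR)
  show "1 *\<^sub>R S = S" by transfer (rule scaleR_one)
  show "dist S T = norm (S - T)" by (rule dist_reduced_cstar_def)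
  show "sgn S = inverse (norm S) *\<^sub>R S" by (rule sgn_reduced_cstar_def)
  show "(uniformity :: ('a reduced_cstar \<times> 'a reduced_cstar) filter)
      = (INF e\<in>{0 <..}. principal {(S, T). dist S T < e})"
    by (rule uniformity_reduced_cstar_def)
  show "open V \<longleftrightarrow> (\<forall>S\<in>V. \<forall>\<^sub>F (S', T) in uniformity. S' = S \<longrightarrow> T \<in> V)"
    for V :: "'a reduced_cstar set"
    by (rule open_reduced_cstar_def)
  show "norm S = 0 \<longleftrightarrow> S = 0" by transfer (rule norm_eq_zero)
  show "norm (S + T) \<le> norm S + norm T" by transfer (rule norm_triangle_ineq)
  show "norm (r *\<^sub>R S) = \<bar>r\<bar> * norm S" by transfer (rule norm_scaleR)
  show "c *\<^sub>C (S + T) = c *\<^sub>C S + c *\<^sub>C T" by transfer (rule scaleC_add_right)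
  show "(c + d) *\<^sub>C S = c *\<^sub>C S + d *\<^sub>C S" by transfer (rule scaleC_add_left)
  show "c *\<^sub>C d *\<^sub>C S = (c * d) *\<^sub>C S" by transfer (rule scaleC_scaleC)
  show "r *\<^sub>R S = complex_of_real r *\<^sub>C S" by transfer (rule scaleR_scaleC)
  show "norm (c *\<^sub>C S) = cmod c * norm S" by transfer (rule norm_scaleC)
qed

end

type_synonym 'g reduced_fourier_stieltjes = "'g reduced_cstar cdual"

end

theory Submission
  imports Defs
begin

text \<open>
  Take a strictly positive integrable \<open>k\<close> with \<open>k dx\<close> invariant under inversion, scaled so that the
  self-adjoint operator \<open>K = \<rho>(k)\<close> has norm one, and put \<open>T = K\<^sup>2\<close>.
  If 1 were an eigenvalue of \<open>T\<close>, a Perron--Frobenius argument would give an a.e. positive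
  \<open>p \<in> L\<^sup>2\<close> with \<open>K p = p\<close>, unique up to scaling. As \<open>K\<close> commutes with right translations, almost all
  right translates of \<open>p\<close> are multiples of \<open>p\<close>; with left invariance of the Haar measure this
  makes \<open>p\<close> constant, so the Haar measure is finite and \<open>G\<close> is compact.
  For noncompact \<open>G\<close> therefore 1 is in the spectrum of \<open>T\<close> but not an eigenvalue, so \<open>T\<^sup>n \<rightarrow> 0\<close> strongly
  although \<open>T\<^sup>n\<close> has norm one. Differences \<open>T\<^sup>n - T\<^sup>m\<close> then supply approximately orthogonal vector states
  \<open>\<phi> j\<close> that drift towards the top of the spectrum and move to distance 2 from every point of a weak*
  closed convex set \<open>C\<close> containing them: for the tails of \<open>\<phi>\<close>, the asymptotic center in \<open>C\<close> is
  all of \<open>C\<close>, which is not norm compact.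
\<close>

section \<open>Functionals on complex normed spaces and asymptotic centers\<close>

text \<open>The algebra has in general no unit, so weak* limits of states may lose mass. The set
  \<open>C\<close> is therefore cut out by the conditions that \<open>1 - U ^^ Suc k\<close>, with
  \<open>U = 1 - T\<close>, has value at least \<open>1 - \<delta> k\<close>; these elements are
  polynomials in \<open>T\<close> without constant term, hence lie in the algebra. The conditions
  can be imposed only with a \<open>\<delta>\<close> common to all states of the sequence, which is
  why the vectors are taken in the range of \<open>T\<close>. The number 2 arises because the
  self-adjoint contraction \<open>1 - U ^^ Suc k - 2 b j\<close> has value near -1 at
  \<open>\<phi> j\<close> and near 1 at any fixed point of \<open>C\<close>, for large
  \<open>j\<close> and \<open>k\<close>. Squaring \<open>K\<close> gives
  \<open>0 \<le> T \<le> 1\<close>, so the spectral theorem can be replaced by scalar inequalities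
  for polynomials on the unit interval, each proved for quadratic forms by algebraic identities.
  That 1 is in the spectrum enters as the existence of unit vectors with
  \<open>inner (T x) x\<close> arbitrarily near 1.\<close>

lemma cblinfun_diff_apply: "cblinfun_apply (S - T) x = cblinfun_apply S x - cblinfun_apply T x"
  by transfer (rule blinfun.diff_left)

lemma bounded_linear_cblinfun_apply: "bounded_linear (cblinfun_apply T)"
  by transfer (rule blinfun.bounded_linear_right)

lemmas cblinfun_apply_simps =
  linear_simps[OF bounded_linear_cblinfun_apply]
  linear_sum[OF bounded_linear.linear[OF bounded_linear_cblinfun_apply]]

lemma norm_cblinfun: "norm (cblinfun_apply T x) \<le> norm T * norm x"
  by transfer (rule norm_blinfun)

lemma norm_cblinfun_bound:
  "0 \<le> b \<Longrightarrow> (\<And>x. norm (cblinfun_apply T x) \<le> b * norm x) \<Longrightarrow> norm T \<le> b"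
  by transfer (rule norm_blinfun_bound)

section \<open>Weak* closed sets and complex functionals\<close>

lemma closedin_weak_star_eval:
  assumes "closed S"
  shows "closedin weak_star_topology {\<phi>. cblinfun_apply \<phi> x \<in> S}"
proof -
  have [simp]: "topspace (weak_star_topology :: 'a cdual topology) = UNIV"
    unfolding weak_star_topology_def topology_generated_by_topspace
    by (auto intro!: exI[of _ UNIV])
  have "openin weak_star_topology {\<phi>. cblinfun_apply \<phi> x \<in> - S}"
    unfolding weak_star_topology_def
    by (rule topology_generated_by_Basis) (use assms in \<open>auto intro!: exI[of _ x] exI[of _ "- S"]\<close>)
  then show ?thesis
    by (simp add: closedin_def Diff_eq Compl_eq)
qed

lemma closedin_weak_star_all:
  assumes "\<And>i. closed (S i)"
  shows "closedin weak_star_topology {\<phi>. \<forall>i. cblinfun_apply \<phi> (x i) \<in> S i}"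
proof -
  have "{\<phi>. \<forall>i. cblinfun_apply \<phi> (x i) \<in> S i} = (\<Inter>i. {\<phi>. cblinfun_apply \<phi> (x i) \<in> S i})"
    by auto
  then show ?thesis
    by (auto intro!: closedin_weak_star_eval assms)
qed

lemma closedin_weak_star_cball: "closedin weak_star_topology {\<phi>. norm \<phi> \<le> 1}"
proof -
  have "norm \<phi> \<le> 1 \<longleftrightarrow> (\<forall>x. cblinfun_apply \<phi> x \<in> cball 0 (norm x))" for \<phi> :: "'a cdual"
    using norm_cblinfun[of \<phi>] norm_cblinfun_bound[of 1 \<phi>] mult_right_mono[of "norm \<phi>" 1 "norm _"]
    by (fastforce intro: order_trans)
  then show ?thesis
    using closedin_weak_star_all[of "\<lambda>x. cball 0 (norm x)" "\<lambda>x. x"] by simp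
qed

text \<open>The inner product on \<open>'g L2\<close> is real valued, so a vector state is available
  only through its real part \<open>f\<close>. The complex functional is
  \<open>f a - \<i> f (\<i> a)\<close>; rotating \<open>a\<close> by a scalar of modulus one makes
  its value real and non-negative, which reduces the norm bound to the bound on
  \<open>f\<close>.\<close>

lemma real_functional_complexification:
  fixes f :: "'a::complex_normed_vector \<Rightarrow> real"
  assumes f: "linear f" and bound: "\<And>a. f a \<le> norm a"
  obtains \<phi> :: "'a cdual" where "norm \<phi> \<le> 1" "\<And>a. Re (cblinfun_apply \<phi> a) = f a"
proof -
  interpret linear f by (rule f)
  define g where "g a = Complex (f a) (- f (\<i> *\<^sub>C a))" for a
  have one: "1 *\<^sub>C x = x" for x :: 'a
    using scaleR_scaleC[of 1 x] by simp
  have i2: "\<i> *\<^sub>C \<i> *\<^sub>C x = - x" for x :: 'a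
    using scaleR_scaleC[of "-1" x] by (simp add: scaleC_scaleC)
  have split: "c *\<^sub>C x = Re c *\<^sub>R x + Im c *\<^sub>R (\<i> *\<^sub>C x)" for c and x :: 'a
    unfolding scaleR_scaleC scaleC_scaleC scaleC_add_left[symmetric]
    by (simp add: mult.commute flip: complex_eq)
  have gC: "g (c *\<^sub>C x) = c * g x" for c x
  proof -
    have "\<i> *\<^sub>C (c *\<^sub>C x) = Re c *\<^sub>R (\<i> *\<^sub>C x) + Im c *\<^sub>R (- x)"
      unfolding split[of c x] scaleC_add_right i2[symmetric] scaleR_scaleC scaleC_scaleC
      by (simp add: mult.commute mult.left_commute)
    then show ?thesis
      unfolding g_def by (simp add: split[of c x] add scale diff complex_eq_iff)
  qed
  have bg: "cmod (g a) \<le> norm a" for a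
  proof (cases "g a = 0")
    case False
    define u where "u = cnj (g a) / cmod (g a)"
    have "cmod u = 1" using False by (simp add: u_def norm_divide)
    have "cnj (g a) * g a = complex_of_real (cmod (g a)) * complex_of_real (cmod (g a))"
      using complex_norm_square[of "g a"] by (simp add: power2_eq_square mult.commute)
    then have "g (u *\<^sub>C a) = cmod (g a)"
      using False by (simp add: gC u_def)
    then have "cmod (g a) = f (u *\<^sub>C a)" by (metis g_def complex.sel(1) Re_complex_of_real)
    also have "\<dots> \<le> norm a" using bound[of "u *\<^sub>C a"] \<open>cmod u = 1\<close> by (simp add: norm_scaleC)
    finally show ?thesis .
  qed simp
  have bl: "bounded_linear g"
    by (rule bounded_linear_intro[where K=1])
      (use bg in \<open>auto simp: g_def add scale complex_eq_iff scaleC_add_right linear_simps[OF bounded_linear_scaleC]\<close>)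
  define \<phi> :: "'a cdual" where "\<phi> = Abs_cblinfun (Blinfun g)"
  have \<phi>: "cblinfun_apply \<phi> = g"
    unfolding \<phi>_def cblinfun_apply.rep_eq
    by (subst Abs_cblinfun_inverse) (auto simp: bounded_linear_Blinfun_apply[OF bl] gC scaleC_complex_def)
  show ?thesis
  proof (rule that[of \<phi>])
    show "norm \<phi> \<le> 1" by (rule norm_cblinfun_bound) (simp_all add: \<phi> bg)
  qed (simp add: \<phi> g_def)
qed

lemma summable_bounded_finite_sums_tendsto_0:
  fixes f :: "nat \<Rightarrow> real"
  assumes "\<And>i. 0 \<le> f i" "\<And>F. finite F \<Longrightarrow> sum f F \<le> B"
  shows "f \<longlonglongrightarrow> 0"
  by (rule summable_LIMSEQ_zero, rule summableI_nonneg_bounded[of _ B]) (use assms in auto)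

text \<open>
  The functionals \<open>\<phi> j\<close> behave like states and the elements \<open>b j\<close> like bumps with disjoint
  supports on which \<open>\<phi> j\<close> concentrates, while the \<open>h k\<close> replace the missing unit and keep the mass
  of the limits equal to one. Hence the \<open>\<phi> j\<close> move to distance 2 from every point of \<open>C\<close>.
\<close>

theorem not_asymptotic_center_property:
  fixes \<phi> :: "nat \<Rightarrow> 'a::complex_normed_vector cdual" and h b :: "nat \<Rightarrow> 'a"
  assumes \<phi>: "\<And>j. norm (\<phi> j) \<le> 1"
    and h: "\<And>j k. 1 - \<delta> k \<le> Re (cblinfun_apply (\<phi> j) (h k))"
    and \<delta>: "\<delta> \<longlonglongrightarrow> 0"
    and b: "\<And>F k. finite F \<Longrightarrow> norm (h k - 2 *\<^sub>R sum b F) \<le> 1"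
    and lim: "(\<lambda>j. Re (cblinfun_apply (\<phi> j) (b j))) \<longlonglongrightarrow> 1"
  shows "\<not> asymptotic_center_property TYPE('a cdual)"
proof
  assume acp: "asymptotic_center_property TYPE('a cdual)"
  define C where "C = {\<psi> :: 'a cdual. norm \<psi> \<le> 1} \<inter>
    {\<psi>. \<forall>k. cblinfun_apply \<psi> (h k) \<in> {z. 1 - \<delta> k \<le> Re z}}"
  have CD: "norm c \<le> 1" "1 - \<delta> k \<le> Re (cblinfun_apply c (h k))" if "c \<in> C" for c k
    using that by (auto simp: C_def)
  have \<phi>C: "\<phi> j \<in> C" for j using \<phi> h by (simp add: C_def)
  have closed: "closedin weak_star_topology C"
    unfolding C_def by (intro closedin_Int closedin_weak_star_cball closedin_weak_star_all
        closed_halfspace_Re_ge)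
  have conv: "convex C"
  proof (rule convexI)
    fix x y u v assume xy: "x \<in> C" "y \<in> C" and uv: "(0::real) \<le> u" "0 \<le> v" "u + v = 1"
    have "norm (u *\<^sub>R x + v *\<^sub>R y) \<le> u * norm x + v * norm y"
      using norm_triangle_ineq[of "u *\<^sub>R x" "v *\<^sub>R y"] uv by simp
    also have "\<dots> \<le> u * 1 + v * 1"
      by (intro add_mono mult_left_mono CD xy uv)
    finally have "norm (u *\<^sub>R x + v *\<^sub>R y) \<le> 1" using uv by simp
    moreover have "1 - \<delta> k \<le> Re (cblinfun_apply (u *\<^sub>R x + v *\<^sub>R y) (h k))" for k
    proof -
      have "1 - \<delta> k = u * (1 - \<delta> k) + v * (1 - \<delta> k)"
        using uv by (simp flip: distrib_right)
      also have "\<dots> \<le> u * Re (cblinfun_apply x (h k)) + v * Re (cblinfun_apply y (h k))"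
        by (intro add_mono mult_left_mono CD xy uv)
      finally show ?thesis
        by (simp add: cblinfun_add_apply scaleR_scaleC cblinfun_scaleC_apply scaleC_complex_def)
    qed
    ultimately show "u *\<^sub>R x + v *\<^sub>R y \<in> C" by (simp add: C_def)
  qed
  have bound: "Re (cblinfun_apply c a) \<le> norm a" if "norm c \<le> 1" for c :: "'a cdual" and a
    using complex_Re_le_cmod[of "cblinfun_apply c a"] norm_cblinfun[of c a]
      mult_right_mono[OF that norm_ge_zero[of a]] by simp
  have far: "(\<lambda>j. norm (\<phi> j - c)) \<longlonglongrightarrow> 2" if c: "c \<in> C" for c
  proof -
    define \<beta> where "\<beta> j = Re (cblinfun_apply c (b j))" for j
    \<comment> \<open>Testing \<open>c\<close> on \<open>h k - 2 b j\<close> gives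
      \<open>1 - \<delta> k - 2 \<beta> j \<le> 1\<close>; then \<open>k\<close> tends to
      infinity.\<close>
    have nonneg: "0 \<le> \<beta> j" for j
    proof -
      have "- \<delta> k \<le> 2 * \<beta> j" for k
        using bound[OF CD(1)[OF c], of "h k - 2 *\<^sub>R sum b {j}"] b[of "{j}" k] CD(2)[OF c, of k]
        by (simp add: cblinfun_apply_simps \<beta>_def)
      then have "- 0 \<le> 2 * \<beta> j"
        by (intro tendsto_upperbound[OF tendsto_minus[OF \<delta>]]) auto
      then show ?thesis by simp
    qed
    \<comment> \<open>Both \<open>h 0\<close> (the case \<open>F = {}\<close>) and
      \<open>h 0 - 2 sum b F\<close> have norm at most 1, so \<open>sum b F\<close> has norm at most
      1 and \<open>\<beta>\<close> is summable.\<close>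
    have \<beta>0: "\<beta> \<longlonglongrightarrow> 0"
    proof (rule summable_bounded_finite_sums_tendsto_0[where B=1, OF nonneg])
      fix F :: "nat set" assume F: "finite F"
      have "norm (2 *\<^sub>R sum b F) \<le> norm (h 0) + norm (h 0 - 2 *\<^sub>R sum b F)"
        using norm_triangle_ineq4[of "h 0" "h 0 - 2 *\<^sub>R sum b F"] by simp
      then have "norm (sum b F) \<le> 1"
        using b[OF F, of 0] b[of "{}" 0] by simp
      then show "sum \<beta> F \<le> 1"
        using bound[OF CD(1)[OF c], of "sum b F"] by (simp add: cblinfun_apply_simps \<beta>_def)
    qed
    \<comment> \<open>The contraction \<open>h k - 2 b j\<close> separates the two functionals: the
      real part of \<open>c\<close> on it is at least \<open>1 - \<delta> k - 2 \<beta> j\<close>,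
      that of \<open>\<phi> j\<close> at most 1 minus twice its value on \<open>b j\<close>.\<close>
    have lower: "2 * Re (cblinfun_apply (\<phi> j) (b j)) - 2 * \<beta> j \<le> norm (\<phi> j - c)" for j
    proof -
      have "2 * Re (cblinfun_apply (\<phi> j) (b j)) - 2 * \<beta> j - \<delta> k \<le> norm (\<phi> j - c)" for k
      proof -
        have "Re (cblinfun_apply (c - \<phi> j) (h k - 2 *\<^sub>R b j)) \<le> norm (\<phi> j - c)"
          using complex_Re_le_cmod[of "cblinfun_apply (c - \<phi> j) (h k - 2 *\<^sub>R b j)"]
            norm_cblinfun[of "c - \<phi> j" "h k - 2 *\<^sub>R b j"] b[of "{j}" k]
            mult_left_mono[of "norm (h k - 2 *\<^sub>R b j)" 1 "norm (c - \<phi> j)"]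
          by (simp add: norm_minus_commute)
        moreover have "Re (cblinfun_apply (\<phi> j) (h k)) \<le> 1"
          using bound[OF \<phi>, of j "h k"] b[of "{}" k] by simp
        ultimately show ?thesis
          using CD(2)[OF c, of k] by (simp add: cblinfun_diff_apply cblinfun_apply_simps \<beta>_def)
      qed
      moreover have "(\<lambda>k. 2 * Re (cblinfun_apply (\<phi> j) (b j)) - 2 * \<beta> j - \<delta> k)
          \<longlonglongrightarrow> 2 * Re (cblinfun_apply (\<phi> j) (b j)) - 2 * \<beta> j - 0"
        by (intro tendsto_intros \<delta>)
      ultimately show ?thesis
        using tendsto_upperbound[of _ "2 * Re (cblinfun_apply (\<phi> j) (b j)) - 2 * \<beta> j - 0" sequentially]
        by simp
    qed
    show ?thesis
    proof (rule tendsto_sandwich[OF always_eventually always_eventually])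
      show "\<forall>j. 2 * Re (cblinfun_apply (\<phi> j) (b j)) - 2 * \<beta> j \<le> norm (\<phi> j - c)"
        using lower by blast
      show "\<forall>j. norm (\<phi> j - c) \<le> 2"
        using norm_triangle_ineq4[of "\<phi> _" c] \<phi> CD(1)[OF c] by (smt (verit))
      have "(\<lambda>j. 2 * Re (cblinfun_apply (\<phi> j) (b j)) - 2 * \<beta> j) \<longlonglongrightarrow> 2 * 1 - 2 * 0"
        by (intro tendsto_intros lim \<beta>0)
      then show "(\<lambda>j. 2 * Re (cblinfun_apply (\<phi> j) (b j)) - 2 * \<beta> j) \<longlonglongrightarrow> 2" by simp
    qed simp
  qed
  have le2: "norm (\<phi> j - c) \<le> 2" if "c \<in> C" for j c
    using norm_triangle_ineq4[of "\<phi> j" c] \<phi>[of j] CD(1)[OF that] by simp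
  define W where "W n = \<phi> ` {n..}" for n
  \<comment> \<open>Every tail has radius exactly 2 about every \<open>c\<close>, so all points of
    \<open>C\<close> are minimisers. Compactness then fails because a norm limit of a subsequence of
    \<open>\<phi>\<close> would be a point of \<open>C\<close>, from which \<open>\<phi>\<close>
    keeps asymptotic distance 2.\<close>
  have radius: "radius_at W n c = 2" if c: "c \<in> C" for n c
    unfolding radius_at_def
  proof (rule antisym)
    show "(SUP w\<in>W n. norm (w - c)) \<le> 2"
      by (rule cSUP_least) (auto simp: W_def le2[OF c])
    have "norm (\<phi> j - c) \<le> (SUP w\<in>W n. norm (w - c))" if "n \<le> j" for j
      by (rule cSUP_upper) (use that in \<open>auto simp: W_def intro!: bdd_aboveI[of _ 2] le2[OF c]\<close>)
    then show "2 \<le> (SUP w\<in>W n. norm (w - c))"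
      by (intro tendsto_upperbound[OF far[OF c]] eventually_sequentiallyI[of n]) auto
  qed
  have "C \<noteq> {}" using \<phi>C by blast
  then have center: "asymptotic_center UNIV W C = C"
    by (auto simp: asymptotic_center_def asymptotic_radius_def asymptotic_radius_at_def radius)
  have "asymptotic_center UNIV W C \<noteq> {} \<and> compact (asymptotic_center UNIV W C) \<and>
      convex (asymptotic_center UNIV W C)"
  proof (rule asymptotic_center_property_net[OF acp \<open>C \<noteq> {}\<close> closed conv])
    show "decreasing_net UNIV (\<le>) W"
      by (auto simp: decreasing_net_def directed_on_def W_def intro: max.cobounded1 max.cobounded2)
    show "W n \<noteq> {} \<and> bounded (W n) \<and> W n \<subseteq> C" for n
      by (auto simp: W_def \<phi>C bounded_iff intro!: exI[of _ 1] \<phi>)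
  qed
  then have "seq_compact C" by (simp add: center compact_imp_seq_compact)
  then obtain l r where l: "l \<in> C" and r: "strict_mono r" "(\<phi> \<circ> r) \<longlonglongrightarrow> l"
    using \<phi>C unfolding seq_compact_def by blast
  have "(\<lambda>j. norm ((\<phi> \<circ> r) j - l)) \<longlonglongrightarrow> 0"
    by (rule tendsto_norm_zero[OF LIM_zero[OF r(2)]])
  moreover have "(\<lambda>j. norm ((\<phi> \<circ> r) j - l)) \<longlonglongrightarrow> 2"
    using LIMSEQ_subseq_LIMSEQ[OF far[OF l] r(1)] by (simp add: o_def)
  ultimately show False using LIMSEQ_unique by fastforce
qed

section \<open>Positive contractions without fixed vectors\<close>

text \<open>Polarization bounds \<open>inner (B x) y\<close> by half the sum of the squared norms of
  \<open>x\<close> and \<open>y\<close>; the bound follows on taking \<open>y\<close> parallel to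
  \<open>B x\<close> and of the same norm as \<open>x\<close>.\<close>

lemma norm_le_of_symmetric_form:
  fixes B :: "'a::real_inner \<Rightarrow> 'a"
  assumes B: "linear B" and sym: "\<And>x y. inner (B x) y = inner x (B y)"
    and form: "\<And>x. \<bar>inner (B x) x\<bar> \<le> inner x x"
  shows "norm (B x) \<le> norm x"
proof -
  have polar: "4 * inner (B x) y \<le> 2 * (inner x x + inner y y)" for x y
  proof -
    have "4 * inner (B x) y = inner (B (x + y)) (x + y) - inner (B (x - y)) (x - y)"
      using sym[of y x] by (simp add: linear_add[OF B] linear_diff[OF B] inner_add inner_diff
          inner_commute)
    also have "\<dots> \<le> inner (x + y) (x + y) + inner (x - y) (x - y)"
      using form[of "x + y"] form[of "x - y"] by linarith
    also have "\<dots> = 2 * (inner x x + inner y y)"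
      by (simp add: inner_add inner_diff inner_commute)
    finally show ?thesis .
  qed
  show ?thesis
  proof (cases "x = 0 \<or> B x = 0")
    case True
    then show ?thesis using linear_0[OF B] by auto
  next
    case False
    define t where "t = norm x / norm (B x)"
    have t: "t > 0" using False by (simp add: t_def)
    have e1: "inner (B x) (t *\<^sub>R B x) = norm (B x) * norm x"
      using False by (simp add: t_def power2_norm_eq_inner[symmetric] power2_eq_square)
    have e2: "inner (t *\<^sub>R B x) (t *\<^sub>R B x) = norm x * norm x"
      unfolding t_def power2_norm_eq_inner[symmetric] using False by (simp add: power2_eq_square)
    have e3: "inner x x = norm x * norm x"
      by (simp add: power2_norm_eq_inner[symmetric] power2_eq_square)
    have "norm (B x) * norm x \<le> norm x * norm x"
      using polar[of x "t *\<^sub>R B x"] unfolding e1 e2 e3 by (simp only: mult_2[symmetric])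
    then show ?thesis using False by simp
  qed
qed

section \<open>Polynomial calculus for \<open>0 \<le> T \<le> 1\<close> by quadratic forms\<close>

locale positive_contraction =
  fixes T :: "'a::real_inner \<Rightarrow> 'a"
  assumes linear: "linear T"
    and sym: "inner (T x) y = inner x (T y)"
    and nonneg: "0 \<le> inner (T x) x"
    and le: "inner (T x) x \<le> inner x x"
begin

text \<open>Powers of \<open>U\<close> are small where \<open>T\<close> is near 1, so
  \<open>1 - U ^^ n\<close> acts there as a unit.\<close>

definition U :: "'a \<Rightarrow> 'a" where "U x = x - T x"

lemma linear_U: "linear U"
  unfolding U_def[abs_def] by (rule linear_compose_sub[OF linear_ident linear])

text \<open>The complement of \<open>U\<close> is again \<open>T\<close>, so each statement about
  powers of \<open>U\<close> also yields one about powers of \<open>T\<close>.\<close>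

lemma complement: "positive_contraction U"
proof (rule positive_contraction.intro)
  show "linear U" by (rule linear_U)
  show "inner (U x) y = inner x (U y)" for x y
    by (simp add: U_def inner_diff sym)
  show "0 \<le> inner (U x) x" "inner (U x) x \<le> inner x x" for x
    using nonneg[of x] le[of x] by (simp_all add: U_def inner_diff_left)
qed

lemma UT: "U (T x) = T (U x)"
  by (simp add: U_def linear_diff[OF linear])

lemma linear_pow: "linear (T ^^ n)" "linear (U ^^ n)"
  by (induction n) (auto intro!: linear_compose linear linear_U linear_id)

lemma sym_U: "inner (U x) y = inner x (U y)"
  by (simp add: U_def inner_diff sym)

lemma sym_pow: "inner ((T ^^ n) x) y = inner x ((T ^^ n) y)"
  by (induction n arbitrary: x y) (simp_all add: sym funpow_swap1)

lemma sym_U_pow: "inner ((U ^^ n) x) y = inner x ((U ^^ n) y)"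
  by (rule positive_contraction.sym_pow[OF complement])

lemma UT_pow: "(U ^^ n) (T x) = T ((U ^^ n) x)"
  by (induction n) (simp_all add: UT)

text \<open>The identity \<open>T U = U T U + T U T\<close> displays the product as a sum of two
  positive operators, in place of a square root of \<open>T\<close>.\<close>

lemma UTx_nonneg: "0 \<le> inner (T (U x)) x"
proof -
  have "U x + T x = x" by (simp add: U_def)
  then have "inner (T (U x)) x = inner (T (U x)) (U x + T x)" by simp
  also have "\<dots> = inner (T (U x)) (U x) + inner (U (T x)) (T x)"
    by (simp add: UT inner_add_right)
  finally show ?thesis
    using add_nonneg_nonneg[OF nonneg positive_contraction.nonneg[OF complement], of "U x" "T x"]
    by (simp only:)
qed

text \<open>Moving one factor \<open>U\<close> to the other side of the inner product lowers the
  exponent by two, hence the induction in steps of two; the base case \<open>T U\<close> is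
  \<open>UTx_nonneg\<close>.\<close>

lemma mixed_pow_nonneg: "0 \<le> inner (T ((U ^^ n) x)) x" "0 \<le> inner ((U ^^ n) x) x"
proof (induction n arbitrary: x rule: nat_induct2)
  case 0
  { case 1 show ?case by (simp add: nonneg) }
  { case 2 show ?case by simp }
next
  case 1
  { case 1 show ?case by (simp add: UTx_nonneg) }
  { case 2 show ?case by (simp add: positive_contraction.nonneg[OF complement]) }
next
  case (step n)
  { case 1
    have "inner (T ((U ^^ (n + 2)) x)) x = inner (T ((U ^^ n) (U x))) (U x)"
    proof -
      have "T ((U ^^ (n + 2)) x) = U (T ((U ^^ n) (U x)))" by (simp add: UT funpow_swap1)
      then show ?thesis by (simp add: sym_U)
    qed
    then show ?case using step(1)[of "U x"] by simp }
  { case 2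
    have "inner ((U ^^ (n + 2)) x) x = inner ((U ^^ n) (U x)) (U x)"
    proof -
      have "(U ^^ (n + 2)) x = U ((U ^^ n) (U x))" by (simp add: funpow_swap1)
      then show ?thesis by (simp add: sym_U)
    qed
    then show ?case using step(2)[of "U x"] by simp }
qed

lemma inner_U_pow_Suc: "inner ((U ^^ Suc n) x) x = inner ((U ^^ n) x) x - inner (T ((U ^^ n) x)) x"
  by (simp add: U_def[of "(U ^^ n) x"] inner_diff)

lemma U_pow_Suc_le: "inner ((U ^^ Suc n) x) x \<le> inner ((U ^^ n) x) x"
  using mixed_pow_nonneg(1)[of n x] by (simp only: inner_U_pow_Suc)

lemma U_pow_antimono: "m \<le> n \<Longrightarrow> inner ((U ^^ n) x) x \<le> inner ((U ^^ m) x) x"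
  by (rule lift_Suc_antimono_le[of "\<lambda>n. inner ((U ^^ n) x) x"]) (rule U_pow_Suc_le)

lemma pow_nonneg: "0 \<le> inner ((T ^^ n) x) x"
proof -
  interpret c: positive_contraction U by (rule complement)
  have "c.U = T" by (auto simp: c.U_def U_def)
  then show ?thesis using c.mixed_pow_nonneg(2)[of n x] by simp
qed

lemma pow_antimono: "m \<le> n \<Longrightarrow> inner ((T ^^ n) x) x \<le> inner ((T ^^ m) x) x"
proof -
  interpret c: positive_contraction U by (rule complement)
  have "c.U = T" by (auto simp: c.U_def U_def)
  then show "m \<le> n \<Longrightarrow> ?thesis" using c.U_pow_antimono[of m n x] by simp
qed

lemma norm_le: "norm (T x) \<le> norm x"
  by (rule norm_le_of_symmetric_form[OF linear sym]) (use nonneg le in simp)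

text \<open>Since \<open>1 - U = T\<close>, the difference of the two operators is
  \<open>T U ^^ n T\<close>, which is positive.\<close>

lemma T_U_pow_antimono: "inner (T ((U ^^ Suc n) x)) x \<le> inner (T ((U ^^ n) x)) x"
proof -
  have "inner (T ((U ^^ n) x)) x - inner (T ((U ^^ Suc n) x)) x = inner ((U ^^ n) (T x)) (T x)"
    by (simp add: U_def[of "(U ^^ n) x"] linear_diff[OF linear] inner_diff UT_pow sym)
  then show ?thesis using mixed_pow_nonneg(2)[of n "T x"] by simp
qed

text \<open>Operator form of \<open>(n + 1) t (1 - t) ^ n \<le> 1\<close> on the unit interval: the
  terms \<open>t (1 - t) ^ i\<close> decrease in \<open>i\<close> and their sum telescopes to
  \<open>1 - (1 - t) ^ (n + 1)\<close>.\<close>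

lemma T_U_pow_le: "(real n + 1) * inner (T ((U ^^ n) x)) x \<le> inner x x"
proof -
  let ?a = "\<lambda>i. inner (T ((U ^^ i) x)) x"
  have "(\<Sum>i\<le>n. ?a i) = inner x x - inner ((U ^^ Suc n) x) x"
  proof (induction n)
    case 0
    show ?case using inner_U_pow_Suc[of 0 x] by simp
  next
    case (Suc n)
    then show ?case using inner_U_pow_Suc[of "Suc n" x] by (simp del: funpow.simps)
  qed
  also have "\<dots> \<le> inner x x"
    using mixed_pow_nonneg(2)[of "Suc n" x] by simp
  also have "(\<Sum>i\<le>n. ?a n) \<le> (\<Sum>i\<le>n. ?a i)"
  proof (rule sum_mono)
    fix i assume "i \<in> {..n}"
    then show "?a n \<le> ?a i"
      using lift_Suc_antimono_le[of ?a i n, OF T_U_pow_antimono] by simp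
  qed
  finally show ?thesis by (simp add: add.commute)
qed

text \<open>The scalar inequality is \<open>(n + 1) t ^ 2 (1 - t) ^ n \<le> 1\<close>. It gives a
  rate of decay that is the same for all unit vectors \<open>x\<close>, at the price of passing to
  \<open>T x\<close>.\<close>

lemma U_pow_T_le: "(real n + 1) * inner ((U ^^ n) (T x)) (T x) \<le> inner x x"
proof -
  have "inner ((U ^^ n) (T x)) (T x) = inner (T ((U ^^ n) (T x))) x"
    by (simp add: sym)
  also have "\<dots> = inner (T ((U ^^ n) x)) x - inner (T ((U ^^ Suc n) x)) x"
    by (simp add: U_def[of "(U ^^ n) x"] linear_diff[OF linear] inner_diff UT_pow)
  also have "\<dots> \<le> inner (T ((U ^^ n) x)) x"
    using mixed_pow_nonneg(1)[of "Suc n" x] by simp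
  finally have "(real n + 1) * inner ((U ^^ n) (T x)) (T x) \<le> (real n + 1) * inner (T ((U ^^ n) x)) x"
    by (rule mult_left_mono) simp
  also have "\<dots> \<le> inner x x" by (rule T_U_pow_le)
  finally show ?thesis .
qed

text \<open>Bernoulli's inequality \<open>1 - t ^ n \<le> n (1 - t)\<close>: each increment
  \<open>t ^ n (1 - t)\<close> is at most \<open>1 - t\<close>.\<close>

lemma one_minus_pow_le: "inner x x - inner ((T ^^ n) x) x \<le> real n * (inner x x - inner (T x) x)"
proof (induction n)
  case (Suc n)
  have "inner ((T ^^ n) x) x - inner ((T ^^ Suc n) x) x \<le> inner x x - inner (T x) x"
  proof -
    interpret c: positive_contraction U by (rule complement)
    have cU: "c.U = T" by (auto simp: c.U_def U_def)
    have "inner (U ((T ^^ n) x)) x \<le> inner (U ((T ^^ 0) x)) x"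
      using c.T_U_pow_antimono[unfolded cU] lift_Suc_antimono_le[of "\<lambda>n. inner (U ((T ^^ n) x)) x" 0 n]
      by simp
    then show ?thesis by (simp add: U_def inner_diff)
  qed
  then show ?case using Suc.IH by (simp add: distrib_right)
qed simp

end

locale positive_contraction_no_fixpoint = positive_contraction T
  for T :: "'a::{real_inner, complete_space} \<Rightarrow> 'a" +
  assumes no_fixpoint: "T x = x \<Longrightarrow> x = 0"
    and norm_one: "\<epsilon> > 0 \<Longrightarrow> \<exists>x. norm x = 1 \<and> 1 - \<epsilon> \<le> inner (T x) x"
begin

lemma pow_add_inner: "inner ((T ^^ m) x) ((T ^^ n) x) = inner ((T ^^ (m + n)) x) x"
  by (simp add: funpow_add sym_pow inner_commute)

text \<open>The numbers \<open>inner ((T ^^ n) x) x\<close> decrease and are non-negative, hence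
  form a Cauchy sequence \<open>q\<close>. The squared distance of two iterates is
  \<open>q (2 m) - 2 q (m + n) + q (2 n)\<close>, so the iterates converge, and their limit is fixed
  by \<open>T\<close>.\<close>

lemma pow_tendsto_0: "(\<lambda>n. (T ^^ n) x) \<longlonglongrightarrow> 0"
proof -
  define q where "q n = inner ((T ^^ n) x) x" for n
  have q: "decseq q" "\<And>n. 0 \<le> q n"
    by (auto simp: q_def decseq_def pow_antimono pow_nonneg)
  then have "convergent q"
    by (intro Bseq_monoseq_convergent decseq_imp_monoseq decseq_bounded[of _ 0]) auto
  then have Cq: "Cauchy q" by (rule convergent_Cauchy)
  have dist: "(dist ((T ^^ m) x) ((T ^^ n) x))\<^sup>2 = q (m + m) - 2 * q (m + n) + q (n + n)" for m n
    unfolding dist_norm power2_norm_eq_inner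
    by (simp add: inner_diff pow_add_inner q_def add.commute[of n m])
  have "Cauchy (\<lambda>n. (T ^^ n) x)"
  proof (rule metric_CauchyI)
    fix e :: real assume e: "e > 0"
    then obtain N where N: "\<And>m n. m \<ge> N \<Longrightarrow> n \<ge> N \<Longrightarrow> dist (q m) (q n) < e\<^sup>2 / 2"
      using metric_CauchyD[OF Cq, of "e\<^sup>2 / 2"] by auto
    show "\<exists>M. \<forall>m\<ge>M. \<forall>n\<ge>M. dist ((T ^^ m) x) ((T ^^ n) x) < e"
    proof (intro exI[of _ N] allI impI)
      fix m n assume mn: "N \<le> m" "N \<le> n"
      have "(dist ((T ^^ m) x) ((T ^^ n) x))\<^sup>2 < e\<^sup>2"
        using N[of "m + m" "m + n", OF trans_le_add1[OF mn(1)] trans_le_add1[OF mn(1)]]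
          N[of "n + n" "m + n", OF trans_le_add1[OF mn(2)] trans_le_add1[OF mn(1)]]
        unfolding dist dist_real_def by linarith
      then show "dist ((T ^^ m) x) ((T ^^ n) x) < e"
        by (rule power_less_imp_less_base) (use e in simp)
    qed
  qed
  then obtain l where l: "(\<lambda>n. (T ^^ n) x) \<longlonglongrightarrow> l"
    using Cauchy_convergent convergent_def by blast
  have "bounded_linear T"
    by (rule bounded_linear_intro[where K=1])
      (simp_all add: linear_add[OF linear] linear_scale[OF linear] norm_le)
  then have "(\<lambda>n. T ((T ^^ n) x)) \<longlonglongrightarrow> T l" by (rule bounded_linear.tendsto[OF _ l])
  moreover have "(\<lambda>n. T ((T ^^ n) x)) \<longlonglongrightarrow> l" using LIMSEQ_Suc[OF l] by simp
  ultimately have "T l = l" by (rule LIMSEQ_unique)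
  then have "l = 0" by (rule no_fixpoint)
  then show ?thesis using l by simp
qed

text \<open>Passing from \<open>\<zeta>\<close> to \<open>T \<zeta>\<close> makes the decay of \<open>\<langle>U\<^sup>k \<xi>, \<xi>\<rangle>\<close> uniform in \<open>\<xi>\<close>.\<close>

lemma concentrated_vector:
  assumes "\<epsilon> > 0"
  obtains \<xi> m where "norm \<xi> = 1" "n < m" "1 - \<epsilon> \<le> inner ((T ^^ n) \<xi>) \<xi>" "inner ((T ^^ m) \<xi>) \<xi> \<le> \<epsilon>"
    "\<And>k. inner ((U ^^ k) \<xi>) \<xi> \<le> 2 / (real k + 1)"
proof -
  \<comment> \<open>Normalising \<open>T \<zeta>\<close> turns the exponent \<open>n\<close> into
    \<open>n + 2\<close>, hence the factor \<open>n + 2\<close>. The bound \<open>1/4\<close> keeps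
    the squared norm of \<open>T \<zeta>\<close> at least \<open>1 - 2 / 4 = 1/2\<close>; this is
    the source of the 2 in \<open>2 / (real k + 1)\<close>.\<close>
  define \<delta> where "\<delta> = min (1/4) (\<epsilon> / (real n + 2))"
  have \<delta>: "\<delta> > 0" "\<delta> \<le> 1/4"
    using assms by (simp_all only: \<delta>_def min.cobounded1 min_less_iff_conj) simp
  have "(real n + 2) * \<delta> \<le> (real n + 2) * (\<epsilon> / (real n + 2))"
    unfolding \<delta>_def by (intro mult_left_mono) auto
  then have \<delta>\<epsilon>: "(real n + 2) * \<delta> \<le> \<epsilon>" by simp
  obtain \<zeta> where \<zeta>: "norm \<zeta> = 1" "1 - \<delta> \<le> inner (T \<zeta>) \<zeta>" using norm_one[OF \<delta>(1)] by blast
  have \<zeta>1: "inner \<zeta> \<zeta> = 1" using \<zeta>(1) by (simp add: norm_eq_1)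
  have lower: "1 - real k * \<delta> \<le> inner ((T ^^ k) \<zeta>) \<zeta>" for k
  proof -
    have "real k * (1 - inner (T \<zeta>) \<zeta>) \<le> real k * \<delta>"
      using \<zeta>(2) by (intro mult_left_mono) auto
    then show ?thesis using one_minus_pow_le[of \<zeta> k] \<zeta>1 by simp
  qed
  define c where "c = norm (T \<zeta>)"
  have c2: "c\<^sup>2 = inner ((T ^^ 2) \<zeta>) \<zeta>"
    using sym[of \<zeta> "T \<zeta>"] by (simp add: c_def power2_norm_eq_inner inner_commute) (simp add: numeral_2_eq_2)
  have "1/2 \<le> c\<^sup>2"
    using lower[of 2] \<delta>(2) unfolding c2 by simp
  then have c: "1/2 \<le> c\<^sup>2" "c \<le> 1" "0 \<le> c"
    using norm_le[of \<zeta>] \<zeta>(1) by (simp_all add: c_def)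
  then have "c \<noteq> 0" by auto
  then have c0: "c > 0" using c(3) by simp
  define \<xi> where "\<xi> = (1 / c) *\<^sub>R T \<zeta>"
  have form: "inner ((T ^^ k) \<xi>) \<xi> = inner ((T ^^ (k + 2)) \<zeta>) \<zeta> / c\<^sup>2" for k
  proof -
    have "inner ((T ^^ (k + 2)) \<zeta>) \<zeta> = inner (T ((T ^^ k) (T \<zeta>))) \<zeta>"
      by (simp add: funpow_swap1)
    also have "\<dots> = inner ((T ^^ k) (T \<zeta>)) (T \<zeta>)" by (rule sym)
    finally show ?thesis
      by (simp add: \<xi>_def linear_scale[OF linear_pow(1)] power2_eq_square del: funpow.simps)
  qed
  have "(\<lambda>m. inner ((T ^^ m) \<xi>) \<xi>) \<longlonglongrightarrow> inner 0 \<xi>"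
    by (rule tendsto_inner[OF pow_tendsto_0 tendsto_const])
  then have "\<forall>\<^sub>F m in sequentially. inner ((T ^^ m) \<xi>) \<xi> < \<epsilon>"
    using assms by (intro order_tendstoD(2)[of _ "inner 0 \<xi>"]) auto
  then have "\<forall>\<^sub>F m in sequentially. inner ((T ^^ m) \<xi>) \<xi> < \<epsilon> \<and> n < m"
    using eventually_gt_at_top by eventually_elim auto
  then obtain m where m: "n < m" "inner ((T ^^ m) \<xi>) \<xi> \<le> \<epsilon>"
    by (auto simp: eventually_sequentially intro: less_imp_le)
  show ?thesis
  proof (rule that[OF _ m(1) _ m(2)])
    show "norm \<xi> = 1" using c0 by (simp add: \<xi>_def c_def)
    have "inner ((T ^^ (n + 2)) \<zeta>) \<zeta> \<le> inner ((T ^^ n) \<xi>) \<xi>"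
      unfolding form using c pow_nonneg[of "n + 2" \<zeta>] c0
      by (simp add: le_divide_eq mult_left_le power_le_one)
    then show "1 - \<epsilon> \<le> inner ((T ^^ n) \<xi>) \<xi>"
      using lower[of "n + 2"] \<delta>\<epsilon> by (simp add: algebra_simps)
    fix k
    have "inner ((U ^^ k) \<xi>) \<xi> = inner ((U ^^ k) (T \<zeta>)) (T \<zeta>) / c\<^sup>2"
      by (simp add: \<xi>_def linear_scale[OF linear_pow(2)] power2_eq_square)
    also have "\<dots> \<le> (1 / (real k + 1)) / (1/2)"
    proof (rule frac_le)
      show "inner ((U ^^ k) (T \<zeta>)) (T \<zeta>) \<le> 1 / (real k + 1)"
        using U_pow_T_le[of k \<zeta>] \<zeta>1 by (simp add: le_divide_eq mult.commute)
    qed (use c(1) in simp_all)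
    finally show "inner ((U ^^ k) \<xi>) \<xi> \<le> 2 / (real k + 1)" by simp
  qed
qed

text \<open>Each \<open>N (Suc j)\<close> is the \<open>m\<close> obtained for
  \<open>n = N j\<close> and \<open>\<epsilon> = 1 / (j + 1)\<close>, so the differences
  \<open>T ^^ N j - T ^^ N (Suc j)\<close> share end points and telescope. The condition
  \<open>1 \<le> N 0\<close> keeps out the power \<open>T ^^ 0\<close>.\<close>

lemma concentrated_sequence:
  obtains \<xi> and N :: "nat \<Rightarrow> nat" where
    "\<And>j. norm (\<xi> j) = 1" "strict_mono N" "1 \<le> N 0"
    "\<And>j k. inner ((U ^^ k) (\<xi> j)) (\<xi> j) \<le> 2 / (real k + 1)"
    "(\<lambda>j. inner ((T ^^ N j) (\<xi> j)) (\<xi> j) - inner ((T ^^ N (Suc j)) (\<xi> j)) (\<xi> j)) \<longlonglongrightarrow> 1"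
proof -
  define P where "P j n m \<xi> \<longleftrightarrow> norm \<xi> = 1 \<and> n < m \<and> 1 - 1 / (real j + 1) \<le> inner ((T ^^ n) \<xi>) \<xi> \<and>
      inner ((T ^^ m) \<xi>) \<xi> \<le> 1 / (real j + 1) \<and> (\<forall>k. inner ((U ^^ k) \<xi>) \<xi> \<le> 2 / (real k + 1))"
    for j n m \<xi>
  have "\<exists>N. \<forall>j. 1 \<le> N j \<and> (\<exists>\<xi>. P j (N j) (N (Suc j)) \<xi>)"
  proof (rule dependent_nat_choice)
    show "\<exists>n::nat. 1 \<le> n" by blast
    fix n j :: nat assume "1 \<le> n"
    have "0 < 1 / (real j + 1)" by simp
    then obtain \<xi> m where "norm \<xi> = 1" "n < m" "1 - 1 / (real j + 1) \<le> inner ((T ^^ n) \<xi>) \<xi>"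
      "inner ((T ^^ m) \<xi>) \<xi> \<le> 1 / (real j + 1)" "\<And>k. inner ((U ^^ k) \<xi>) \<xi> \<le> 2 / (real k + 1)"
      by (rule concentrated_vector[of _ n]) (rule that)
    then have "P j n m \<xi>" "1 \<le> m" by (auto simp: P_def)
    then show "\<exists>m. 1 \<le> m \<and> (\<exists>\<xi>. P j n m \<xi>)" by blast
  qed
  then obtain N where N: "\<And>j. 1 \<le> N j" and "\<forall>j. \<exists>\<xi>. P j (N j) (N (Suc j)) \<xi>"
    by blast
  then obtain \<xi> where P: "\<And>j. P j (N j) (N (Suc j)) (\<xi> j)"
    using choice[of "\<lambda>j \<xi>. P j (N j) (N (Suc j)) \<xi>"] by blast
  let ?b = "\<lambda>j. inner ((T ^^ N j) (\<xi> j)) (\<xi> j) - inner ((T ^^ N (Suc j)) (\<xi> j)) (\<xi> j)"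
  show ?thesis
  proof (rule that)
    show "norm (\<xi> j) = 1" for j using P[of j] by (simp add: P_def)
    show "strict_mono N" using P by (simp add: strict_mono_Suc_iff P_def)
    show "1 \<le> N 0" by (rule N)
    show "inner ((U ^^ k) (\<xi> j)) (\<xi> j) \<le> 2 / (real k + 1)" for j k
      using P[of j] by (simp add: P_def)
    show "?b \<longlonglongrightarrow> 1"
    proof (rule tendsto_sandwich[OF always_eventually always_eventually])
      show "\<forall>j. 1 - 2 * inverse (real (Suc j)) \<le> ?b j"
      proof
        fix j
        show "1 - 2 * inverse (real (Suc j)) \<le> ?b j"
          using P[of j] by (simp add: P_def inverse_eq_divide add.commute)
      qed
      show "\<forall>j. ?b j \<le> 1"
      proof
        fix j
        have "inner ((T ^^ N j) (\<xi> j)) (\<xi> j) \<le> inner ((T ^^ 0) (\<xi> j)) (\<xi> j)"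
          by (rule pow_antimono) simp
        then show "?b j \<le> 1"
          using pow_nonneg[of "N (Suc j)" "\<xi> j"] P[of j] by (simp add: P_def norm_eq_1)
      qed
      have "(\<lambda>j. 1 - 2 * inverse (real (Suc j))) \<longlonglongrightarrow> 1 - 2 * 0"
        by (intro tendsto_intros LIMSEQ_inverse_real_of_nat)
      then show "(\<lambda>j. 1 - 2 * inverse (real (Suc j))) \<longlonglongrightarrow> 1" by simp
    qed simp
  qed
qed

end

text \<open>All summands are non-negative, so enlarging \<open>F\<close> to an initial segment only
  increases the sum, which then telescopes. This is the substitute for disjoint supports;
  \<open>1 \<le> N 0\<close> gives the bound by \<open>T\<close> rather than by the
  identity.\<close>

lemma (in positive_contraction) telescoping_form_bounds:
  fixes x :: 'a and N :: "nat \<Rightarrow> nat"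
  assumes F: "finite F" and N: "strict_mono N" "1 \<le> N 0"
  defines "S \<equiv> \<Sum>j\<in>F. inner ((T ^^ N j) x) x - inner ((T ^^ N (Suc j)) x) x"
  shows "0 \<le> S" "S \<le> inner (T x) x"
proof -
  let ?q = "\<lambda>j. inner ((T ^^ N j) x) x"
  have step: "0 \<le> ?q j - ?q (Suc j)" for j
    using pow_antimono[of "N j" "N (Suc j)" x] N(1) by (simp add: strict_mono_less_eq)
  then show "0 \<le> S" unfolding S_def by (intro sum_nonneg)
  obtain J where J: "F \<subseteq> {..<J}" using finite_nat_bounded[OF F] by blast
  have "S \<le> (\<Sum>j<J. ?q j - ?q (Suc j))"
    unfolding S_def by (rule sum_mono2) (use J step in auto)
  also have "\<dots> = ?q 0 - ?q J" by (rule sum_lessThan_telescope')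
  also have "\<dots> \<le> inner (T x) x"
    using pow_antimono[OF N(2), of x] pow_nonneg[of "N J" x] by simp
  finally show "S \<le> inner (T x) x" .
qed

section \<open>Haar measure and inversion\<close>

lemma measurable_haar_iff [simp]:
  "f \<in> measurable M (haar :: 'g::locally_compact_group measure) \<longleftrightarrow> f \<in> borel_measurable M"
  by (simp add: measurable_cong_sets[OF refl sets_haar])

lemma borel_measurable_haar_iff [simp]:
  "f \<in> borel_measurable (haar :: 'g::locally_compact_group measure) \<longleftrightarrow> f \<in> borel_measurable borel"
  by (simp add: measurable_cong_sets[OF sets_haar refl])

lemma measurable_translate_pair_borel [measurable (raw)]:
  fixes h :: "'g::{locally_compact_group, second_countable_topology} \<Rightarrow> 'b::topological_space"
  assumes [measurable]: "h \<in> borel_measurable borel" "a \<in> borel_measurable M" "b \<in> borel_measurable M"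
  shows "(\<lambda>p. h (- a p + b p)) \<in> borel_measurable M" "(\<lambda>p. h (a p + b p)) \<in> borel_measurable M"
    "(\<lambda>p. h (- a p)) \<in> borel_measurable M"
proof -
  have "continuous_on UNIV (uminus :: 'g \<Rightarrow> 'g)"
    unfolding continuous_on_def by (intro ballI tendsto_minus tendsto_ident_at)
  then have [measurable]: "(uminus :: 'g \<Rightarrow> 'g) \<in> borel_measurable borel"
    by (rule borel_measurable_continuous_onI)
  have [measurable]: "(\<lambda>p. - a p) \<in> borel_measurable M"
    by (rule measurable_compose[OF assms(2)]) measurable
  show "(\<lambda>p. h (- a p + b p)) \<in> borel_measurable M" "(\<lambda>p. h (a p + b p)) \<in> borel_measurable M"
    "(\<lambda>p. h (- a p)) \<in> borel_measurable M"
    by measurable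
qed

lemma pair_sigma_finite_haar:
  "pair_sigma_finite (haar :: 'g::{locally_compact_group, second_countable_topology} measure)
     (haar :: 'g measure)"
  by (intro pair_sigma_finite.intro sigma_finite_haar)

lemma Fubini_haar:
  fixes u :: "'g::{locally_compact_group, second_countable_topology} \<Rightarrow> 'g \<Rightarrow> ennreal"
  assumes "(\<lambda>(x, y). u x y) \<in> borel_measurable (haar \<Otimes>\<^sub>M haar)"
  shows "(\<integral>\<^sup>+x. \<integral>\<^sup>+y. u x y \<partial>haar \<partial>haar) = (\<integral>\<^sup>+y. \<integral>\<^sup>+x. u x y \<partial>haar \<partial>haar)"
  using pair_sigma_finite.Fubini'[OF pair_sigma_finite_haar assms] by simp

lemma haar_not_AE_False: "\<not> (AE x in haar :: 'g::locally_compact_group measure. False)"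
  using haar_nonzero AE_iff_null[of "haar :: 'g measure" "\<lambda>_. False"] by auto

lemma nn_integral_haar_translate_plus:
  fixes u :: "'g::locally_compact_group \<Rightarrow> ennreal"
  assumes "u \<in> borel_measurable borel"
  shows "(\<integral>\<^sup>+x. u (y + x) \<partial>haar) = (\<integral>\<^sup>+x. u x \<partial>haar)"
  using nn_integral_haar_translate[OF assms, of "- y"] by simp

lemma AE_haar_translate:
  assumes "AE x in haar :: 'g::locally_compact_group measure. P x"
  shows "AE x in haar. P (- y + x)"
  by (rule AE_distrD[OF measurable_left_translation]) (simp only: distr_haar assms)

text \<open>For a null set \<open>N\<close> the integral of the indicator of
  \<open>- x + y \<in> N\<close> over both variables is computed twice. Integrating first over
  \<open>y\<close> gives 0 by left invariance; integrating first over \<open>x\<close> gives the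
  measure of \<open>- N\<close> times that of the group, and the latter factor is nonzero.\<close>

lemma AE_haar_uminus:
  assumes "AE x in haar :: 'g::{locally_compact_group, second_countable_topology} measure. P x"
  shows "AE x in haar. P (- x)"
proof -
  obtain N :: "'g set" where N: "{x \<in> space haar. \<not> P x} \<subseteq> N" "emeasure haar N = 0" "N \<in> sets haar"
    using assms by (rule AE_E)
  have [measurable]: "N \<in> sets borel" using N(3) by simp
  have "(\<integral>\<^sup>+y. (\<integral>\<^sup>+x. indicator N (- x) \<partial>haar) \<partial>(haar :: 'g measure))
      = (\<integral>\<^sup>+y. \<integral>\<^sup>+x. indicator N (- x + y) \<partial>haar \<partial>haar)"
  proof (rule nn_integral_cong)
    fix y :: 'g
    show "(\<integral>\<^sup>+x. indicator N (- x) \<partial>haar) = (\<integral>\<^sup>+x. indicator N (- x + y) \<partial>(haar :: 'g measure))"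
      using nn_integral_haar_translate[of "\<lambda>x. indicator N (- x)" y] by (simp add: minus_add)
  qed
  also have "\<dots> = (\<integral>\<^sup>+x. \<integral>\<^sup>+y. indicator N (- x + y) \<partial>haar \<partial>haar)"
    by (rule Fubini_haar) measurable
  also have "\<dots> = 0"
    by (subst nn_integral_haar_translate) (simp_all add: N(2))
  finally have "(\<integral>\<^sup>+x. indicator N (- x) \<partial>(haar :: 'g measure)) * emeasure (haar :: 'g measure) UNIV = 0"
    by simp
  then have "(\<integral>\<^sup>+x. indicator N (- x) \<partial>(haar :: 'g measure)) = 0"
    using haar_nonzero[where 'a='g] by (metis mult_eq_0_iff)
  then have "AE x in haar. indicator N (- x) = (0::ennreal)"
    by (subst (asm) nn_integral_0_iff_AE) measurable
  then show ?thesis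
    by eventually_elim (use N(1) in \<open>auto split: split_indicator_asm\<close>)
qed

lemma AE_haar_reflect:
  assumes "AE x in haar :: 'g::{locally_compact_group, second_countable_topology} measure. P x"
  shows "AE y in haar. P (- y + x)"
  using AE_haar_translate[OF AE_haar_uminus[OF assms], of x] by (simp add: minus_add)

text \<open>Right translation is left translation conjugated by inversion, and both preserve null
  sets.\<close>

lemma AE_haar_right_translate:
  assumes "AE x in haar :: 'g::{locally_compact_group, second_countable_topology} measure. P x"
  shows "AE x in haar. P (x + g)"
  using AE_haar_uminus[OF AE_haar_reflect[OF assms, of g]] by simp

text \<open>Replaces the modular function: almost every right translate of an integrable function is integrable.\<close>

lemma nn_integral_haar_right_translates:
  fixes u v :: "'g::{locally_compact_group, second_countable_topology} \<Rightarrow> ennreal"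
  assumes [measurable]: "u \<in> borel_measurable borel" "v \<in> borel_measurable borel"
  shows "(\<integral>\<^sup>+x. v (- x) * (\<integral>\<^sup>+y. u (y + x) \<partial>haar) \<partial>haar)
    = (\<integral>\<^sup>+x. u x \<partial>haar) * (\<integral>\<^sup>+x. v x \<partial>haar)"
proof -
  have "(\<integral>\<^sup>+x. v (- x) * (\<integral>\<^sup>+y. u (y + x) \<partial>haar) \<partial>haar)
      = (\<integral>\<^sup>+x. \<integral>\<^sup>+y. v (- x) * u (y + x) \<partial>haar \<partial>haar)"
    by (intro nn_integral_cong nn_integral_cmult[symmetric]) measurable
  also have "\<dots> = (\<integral>\<^sup>+y. \<integral>\<^sup>+x. v (- x) * u (y + x) \<partial>haar \<partial>haar)"
    by (rule Fubini_haar) measurable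
  also have "\<dots> = (\<integral>\<^sup>+y. \<integral>\<^sup>+x. v (- x + y) * u x \<partial>haar \<partial>haar)"
  proof (rule nn_integral_cong)
    fix y :: 'g
    show "(\<integral>\<^sup>+x. v (- x) * u (y + x) \<partial>haar) = (\<integral>\<^sup>+x. v (- x + y) * u x \<partial>haar)"
      using nn_integral_haar_translate[of "\<lambda>x. v (- x) * u (y + x)" y]
      by (simp add: minus_add add.assoc[symmetric])
  qed
  also have "\<dots> = (\<integral>\<^sup>+x. \<integral>\<^sup>+y. v (- x + y) * u x \<partial>haar \<partial>haar)"
    by (rule Fubini_haar) measurable
  also have "\<dots> = (\<integral>\<^sup>+x. (\<integral>\<^sup>+y. v y \<partial>haar) * u x \<partial>haar)"
  proof (rule nn_integral_cong)
    fix x :: 'g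
    show "(\<integral>\<^sup>+y. v (- x + y) * u x \<partial>haar) = (\<integral>\<^sup>+y. v y \<partial>haar) * u x"
      using nn_integral_haar_translate[of v x] by (subst nn_integral_multc) auto
  qed
  also have "\<dots> = (\<integral>\<^sup>+x. u x \<partial>haar) * (\<integral>\<^sup>+x. v x \<partial>haar)"
    by (subst nn_integral_cmult) (auto simp: mult.commute)
  finally show ?thesis .
qed

text \<open>By inner regularity some compact \<open>K\<close> has more than half of the total mass.
  Then no translate \<open>g + K\<close> is disjoint from \<open>K\<close>, so every
  \<open>g\<close> is a difference of two points of \<open>K\<close>.\<close>

lemma haar_finite_imp_compact:
  assumes "emeasure (haar :: 'g::locally_compact_group measure) UNIV < \<infinity>"
  shows "compact (UNIV :: 'g set)"
proof -
  let ?m = "emeasure (haar :: 'g measure)"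
  have "?m UNIV / 2 < ?m UNIV"
    using assms haar_nonzero[where 'a='g]
    by (subst divide_less_ennreal) (auto simp: mult_2_right less_top[symmetric] zero_less_iff_neq_zero
        ennreal_add_left_cancel_less[of _ 0, simplified])
  then have "?m UNIV / 2 < (SUP K\<in>{K. compact K \<and> K \<subseteq> UNIV}. ?m K)"
    by (simp only: haar_inner_regular[OF open_UNIV, symmetric])
  then obtain K where K: "compact K" "?m UNIV / 2 < ?m K"
    by (auto simp: less_SUP_iff)
  have Ks: "K \<in> sets haar" using K(1) by (simp add: compact_imp_closed borel_closed)
  have meet: "((+) g ` K) \<inter> K \<noteq> {}" for g
  proof
    assume dis: "((+) g ` K) \<inter> K = {}"
    have "continuous_on K ((+) g)"
      unfolding continuous_on_def by (intro ballI tendsto_add tendsto_const tendsto_ident_at)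
    then have "compact ((+) g ` K)" using K(1) by (rule compact_continuous_image)
    then have gK: "(+) g ` K \<in> sets haar" by (simp add: compact_imp_closed borel_closed)
    have "?m K + ?m K = ?m ((+) g ` K \<union> K)"
      using plus_emeasure[OF gK Ks dis] haar_left_invariant[OF Ks] by simp
    also have "\<dots> \<le> ?m UNIV" by (rule emeasure_mono) simp_all
    finally have "?m K * 2 \<le> ?m UNIV" by (simp add: mult_2_right)
    then show False
      using K(2) by (simp add: divide_less_ennreal)
  qed
  have "UNIV = (\<lambda>p. fst p + - snd p) ` (K \<times> K)"
  proof (intro equalityI subsetI)
    fix g
    obtain x y where "x \<in> K" "y \<in> K" "g + x = y" using meet[of g] by auto
    then show "g \<in> (\<lambda>p. fst p + - snd p) ` (K \<times> K)"
      by (intro image_eqI[of _ _ "(y, x)"]) (auto simp: add.assoc)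
  qed simp
  moreover have "continuous_on (K \<times> K) (\<lambda>p. fst p + - snd p)"
    unfolding continuous_on_def
    by (intro ballI tendsto_add tendsto_minus tendsto_fst[OF tendsto_ident_at] tendsto_snd[OF tendsto_ident_at])
  ultimately show ?thesis
    using compact_continuous_image[OF _ compact_Times[OF K(1) K(1)]] by metis
qed

section \<open>Kernels whose measure is invariant under inversion\<close>

lemma exists_positive_integrable:
  obtains f :: "'g::{locally_compact_group, second_countable_topology} \<Rightarrow> real"
    where "\<And>x. 0 < f x" "integrable haar f" "f \<in> borel_measurable borel"
proof -
  interpret sigma_finite_measure "haar :: 'g measure" by (rule sigma_finite_haar)
  obtain h :: "'g \<Rightarrow> ennreal" where h: "h \<in> borel_measurable haar" "(\<integral>\<^sup>+x. h x \<partial>haar) \<noteq> \<infinity>"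
      "\<And>x. 0 < h x \<and> h x < \<infinity>"
    using Ex_finite_integrable_function by auto
  show ?thesis
  proof (rule that[of "\<lambda>x. enn2real (h x)"])
    show "0 < enn2real (h x)" for x using h(3)[of x] by (simp add: enn2real_positive_iff)
    show "(\<lambda>x. enn2real (h x)) \<in> borel_measurable borel" using h(1) by simp
    have "(\<integral>\<^sup>+x. ennreal (enn2real (h x)) \<partial>haar) = (\<integral>\<^sup>+x. h x \<partial>haar)"
      using h(3) by (intro nn_integral_cong) simp
    then show "integrable haar (\<lambda>x. enn2real (h x))"
      using h(1,2) by (intro integrableI_nonneg) (auto simp: less_top)
  qed
qed

text \<open>Inversion preserves null sets, so the image of the finite measure \<open>f dx\<close>
  under inversion has a Radon-Nikodym density; it is finite a.e. because the total mass is finite,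
  and \<open>f'\<close> is its real-valued version.\<close>

lemma exists_reflection:
  fixes f :: "'g::{locally_compact_group, second_countable_topology} \<Rightarrow> real"
  assumes f: "integrable haar f" "\<And>x. 0 \<le> f x"
  obtains f' :: "'g \<Rightarrow> real" where "\<And>x. 0 \<le> f' x" "integrable haar f'"
    "\<And>u. u \<in> borel_measurable borel \<Longrightarrow>
      (\<integral>\<^sup>+x. ennreal (f x) * u (- x) \<partial>haar) = (\<integral>\<^sup>+x. ennreal (f' x) * u x \<partial>haar)"
proof -
  interpret sigma_finite_measure "haar :: 'g measure" by (rule sigma_finite_haar)
  have [measurable]: "f \<in> borel_measurable borel"
    using borel_measurable_integrable[OF f(1)] by simp
  have um: "uminus \<in> measurable (density haar (\<lambda>x. ennreal (f x))) (haar :: 'g measure)" by simp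
  define N where "N = distr (density haar (\<lambda>x. ennreal (f x))) (haar :: 'g measure) uminus"
  have N: "(\<integral>\<^sup>+x. u x \<partial>N) = (\<integral>\<^sup>+x. ennreal (f x) * u (- x) \<partial>haar)" if "u \<in> borel_measurable borel" for u
    unfolding N_def using that by (subst nn_integral_distr[OF um]) (auto simp: nn_integral_density)
  have fin: "(\<integral>\<^sup>+x. 1 \<partial>N) < \<infinity>"
    using f by (simp only: N[OF borel_measurable_const]) (simp add: nn_integral_eq_integral)
  then have "finite_measure N" by (intro finite_measureI) (simp add: N_def)
  moreover have "absolutely_continuous haar N"
    unfolding absolutely_continuous_def
  proof
    fix B :: "'g set" assume B: "B \<in> null_sets haar"
    then have [measurable]: "B \<in> sets borel" by auto
    have "AE x in haar. - x \<notin> B"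
      using AE_haar_uminus[OF AE_not_in[OF B]] .
    then have "(\<integral>\<^sup>+x. ennreal (f x) * indicator B (- x) \<partial>haar) = 0"
      by (subst nn_integral_0_iff_AE) (auto elim!: eventually_mono)
    then have "emeasure N B = 0"
      using N[of "indicator B"] by (simp add: N_def)
    then show "B \<in> null_sets N" by (intro null_setsI) (simp_all add: N_def)
  qed
  ultimately obtain d where d: "d \<in> borel_measurable haar" "density haar d = N"
    using Radon_Nikodym[of N] by (auto simp: N_def)
  have dN: "(\<integral>\<^sup>+x. u x \<partial>N) = (\<integral>\<^sup>+x. d x * u x \<partial>haar)" if "u \<in> borel_measurable borel" for u
    using d that by (simp add: nn_integral_density flip: d(2))
  have dfin: "AE x in haar. d x \<noteq> \<infinity>"
    using fin d(1) dN[of "\<lambda>_. 1"] by (intro nn_integral_PInf_AE) auto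
  show ?thesis
  proof (rule that[of "\<lambda>x. enn2real (d x)"])
    show *: "(\<integral>\<^sup>+x. ennreal (f x) * u (- x) \<partial>haar) = (\<integral>\<^sup>+x. ennreal (enn2real (d x)) * u x \<partial>haar)"
      if "u \<in> borel_measurable borel" for u
    proof -
      have "(\<integral>\<^sup>+x. d x * u x \<partial>haar) = (\<integral>\<^sup>+x. ennreal (enn2real (d x)) * u x \<partial>haar)"
        by (rule nn_integral_cong_AE) (use dfin in eventually_elim, auto simp: less_top)
      then show ?thesis using N[OF that] dN[OF that] by simp
    qed
    show "integrable haar (\<lambda>x. enn2real (d x))"
      using d(1) *[of "\<lambda>_. 1"] fin N[of "\<lambda>_. 1"] by (intro integrableI_nonneg) auto
  qed simp
qed

text \<open>Symmetry is expressed by the measure \<open>k dx\<close>, which avoids the modular function.\<close>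

lemma exists_symmetric_kernel:
  obtains k :: "'g::{locally_compact_group, second_countable_topology} \<Rightarrow> real"
  where "\<And>x. 0 < k x" "integrable haar k"
    "distr (density haar (\<lambda>x. ennreal (k x))) haar uminus = density haar (\<lambda>x. ennreal (k x))"
proof -
  obtain f :: "'g \<Rightarrow> real" where f: "\<And>x. 0 < f x" "integrable haar f" and [measurable]: "f \<in> borel_measurable borel"
    using exists_positive_integrable by metis
  obtain f' where f': "\<And>x. 0 \<le> f' x" "integrable haar f'"
    and refl: "\<And>u. u \<in> borel_measurable borel \<Longrightarrow>
      (\<integral>\<^sup>+x. ennreal (f x) * u (- x) \<partial>haar) = (\<integral>\<^sup>+x. ennreal (f' x) * u x \<partial>haar)"
    using exists_reflection[OF f(2) less_imp_le[OF f(1)]] by metis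
  have [measurable]: "f' \<in> borel_measurable borel"
    using borel_measurable_integrable[OF f'(2)] by simp
  \<comment> \<open>Inversion exchanges the measures \<open>f dx\<close> and \<open>f' dx\<close>,
    so it preserves their sum; strict positivity comes from \<open>f\<close> alone.\<close>
  let ?k = "\<lambda>x. f x + f' x"
  have um: "uminus \<in> measurable (density haar (\<lambda>x. ennreal (?k x))) (haar :: 'g measure)" by simp
  show ?thesis
  proof (rule that[of ?k])
    show "0 < ?k x" for x using f(1)[of x] f'(1)[of x] by simp
    show "integrable haar ?k" using f(2) f'(2) by simp
    show "distr (density haar (\<lambda>x. ennreal (?k x))) haar uminus = density haar (\<lambda>x. ennreal (?k x))"
    proof (rule measure_eqI)
      fix B :: "'g set" assume "B \<in> sets (distr (density haar (\<lambda>x. ennreal (?k x))) haar uminus)"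
      then have [measurable]: "B \<in> sets borel" by simp
      have split: "(\<integral>\<^sup>+x. ennreal (?k x) * u x \<partial>haar) =
          (\<integral>\<^sup>+x. ennreal (f x) * u x \<partial>haar) + (\<integral>\<^sup>+x. ennreal (f' x) * u x \<partial>haar)"
        if [measurable]: "u \<in> borel_measurable borel" for u
        using f(1) f'(1) by (subst nn_integral_add[symmetric]) (auto simp: less_imp_le distrib_right)
      have "emeasure (distr (density haar (\<lambda>x. ennreal (?k x))) haar uminus) B
          = (\<integral>\<^sup>+x. indicator B x \<partial>distr (density haar (\<lambda>x. ennreal (?k x))) haar uminus)"
        by simp
      also have "\<dots> = (\<integral>\<^sup>+x. ennreal (?k x) * indicator B (- x) \<partial>haar)"
        by (subst nn_integral_distr[OF um]) (simp_all add: nn_integral_density)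
      also have "\<dots> = (\<integral>\<^sup>+x. ennreal (?k x) * indicator B x \<partial>haar)"
      proof -
        have B: "(indicator B :: 'g \<Rightarrow> ennreal) \<in> borel_measurable borel"
          and B': "(\<lambda>x. indicator B (- x) :: ennreal) \<in> borel_measurable borel"
          by measurable
        show ?thesis
          unfolding split[OF B] split[OF B'] refl[OF B] refl[OF B', unfolded minus_minus]
          by (rule add.commute)
      qed
      also have "\<dots> = emeasure (density haar (\<lambda>x. ennreal (?k x))) B"
        by (simp add: emeasure_density)
      finally show "emeasure (distr (density haar (\<lambda>x. ennreal (?k x))) haar uminus) B
          = emeasure (density haar (\<lambda>x. ennreal (?k x))) B" .
    qed simp
  qed
qed

section \<open>Fixed functions of a positive convolution operator\<close>

lemma square_integrable_iff_nn_integral: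
  "square_integrable f \<longleftrightarrow> f \<in> borel_measurable borel \<and> (\<integral>\<^sup>+x. ennreal ((cmod (f x))\<^sup>2) \<partial>haar) < \<infinity>"
  by (auto simp: square_integrable_def integrable_iff_bounded)

lemma AE_eq_of_nn_integral_le:
  assumes [measurable]: "a \<in> borel_measurable M" "b \<in> borel_measurable M"
    and le: "AE x in M. a x \<le> b x"
    and int: "(\<integral>\<^sup>+x. b x \<partial>M) \<le> (\<integral>\<^sup>+x. a x \<partial>M)" "(\<integral>\<^sup>+x. a x \<partial>M) < \<infinity>"
  shows "AE x in M. b x = a x"
proof -
  have "(\<integral>\<^sup>+x. b x - a x \<partial>M) = (\<integral>\<^sup>+x. b x \<partial>M) - (\<integral>\<^sup>+x. a x \<partial>M)"
    using int(2) le by (intro nn_integral_diff) auto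
  also have "\<dots> = 0" using int by (simp add: diff_eq_0_iff_ennreal)
  finally have "AE x in M. b x - a x = 0"
    by (subst (asm) nn_integral_0_iff_AE) auto
  moreover have "AE x in M. a x \<noteq> \<infinity>"
    using int(2) by (intro nn_integral_PInf_AE) auto
  ultimately show ?thesis
    using le by eventually_elim (auto simp: diff_eq_0_iff_ennreal)
qed

lemma ennreal_power2_eq_iff: "a\<^sup>2 = b\<^sup>2 \<longleftrightarrow> a = (b::ennreal)"
  by (cases a; cases b) (auto simp: ennreal_power power_eq_top_ennreal)

text \<open>Values in \<open>ennreal\<close> make this defined at every point for every non-negative
  function, with monotonicity and additivity free of integrability conditions.\<close>

definition positive_convolution ::
  "('g::locally_compact_group \<Rightarrow> real) \<Rightarrow> ('g \<Rightarrow> ennreal) \<Rightarrow> 'g \<Rightarrow> ennreal" where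
  "positive_convolution k u x = (\<integral>\<^sup>+y. ennreal (k y) * u (- y + x) \<partial>haar)"

locale positive_kernel =
  fixes k :: "'g::{locally_compact_group, second_countable_topology} \<Rightarrow> real"
  assumes pos: "0 < k x"
    and integrable: "integrable haar k"
    and contraction: "square_integrable f \<Longrightarrow>
      (\<integral>x. (cmod (convolution (\<lambda>y. complex_of_real (k y)) f x))\<^sup>2 \<partial>haar) \<le> (\<integral>x. (cmod (f x))\<^sup>2 \<partial>haar)"
begin

abbreviation "A \<equiv> positive_convolution k"

lemma k_measurable [measurable]: "k \<in> borel_measurable borel"
  using borel_measurable_integrable[OF integrable] by simp

lemma A_measurable [measurable]:
  assumes [measurable]: "u \<in> borel_measurable borel"
  shows "A u \<in> borel_measurable borel"
proof -
  interpret sigma_finite_measure "haar :: 'g measure" by (rule sigma_finite_haar)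
  have "(\<lambda>x. \<integral>\<^sup>+y. ennreal (k y) * u (- y + x) \<partial>haar) \<in> borel_measurable borel"
    by measurable
  then show ?thesis by (simp add: positive_convolution_def[abs_def])
qed

lemma A_mono: "(\<And>x. u x \<le> w x) \<Longrightarrow> A u x \<le> A w x"
  unfolding positive_convolution_def by (intro nn_integral_mono mult_left_mono) auto

text \<open>The map taking \<open>y\<close> to \<open>- y + x\<close> pulls null sets back to null
  sets, so \<open>A u\<close> is determined at every point by the a.e. class of
  \<open>u\<close>.\<close>

lemma A_cong_AE:
  assumes "AE x in haar. u x = w x"
  shows "A u x = A w x"
  unfolding positive_convolution_def
proof (rule nn_integral_cong_AE)
  show "AE y in haar. ennreal (k y) * u (- y + x) = ennreal (k y) * w (- y + x)"
    using AE_haar_reflect[OF assms, of x] by eventually_elim simp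
qed

lemma A_add:
  assumes [measurable]: "u \<in> borel_measurable borel" "w \<in> borel_measurable borel"
  shows "A (\<lambda>x. u x + w x) x = A u x + A w x"
  unfolding positive_convolution_def distrib_left by (rule nn_integral_add) measurable

lemma A_cmult:
  assumes [measurable]: "u \<in> borel_measurable borel"
  shows "A (\<lambda>x. c * u x) x = c * A u x"
  unfolding positive_convolution_def mult.left_commute[of _ c] by (rule nn_integral_cmult) measurable

lemma norm_convolution_le_A:
  assumes "f \<in> borel_measurable borel"
  shows "ennreal (cmod (convolution (\<lambda>y. complex_of_real (k y)) f x)) \<le> A (\<lambda>z. ennreal (cmod (f z))) x"
proof -
  have "(\<lambda>y. complex_of_real (k y)) \<in> borel_measurable haar" "f \<in> borel_measurable haar"
    using assms by simp_all
  then have "ennreal (cmod (convolution (\<lambda>y. complex_of_real (k y)) f x))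
      \<le> (\<integral>\<^sup>+y. ennreal (cmod (complex_of_real (k y) * f (- y + x))) \<partial>haar)"
    by (rule convolution_le_nn)
  also have "\<dots> = A (\<lambda>z. ennreal (cmod (f z))) x"
    unfolding positive_convolution_def using pos
    by (intro nn_integral_cong) (simp add: norm_mult ennreal_mult less_imp_le)
  finally show ?thesis .
qed

text \<open>If the right side is finite, \<open>u\<close> agrees a.e. with the modulus of a square
  integrable function, and \<open>A u\<close> a.e. with its convolution by \<open>k\<close>, to
  which \<open>contraction\<close> applies.\<close>

lemma A_contraction:
  assumes [measurable]: "u \<in> borel_measurable borel"
  shows "(\<integral>\<^sup>+x. (A u x)\<^sup>2 \<partial>haar) \<le> (\<integral>\<^sup>+x. (u x)\<^sup>2 \<partial>haar)"
proof (cases "(\<integral>\<^sup>+x. (u x)\<^sup>2 \<partial>haar) = \<infinity>")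
  case False
  define f where "f x = complex_of_real (enn2real (u x))" for x
  have [measurable]: "f \<in> borel_measurable borel" unfolding f_def by measurable
  have "AE x in haar. (u x)\<^sup>2 \<noteq> \<infinity>"
    using False by (intro nn_integral_PInf_AE) auto
  then have uf: "AE x in haar. u x = ennreal (cmod (f x))"
    by eventually_elim (auto simp: f_def less_top power_eq_top_ennreal)
  then have int: "(\<integral>\<^sup>+x. (u x)\<^sup>2 \<partial>haar) = (\<integral>\<^sup>+x. ennreal ((cmod (f x))\<^sup>2) \<partial>haar)"
    by (intro nn_integral_cong_AE) (auto elim!: eventually_mono simp: ennreal_power)
  then have f: "square_integrable f"
    using False by (simp add: square_integrable_iff_nn_integral less_top)
  have ki: "integrable haar (\<lambda>y. complex_of_real (k y))"
    using integrable by (rule integrable_of_real)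
  let ?c = "convolution (\<lambda>y. complex_of_real (k y)) f"
  have "AE x in haar. A u x = ennreal (cmod (?c x))"
    using AE_integrable_convolution[OF ki f]
  proof eventually_elim
    fix x assume i: "Bochner_Integration.integrable haar (\<lambda>y. complex_of_real (k y) * f (- y + x))"
    let ?r = "\<lambda>y. k y * enn2real (u (- y + x))"
    have "?c x = complex_of_real (\<integral>y. ?r y \<partial>haar)"
      unfolding convolution_def f_def by (simp flip: of_real_mult)
    moreover have "Bochner_Integration.integrable haar ?r"
      using i unfolding f_def by (simp flip: of_real_mult add: complex_of_real_integrable_eq)
    moreover have "0 \<le> ?r y" for y using pos[of y] by simp
    ultimately have "ennreal (cmod (?c x)) = (\<integral>\<^sup>+y. ennreal (?r y) \<partial>haar)"
      by (subst nn_integral_eq_integral) (auto simp: integral_nonneg_AE)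
    also have "\<dots> = A (\<lambda>z. ennreal (cmod (f z))) x"
      unfolding positive_convolution_def f_def using pos
      by (intro nn_integral_cong) (simp add: ennreal_mult less_imp_le)
    also have "\<dots> = A u x"
      by (rule A_cong_AE[symmetric, OF uf])
    finally show "A u x = ennreal (cmod (?c x))" by simp
  qed
  then have "(\<integral>\<^sup>+x. (A u x)\<^sup>2 \<partial>haar) = (\<integral>\<^sup>+x. ennreal ((cmod (?c x))\<^sup>2) \<partial>haar)"
    by (intro nn_integral_cong_AE) (auto elim!: eventually_mono simp: ennreal_power)
  also have "\<dots> = ennreal (\<integral>x. (cmod (?c x))\<^sup>2 \<partial>haar)"
    using square_integrable_convolution[OF ki f]
    by (intro nn_integral_eq_integral) (auto simp: square_integrable_def)
  also have "\<dots> \<le> ennreal (\<integral>x. (cmod (f x))\<^sup>2 \<partial>haar)"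
    by (intro ennreal_leI contraction f)
  also have "\<dots> = (\<integral>\<^sup>+x. (u x)\<^sup>2 \<partial>haar)"
    unfolding int using f by (intro nn_integral_eq_integral[symmetric]) (auto simp: square_integrable_def)
  finally show ?thesis .
qed simp

text \<open>A pointwise increase is incompatible with the contraction in mean square unless it is an
  equality a.e.\<close>

lemma A_fixed_of_le:
  assumes [measurable]: "u \<in> borel_measurable borel"
    and "AE x in haar. u x \<le> A u x" "(\<integral>\<^sup>+x. (u x)\<^sup>2 \<partial>haar) < \<infinity>"
  shows "AE x in haar. A u x = u x"
proof -
  have "AE x in haar. (u x)\<^sup>2 \<le> (A u x)\<^sup>2"
    using assms(2) by eventually_elim (simp add: power_mono)
  then have "AE x in haar. (A u x)\<^sup>2 = (u x)\<^sup>2"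
    by (rule AE_eq_of_nn_integral_le[rotated 2]) (use assms(3) A_contraction[OF assms(1)] in auto)
  then show ?thesis by eventually_elim (simp add: ennreal_power2_eq_iff)
qed

text \<open>Since \<open>k\<close> is strictly positive everywhere, \<open>A u\<close> vanishing at
  a single point forces \<open>u\<close> to vanish a.e.\<close>

lemma A_pos:
  assumes [measurable]: "u \<in> borel_measurable borel" and nonzero: "\<not> (AE x in haar. u x = 0)"
  shows "0 < A u x"
proof (rule ccontr)
  assume "\<not> 0 < A u x"
  then have "(\<integral>\<^sup>+y. ennreal (k y) * u (- y + x) \<partial>haar) = 0"
    by (simp add: positive_convolution_def)
  then have "AE y in haar. ennreal (k y) * u (- y + x) = 0"
    by (subst (asm) nn_integral_0_iff_AE) measurable
  then have "AE y in haar. u (- y + x) = 0"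
    by eventually_elim (metis pos ennreal_eq_0_iff mult_eq_0_iff not_less)
  from AE_haar_right_translate[OF AE_haar_uminus[OF this], of "- x"]
  have "AE y in haar. u y = 0" by (simp add: add.assoc)
  with nonzero show False by blast
qed

section \<open>Perron-Frobenius theory of the fixed functions\<close>

definition fixpoint :: "('g \<Rightarrow> ennreal) \<Rightarrow> bool" where
  "fixpoint u \<longleftrightarrow> u \<in> borel_measurable borel \<and> (\<integral>\<^sup>+x. (u x)\<^sup>2 \<partial>haar) < \<infinity> \<and> (AE x in haar. A u x = u x)"

lemma fixpoint_zero_or_pos:
  assumes "fixpoint u"
  shows "(AE x in haar. u x = 0) \<or> (AE x in haar. 0 < u x)"
proof (cases "AE x in haar. u x = 0")
  case False
  have "AE x in haar. A u x = u x" using assms by (simp add: fixpoint_def)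
  then have "AE x in haar. 0 < u x"
    by eventually_elim (metis A_pos False assms fixpoint_def)
  then show ?thesis ..
qed simp

lemma fixpoint_finite:
  assumes "fixpoint u"
  shows "AE x in haar. u x < \<infinity>"
proof -
  have "AE x in haar. (u x)\<^sup>2 \<noteq> \<infinity>"
    using assms by (intro nn_integral_PInf_AE) (auto simp: fixpoint_def)
  then show ?thesis by eventually_elim (auto simp: less_top power_eq_top_ennreal)
qed

text \<open>Subtraction in \<open>ennreal\<close> is truncated, so this is the positive part of
  \<open>u - c p\<close>. The maximum \<open>w\<close> of \<open>u\<close> and \<open>c p\<close>
  satisfies \<open>w \<le> A w\<close> by monotonicity, hence is fixed; it is \<open>c p\<close>
  plus the positive part, and \<open>c p\<close>, which is fixed and a.e. finite, cancels.\<close>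

lemma fixpoint_truncated_diff:
  assumes u: "fixpoint u" and p: "fixpoint p" and c: "c < \<infinity>"
  shows "fixpoint (\<lambda>x. u x - c * p x)"
proof -
  have [measurable]: "u \<in> borel_measurable borel" "p \<in> borel_measurable borel"
    using u p by (auto simp: fixpoint_def)
  define w where "w x = max (u x) (c * p x)" for x
  have [measurable]: "w \<in> borel_measurable borel" unfolding w_def by measurable
  have "(\<integral>\<^sup>+x. (w x)\<^sup>2 \<partial>haar) \<le> (\<integral>\<^sup>+x. (u x)\<^sup>2 + c\<^sup>2 * (p x)\<^sup>2 \<partial>haar)"
    by (intro nn_integral_mono) (auto simp: w_def max_def power_mult_distrib)
  also have "\<dots> = (\<integral>\<^sup>+x. (u x)\<^sup>2 \<partial>haar) + c\<^sup>2 * (\<integral>\<^sup>+x. (p x)\<^sup>2 \<partial>haar)"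
    by (subst nn_integral_add) (auto simp: nn_integral_cmult)
  also have "\<dots> < \<infinity>"
    using u p c by (auto simp: fixpoint_def ennreal_mult_less_top power_less_top_ennreal)
  finally have w2: "(\<integral>\<^sup>+x. (w x)\<^sup>2 \<partial>haar) < \<infinity>" .
  have Au: "AE x in haar. A u x = u x" and Ap: "AE x in haar. A p x = p x"
    using u p by (auto simp: fixpoint_def)
  have "AE x in haar. A w x = w x"
  proof (rule A_fixed_of_le[OF _ _ w2])
    show "AE x in haar. w x \<le> A w x"
      using Au Ap
    proof eventually_elim
      fix x assume "A u x = u x" "A p x = p x"
      moreover have "A u x \<le> A w x" by (rule A_mono) (simp add: w_def)
      moreover have "A (\<lambda>x. c * p x) x \<le> A w x" by (rule A_mono) (simp add: w_def)
      ultimately show "w x \<le> A w x" by (simp add: w_def A_cmult)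
    qed
  qed measurable
  moreover have w: "w = (\<lambda>x. c * p x + (u x - c * p x))"
    by (auto simp: w_def max_def fun_eq_iff add_diff_inverse_ennreal diff_eq_0_iff_ennreal top_unique not_less)
  have "A w x = c * A p x + A (\<lambda>x. u x - c * p x) x" for x
    unfolding w by (subst A_add) (simp_all add: A_cmult)
  ultimately have "AE x in haar. A (\<lambda>x. u x - c * p x) x = u x - c * p x"
    using Ap fixpoint_finite[OF p]
  proof (elim AE_mp, intro AE_I2 impI)
    fix x assume *: "\<And>x. A w x = c * A p x + A (\<lambda>x. u x - c * p x) x"
      and "p x < \<infinity>" "A p x = p x" "A w x = w x"
    then have "c * p x + A (\<lambda>x. u x - c * p x) x = c * p x + (u x - c * p x)"
      by (metis w)
    moreover have "c * p x \<noteq> top" using c \<open>p x < \<infinity>\<close> by (auto simp: ennreal_mult_eq_top_iff)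
    ultimately show "A (\<lambda>x. u x - c * p x) x = u x - c * p x"
      by (simp add: ennreal_add_left_cancel)
  qed
  moreover have "(\<integral>\<^sup>+x. (u x - c * p x)\<^sup>2 \<partial>haar) \<le> (\<integral>\<^sup>+x. (u x)\<^sup>2 \<partial>haar)"
    by (intro nn_integral_mono power_mono) (auto simp: diff_le_self_ennreal)
  then have "(\<integral>\<^sup>+x. (u x - c * p x)\<^sup>2 \<partial>haar) < \<infinity>"
    by (rule le_less_trans) (use u in \<open>simp add: fixpoint_def\<close>)
  ultimately show ?thesis by (simp add: fixpoint_def)
qed

text \<open>
  With \<open>c\<close> the coefficient of the projection of \<open>u\<close> onto \<open>p\<close>, the positive part of \<open>u - c p\<close> is again a
  fixed point, hence zero or positive a.e.; orthogonality to \<open>p\<close> forces \<open>u = c p\<close> in both cases.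
\<close>

lemma fixpoint_proportional:
  assumes u: "fixpoint u" and p: "fixpoint p" and pos: "AE x in haar. 0 < p x"
  shows "AE x in haar. u x = (\<integral>\<^sup>+x. u x * p x \<partial>haar) / (\<integral>\<^sup>+x. (p x)\<^sup>2 \<partial>haar) * p x"
proof -
  have [measurable]: "u \<in> borel_measurable borel" "p \<in> borel_measurable borel"
    using u p by (auto simp: fixpoint_def)
  let ?S = "\<integral>\<^sup>+x. u x * p x \<partial>haar" and ?I = "\<integral>\<^sup>+x. (p x)\<^sup>2 \<partial>haar"
  define c where "c = ?S / ?I"
  have "?S \<le> (\<integral>\<^sup>+x. (u x)\<^sup>2 + (p x)\<^sup>2 \<partial>haar)"
  proof (rule nn_integral_mono)
    fix x
    have "u x * p x \<le> max (u x) (p x) * max (u x) (p x)" by (intro mult_mono) auto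
    also have "\<dots> \<le> (u x)\<^sup>2 + (p x)\<^sup>2" by (auto simp: max_def power2_eq_square)
    finally show "u x * p x \<le> (u x)\<^sup>2 + (p x)\<^sup>2" .
  qed
  also have "\<dots> = (\<integral>\<^sup>+x. (u x)\<^sup>2 \<partial>haar) + ?I" by (rule nn_integral_add) auto
  also have "\<dots> < \<infinity>" using u p by (simp add: fixpoint_def)
  finally have S: "?S < \<infinity>" .
  have I: "?I < \<infinity>" using p by (simp add: fixpoint_def)
  have I0: "?I \<noteq> 0"
  proof
    assume "?I = 0"
    then have "AE x in haar. (p x)\<^sup>2 = 0" by (subst (asm) nn_integral_0_iff_AE) auto
    with pos have "AE x in (haar :: 'g measure). False" by eventually_elim simp
    then show False using haar_not_AE_False by blast
  qed
  have c: "c < \<infinity>" unfolding c_def using S I0 by (simp add: ennreal_divide_eq_top_iff less_top[symmetric])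
  have cI: "(\<integral>\<^sup>+x. c * p x * p x \<partial>haar) = ?S"
  proof -
    have "(\<integral>\<^sup>+x. c * p x * p x \<partial>haar) = c * ?I"
      by (subst nn_integral_cmult[symmetric]) (auto simp: power2_eq_square mult.assoc)
    also have "\<dots> = ?S" unfolding c_def using I I0 by (simp add: ennreal_divide_times ennreal_mult_divide_eq)
    finally show ?thesis .
  qed
  have pfin: "AE x in haar. p x < \<infinity>" by (rule fixpoint_finite[OF p])
  from fixpoint_zero_or_pos[OF fixpoint_truncated_diff[OF u p c]]
  have "(AE x in haar. u x \<le> c * p x) \<or> (AE x in haar. c * p x < u x)"
  proof
    assume "AE x in haar. u x - c * p x = 0"
    then have "AE x in haar. u x \<le> c * p x"
      by eventually_elim (simp add: diff_eq_0_iff_ennreal)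
    then show ?thesis ..
  next
    assume "AE x in haar. 0 < u x - c * p x"
    then have "AE x in haar. c * p x < u x"
      using fixpoint_finite[OF u]
      by eventually_elim (metis diff_eq_0_iff_ennreal infinity_ennreal_def less_irrefl not_le)
    then show ?thesis ..
  qed
  \<comment> \<open>By the choice of \<open>c\<close> both sides have the finite integral
    \<open>?S\<close>, so an inequality in either direction is an equality a.e.\<close>
  then have "AE x in haar. u x * p x = c * p x * p x"
  proof
    assume "AE x in haar. u x \<le> c * p x"
    then have "AE x in haar. u x * p x \<le> c * p x * p x" by eventually_elim (simp add: mult_right_mono)
    then have "AE x in haar. c * p x * p x = u x * p x"
      by (rule AE_eq_of_nn_integral_le[rotated 2]) (use S cI in auto)
    then show ?thesis by eventually_elim simp
  next
    assume "AE x in haar. c * p x < u x"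
    then have "AE x in haar. c * p x * p x \<le> u x * p x" by eventually_elim (simp add: mult_right_mono)
    then show ?thesis
      by (rule AE_eq_of_nn_integral_le[rotated 2]) (use S cI in auto)
  qed
  then have "AE x in haar. u x = c * p x"
    using pos pfin
  proof eventually_elim
    fix x assume eq: "u x * p x = c * p x * p x" and p: "0 < p x" "p x < \<infinity>"
    have "u x = u x * p x / p x" using p by (simp add: ennreal_mult_divide_eq)
    also have "\<dots> = c * p x" unfolding eq using p by (simp add: ennreal_mult_divide_eq)
    finally show "u x = c * p x" .
  qed
  then show ?thesis by (simp add: c_def)
qed

theorem fixpoint_imp_finite:
  assumes p: "fixpoint p" and nonzero: "\<not> (AE x in haar. p x = 0)"
  shows "emeasure (haar :: 'g measure) UNIV < \<infinity>"
proof -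
  have [measurable]: "p \<in> borel_measurable borel" using p by (auto simp: fixpoint_def)
  have pos: "AE x in haar. 0 < p x" using fixpoint_zero_or_pos[OF p] nonzero by blast
  let ?I = "\<integral>\<^sup>+x. (p x)\<^sup>2 \<partial>haar"
  have I: "?I < \<infinity>" using p by (simp add: fixpoint_def)
  obtain v :: "'g \<Rightarrow> real" where v: "\<And>x. 0 < v x" "Bochner_Integration.integrable haar v"
      "v \<in> borel_measurable borel"
    using exists_positive_integrable by metis
  note [measurable] = v(3)
  \<comment> \<open>The strictly positive weight \<open>v\<close> makes the integral over all
    translates finite, so almost every right translate of \<open>p\<close> is square
    integrable.\<close>
  have "(\<integral>\<^sup>+x. ennreal (v (- x)) * (\<integral>\<^sup>+y. (p (y + x))\<^sup>2 \<partial>haar) \<partial>haar) = ?I * (\<integral>\<^sup>+x. ennreal (v x) \<partial>haar)"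
    using nn_integral_haar_right_translates[of "\<lambda>x. (p x)\<^sup>2" "\<lambda>x. ennreal (v x)"] by simp
  also have "\<dots> < \<infinity>"
    using I v by (subst nn_integral_eq_integral) (auto simp: less_imp_le ennreal_mult_less_top)
  finally have "AE x in haar. ennreal (v (- x)) * (\<integral>\<^sup>+y. (p (y + x))\<^sup>2 \<partial>haar) \<noteq> \<infinity>"
  proof (intro nn_integral_PInf_AE)
    interpret sigma_finite_measure "haar :: 'g measure" by (rule sigma_finite_haar)
    have "(\<lambda>x. ennreal (v (- x)) * (\<integral>\<^sup>+y. (p (y + x))\<^sup>2 \<partial>haar)) \<in> borel_measurable borel" by measurable
    then show "(\<lambda>x. ennreal (v (- x)) * (\<integral>\<^sup>+y. (p (y + x))\<^sup>2 \<partial>haar)) \<in> borel_measurable haar" by simp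
  qed auto
  then have "AE g in haar. (\<integral>\<^sup>+y. (p (y + g))\<^sup>2 \<partial>haar) < \<infinity>"
  proof eventually_elim
    fix g assume "ennreal (v (- g)) * (\<integral>\<^sup>+y. (p (y + g))\<^sup>2 \<partial>haar) \<noteq> \<infinity>"
    moreover have "ennreal (v (- g)) \<noteq> 0" using v(1)[of "- g"] by (simp add: ennreal_eq_0_iff)
    ultimately show "(\<integral>\<^sup>+y. (p (y + g))\<^sup>2 \<partial>haar) < \<infinity>"
      by (auto simp: ennreal_mult_eq_top_iff less_top)
  qed
  define c where "c g = (\<integral>\<^sup>+x. p (x + g) * p x \<partial>haar) / ?I" for g
  have [measurable]: "c \<in> borel_measurable borel"
  proof -
    interpret sigma_finite_measure "haar :: 'g measure" by (rule sigma_finite_haar)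
    show ?thesis unfolding c_def[abs_def] by measurable
  qed
  have "AE g in haar. AE x in haar. p (x + g) = c g * p x"
    using \<open>AE g in haar. (\<integral>\<^sup>+y. (p (y + g))\<^sup>2 \<partial>haar) < \<infinity>\<close>
  proof eventually_elim
    fix g assume fin: "(\<integral>\<^sup>+y. (p (y + g))\<^sup>2 \<partial>haar) < \<infinity>"
    have "A (\<lambda>x. p (x + g)) x = A p (x + g)" for x
      by (simp add: positive_convolution_def add.assoc)
    moreover have "AE x in haar. A p (x + g) = p (x + g)"
      using p by (intro AE_haar_right_translate) (simp add: fixpoint_def)
    ultimately have "fixpoint (\<lambda>x. p (x + g))"
      using fin by (simp add: fixpoint_def)
    from fixpoint_proportional[OF this p pos]
    show "AE x in haar. p (x + g) = c g * p x" by (simp add: c_def)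
  qed
  then have "AE x in haar. AE g in haar. p (x + g) = c g * p x"
    by (subst pair_sigma_finite.AE_commute[OF pair_sigma_finite_haar]) measurable
  \<comment> \<open>With the quantifiers exchanged, \<open>x\<close> is fixed and \<open>g\<close>
    varies: \<open>p (x + g)\<close> is then a left translate of \<open>p\<close>, whose integrated
    square is \<open>?I\<close> whatever \<open>x\<close> is. Hence \<open>(p x)\<^sup>2\<close>
    does not depend on \<open>x\<close>, up to a null set.\<close>
  then have scale: "AE x in haar. ?I = (p x)\<^sup>2 * (\<integral>\<^sup>+g. (c g)\<^sup>2 \<partial>haar)"
  proof eventually_elim
    fix x assume "AE g in haar. p (x + g) = c g * p x"
    then have "(\<integral>\<^sup>+g. (p (x + g))\<^sup>2 \<partial>haar) = (\<integral>\<^sup>+g. (p x)\<^sup>2 * (c g)\<^sup>2 \<partial>haar)"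
      by (intro nn_integral_cong_AE) (auto elim!: eventually_mono simp: power_mult_distrib mult.commute)
    also have "\<dots> = (p x)\<^sup>2 * (\<integral>\<^sup>+g. (c g)\<^sup>2 \<partial>haar)"
      by (rule nn_integral_cmult) measurable
    finally show "?I = (p x)\<^sup>2 * (\<integral>\<^sup>+g. (c g)\<^sup>2 \<partial>haar)"
      using nn_integral_haar_translate_plus[of "\<lambda>g. (p g)\<^sup>2" x] by simp
  qed
  define J where "J = (\<integral>\<^sup>+g. (c g)\<^sup>2 \<partial>(haar :: 'g measure))"
  have I0: "?I \<noteq> 0"
    using nonzero by (subst nn_integral_0_iff_AE) (auto elim!: eventually_mono)
  have level: "AE x in haar. (p x)\<^sup>2 = ?I / J \<and> J \<noteq> 0 \<and> J \<noteq> top"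
    using scale pos
  proof eventually_elim
    fix x assume eq: "?I = (p x)\<^sup>2 * (\<integral>\<^sup>+g. (c g)\<^sup>2 \<partial>haar)" and "0 < p x"
    then have J: "J \<noteq> 0" "J \<noteq> top"
      using I I0 by (auto simp: J_def ennreal_mult_eq_top_iff)
    have "(p x)\<^sup>2 = (p x)\<^sup>2 * J / J" using J by (simp add: ennreal_mult_divide_eq)
    then show "(p x)\<^sup>2 = ?I / J \<and> J \<noteq> 0 \<and> J \<noteq> top"
      using J unfolding J_def eq[symmetric] by blast
  qed
  have J: "J \<noteq> top"
  proof
    assume "J = top"
    with level have "AE x in (haar :: 'g measure). False" by (auto elim: eventually_mono)
    then show False using haar_not_AE_False by blast
  qed
  have "?I = (\<integral>\<^sup>+x. ?I / J \<partial>(haar :: 'g measure))"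
    by (rule nn_integral_cong_AE) (use level in \<open>auto elim: eventually_mono\<close>)
  then have eq: "?I = ?I / J * emeasure (haar :: 'g measure) UNIV" by simp
  \<comment> \<open>\<open>?I\<close> is the integral of the nonzero constant \<open>?I / J\<close>,
    so infinite Haar measure would make \<open>?I\<close> infinite.\<close>
  have "?I / J \<noteq> 0" using I0 J by (simp add: ennreal_divide_eq_0_iff)
  then have "?I / J * top = top" by (simp add: ennreal_mult_top)
  then show ?thesis
    using I eq by (cases "emeasure (haar :: 'g measure) UNIV = top") (auto simp: less_top)
qed

text \<open>The modulus \<open>u\<close> of \<open>f\<close> satisfies
  \<open>u \<le> A (A u)\<close>, and contraction makes this an equality a.e. Adding
  \<open>A u\<close> gives a function fixed by \<open>A\<close> itself, which also deals with a
  possible eigenvalue -1 of the convolution operator.\<close>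

lemma fixpoint_of_square:
  assumes f: "square_integrable f"
    and fixed: "AE x in haar. convolution (\<lambda>y. complex_of_real (k y))
      (convolution (\<lambda>y. complex_of_real (k y)) f) x = f x"
  obtains p where "fixpoint p" "\<And>x. ennreal (cmod (f x)) \<le> p x"
proof -
  let ?K = "convolution (\<lambda>y. complex_of_real (k y))"
  define u where "u x = ennreal (cmod (f x))" for x
  have [measurable]: "f \<in> borel_measurable borel" using f by (simp add: square_integrable_iff_nn_integral)
  have [measurable]: "u \<in> borel_measurable borel" unfolding u_def by measurable
  have Kf [measurable]: "?K f \<in> borel_measurable borel"
    using measurable_convolution[of "\<lambda>y. complex_of_real (k y)" f] by simp
  have u2: "(\<integral>\<^sup>+x. (u x)\<^sup>2 \<partial>haar) < \<infinity>"
    using f by (simp add: square_integrable_iff_nn_integral u_def ennreal_power)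
  have "u x \<le> A (A u) x" if "?K (?K f) x = f x" for x
  proof -
    have "u x = ennreal (cmod (?K (?K f) x))" by (simp add: u_def that)
    also have "\<dots> \<le> A (\<lambda>z. ennreal (cmod (?K f z))) x" by (rule norm_convolution_le_A[OF Kf])
    also have "\<dots> \<le> A (A u) x"
      by (rule A_mono) (simp add: u_def[abs_def] norm_convolution_le_A)
    finally show ?thesis .
  qed
  with fixed have "AE x in haar. u x \<le> A (A u) x" by (auto elim!: eventually_mono)
  then have "AE x in haar. (u x)\<^sup>2 \<le> (A (A u) x)\<^sup>2" by eventually_elim (simp add: power_mono)
  moreover have Au2: "(\<integral>\<^sup>+x. (A u x)\<^sup>2 \<partial>haar) \<le> (\<integral>\<^sup>+x. (u x)\<^sup>2 \<partial>haar)"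
    by (rule A_contraction) measurable
  then have "(\<integral>\<^sup>+x. (A (A u) x)\<^sup>2 \<partial>haar) \<le> (\<integral>\<^sup>+x. (u x)\<^sup>2 \<partial>haar)"
    using A_contraction[of "A u"] by (intro order_trans[OF _ Au2]) measurable
  ultimately have "AE x in haar. (A (A u) x)\<^sup>2 = (u x)\<^sup>2"
    by (intro AE_eq_of_nn_integral_le u2) measurable
  then have AAu: "AE x in haar. A (A u) x = u x" by eventually_elim (simp add: ennreal_power2_eq_iff)
  define p where "p x = u x + A u x" for x
  have [measurable]: "p \<in> borel_measurable borel" unfolding p_def by measurable
  have "AE x in haar. A p x = p x"
    using AAu unfolding p_def by eventually_elim (simp add: A_add add.commute)
  moreover have "(\<integral>\<^sup>+x. (p x)\<^sup>2 \<partial>haar) < \<infinity>"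
  proof -
    have "(\<integral>\<^sup>+x. (p x)\<^sup>2 \<partial>haar) \<le> (\<integral>\<^sup>+x. 4 * (u x)\<^sup>2 + 4 * (A u x)\<^sup>2 \<partial>haar)"
    proof (rule nn_integral_mono)
      fix x
      have "p x \<le> 2 * max (u x) (A u x)"
        unfolding p_def mult_2 by (intro add_mono) auto
      then have "(p x)\<^sup>2 \<le> (2 * max (u x) (A u x))\<^sup>2" by (rule power_mono) simp
      also have "\<dots> \<le> 4 * (u x)\<^sup>2 + 4 * (A u x)\<^sup>2" by (auto simp: max_def power_mult_distrib)
      finally show "(p x)\<^sup>2 \<le> 4 * (u x)\<^sup>2 + 4 * (A u x)\<^sup>2" .
    qed
    also have "\<dots> = 4 * (\<integral>\<^sup>+x. (u x)\<^sup>2 \<partial>haar) + 4 * (\<integral>\<^sup>+x. (A u x)\<^sup>2 \<partial>haar)"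
      by (subst nn_integral_add) (auto simp: nn_integral_cmult)
    also have "\<dots> < \<infinity>" using u2 le_less_trans[OF Au2 u2] by (simp add: ennreal_mult_less_top)
    finally show ?thesis .
  qed
  ultimately have "fixpoint p" by (simp add: fixpoint_def)
  then show ?thesis by (rule that) (simp add: p_def u_def)
qed

end

section \<open>Completeness of \<open>L\<^sup>2(G)\<close>\<close>

lemma L2_rel_refl_iff [simp]: "L2_rel f f \<longleftrightarrow> square_integrable f"
  by (auto simp: L2_rel_def)

lemma L2_cases:
  fixes x :: "'g::locally_compact_group L2"
  obtains f where "square_integrable f" "x = abs_L2 f"
proof
  show "square_integrable (rep_L2 x)"
    using Quotient_rep_reflp[OF Quotient_L2, of x] by simp
  show "x = abs_L2 (rep_L2 x)"
    using Quotient_abs_rep[OF Quotient_L2, of x] by simp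
qed

lemma square_integrable_diff:
  assumes "square_integrable f" "square_integrable g"
  shows "square_integrable (\<lambda>x. f x - g x)"
  using square_integrable_add[OF assms(1) square_integrable_uminus[OF assms(2)]] by simp

lemma abs_L2_diff:
  assumes "square_integrable f" "square_integrable g"
  shows "abs_L2 f - abs_L2 g = abs_L2 (\<lambda>x. f x - g x)"
  using assms by (simp add: minus_L2_def plus_L2.abs_eq uminus_L2.abs_eq square_integrable_uminus)

lemma dist_abs_L2:
  assumes f: "square_integrable f" and g: "square_integrable g"
  shows "ennreal ((dist (abs_L2 f) (abs_L2 g))\<^sup>2) = (\<integral>\<^sup>+x. ennreal ((cmod (f x - g x))\<^sup>2) \<partial>haar)"
proof -
  note d = square_integrable_diff[OF f g]
  have "(dist (abs_L2 f) (abs_L2 g))\<^sup>2 = (\<integral>x. (cmod (f x - g x))\<^sup>2 \<partial>haar)"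
    using d by (simp add: dist_norm abs_L2_diff[OF f g] norm_L2.abs_eq)
  then show ?thesis
    using d by (simp add: nn_integral_eq_integral square_integrable_def)
qed

lemma abs_L2_eq_0_iff:
  assumes "square_integrable f"
  shows "abs_L2 f = 0 \<longleftrightarrow> (AE x in haar. f x = 0)"
  using assms Quotient_rel[OF Quotient_L2, of f "\<lambda>_. 0"]
  by (auto simp: zero_L2_def L2_rel_def square_integrable_zero)

lemma abs_L2_cong_AE:
  assumes "square_integrable f" "square_integrable g" "AE x in haar. f x = g x"
  shows "abs_L2 f = abs_L2 g"
  by (rule Quotient_rel_abs[OF Quotient_L2]) (rule L2_relI[OF assms])

lemma Cauchy_fast_subseq:
  fixes X :: "nat \<Rightarrow> 'a::metric_space" and \<epsilon> :: "nat \<Rightarrow> real"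
  assumes "Cauchy X" "\<And>n. 0 < \<epsilon> n"
  obtains r :: "nat \<Rightarrow> nat" where "strict_mono r" "\<And>n i j. r n \<le> i \<Longrightarrow> r n \<le> j \<Longrightarrow> dist (X i) (X j) < \<epsilon> n"
proof -
  define P where "P n m \<longleftrightarrow> (\<forall>i\<ge>m. \<forall>j\<ge>m. dist (X i) (X j) < \<epsilon> n)" for n m :: nat
  have ex: "\<exists>m. P n m" for n
    using metric_CauchyD[OF assms(1) assms(2)[of n]] by (auto simp: P_def)
  have "\<exists>r. \<forall>n. P n (r n) \<and> r n < r (Suc n)"
  proof (rule dependent_nat_choice)
    show "\<exists>m. P 0 m" by (rule ex)
    fix m n
    obtain m' where "P (Suc n) m'" using ex by blast
    then have "P (Suc n) (max m' (Suc m)) \<and> m < max m' (Suc m)" by (auto simp: P_def)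
    then show "\<exists>m'. P (Suc n) m' \<and> m < m'" by blast
  qed
  then obtain r where r: "\<And>n. P n (r n)" "\<And>n. r n < r (Suc n)" by blast
  show ?thesis
  proof (rule that)
    show "strict_mono r" using r(2) by (simp add: strict_mono_Suc_iff)
    show "dist (X i) (X j) < \<epsilon> n" if "r n \<le> i" "r n \<le> j" for n i j
      using r(1)[of n] that by (simp add: P_def)
  qed
qed

text \<open>Each weighted term is at most the finite sum \<open>G\<close>, so the increments are
  dominated by a geometric series of ratio \<open>1 / sqrt 2\<close>.\<close>

lemma convergent_of_weighted_squares:
  fixes z :: "nat \<Rightarrow> complex"
  assumes "(\<Sum>n. ennreal (2 ^ n * (cmod (z (Suc n) - z n))\<^sup>2)) \<noteq> \<infinity>"
  shows "convergent z"
proof -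
  let ?d = "\<lambda>n. cmod (z (Suc n) - z n)"
  define a where "a n = ennreal (2 ^ n * (?d n)\<^sup>2)" for n
  have "suminf a \<noteq> top" using assms unfolding a_def[abs_def] by simp
  then obtain G where G: "0 \<le> G" "suminf a = ennreal G"
    by (cases "suminf a") auto
  have bound: "?d n \<le> sqrt G * (1 / sqrt 2) ^ n" for n
  proof -
    have "sum a {n} \<le> suminf a" by (rule sum_le_suminf) auto
    then have "ennreal (2 ^ n * (?d n)\<^sup>2) \<le> ennreal G" unfolding G(2) by (simp add: a_def)
    then have "2 ^ n * (?d n)\<^sup>2 \<le> G" using G(1) by (subst (asm) ennreal_le_iff)
    then have "sqrt (2 ^ n * (?d n)\<^sup>2) \<le> sqrt G" by (rule real_sqrt_le_mono)
    then show ?thesis by (simp add: real_sqrt_mult real_sqrt_power power_divide le_divide_eq mult.commute)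
  qed
  have "1 / sqrt 2 < (1::real)" by simp
  then have "summable (\<lambda>n. sqrt G * (1 / sqrt 2) ^ n)"
    by (intro summable_mult summable_geometric) simp
  then have "summable (\<lambda>n. z (Suc n) - z n)"
    by (rule summable_comparison_test[rotated]) (use bound in auto)
  then have "convergent (\<lambda>n. \<Sum>i<n. z (Suc i) - z i)"
    by (simp add: summable_iff_convergent)
  then have "convergent (\<lambda>n. (z n - z 0) + z 0)"
    by (intro convergent_add convergent_const) (simp add: sum_lessThan_telescope)
  then show ?thesis by simp
qed

text \<open>Riesz-Fischer. Along a fast subsequence the squared increments have integral at most
  \<open>(1/4) ^ n\<close>; the weights \<open>2 ^ n\<close> still leave a convergent series, so the
  subsequence converges a.e., and Fatou's lemma upgrades this to convergence in norm. Completeness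
  provides the limits of the iterates of \<open>T\<close>.\<close>

instance L2 :: (locally_compact_group) complete_space
proof
  fix X :: "nat \<Rightarrow> 'a L2"
  assume "Cauchy X"
  then obtain r where r: "strict_mono r"
    and small: "\<And>n i j. r n \<le> i \<Longrightarrow> r n \<le> j \<Longrightarrow> dist (X i) (X j) < (1/2) ^ n"
    by (rule Cauchy_fast_subseq[where \<epsilon> = "\<lambda>n. (1/2) ^ n"]) auto
  have "\<exists>f. square_integrable f \<and> X (r n) = abs_L2 f" for n
    by (rule L2_cases[of "X (r n)"]) blast
  then obtain f where f: "\<And>n. square_integrable (f n)" and Xf: "\<And>n. X (r n) = abs_L2 (f n)"
    by metis
  have [measurable]: "f n \<in> borel_measurable haar" for n
    using f[of n] by (simp add: square_integrable_def)
  have close: "(\<integral>\<^sup>+x. ennreal ((cmod (f i x - f j x))\<^sup>2) \<partial>haar) \<le> ennreal ((1/4) ^ n)"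
    if "n \<le> i" "n \<le> j" for n i j
  proof -
    have "dist (abs_L2 (f i)) (abs_L2 (f j)) < (1/2) ^ n"
      using small[of n "r i" "r j"] that r by (simp add: strict_mono_less_eq Xf)
    then have "(dist (abs_L2 (f i)) (abs_L2 (f j)))\<^sup>2 \<le> ((1/2) ^ n)\<^sup>2"
      by (intro power_mono) auto
    also have "\<dots> = (1/4) ^ n" by (simp add: power2_eq_square power_mult_distrib[symmetric])
    finally show ?thesis
      by (simp add: dist_abs_L2[OF f f, symmetric] ennreal_leI)
  qed
  have "(\<integral>\<^sup>+x. (\<Sum>n. ennreal (2 ^ n * (cmod (f (Suc n) x - f n x))\<^sup>2)) \<partial>haar)
      = (\<Sum>n. \<integral>\<^sup>+x. ennreal (2 ^ n * (cmod (f (Suc n) x - f n x))\<^sup>2) \<partial>haar)"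
    by (rule nn_integral_suminf) measurable
  also have "\<dots> \<le> (\<Sum>n. ennreal ((1/2) ^ n))"
  proof (rule suminf_le)
    fix n
    have "(\<integral>\<^sup>+x. ennreal (2 ^ n * (cmod (f (Suc n) x - f n x))\<^sup>2) \<partial>haar)
        = ennreal (2 ^ n) * (\<integral>\<^sup>+x. ennreal ((cmod (f (Suc n) x - f n x))\<^sup>2) \<partial>haar)"
      by (subst nn_integral_cmult[symmetric]) (auto simp: ennreal_mult)
    also have "\<dots> \<le> ennreal (2 ^ n) * ennreal ((1/4) ^ n)"
      by (intro mult_left_mono close) auto
    also have "\<dots> = ennreal ((1/2) ^ n)"
      by (simp add: ennreal_mult[symmetric] power_mult_distrib[symmetric])
    finally show "(\<integral>\<^sup>+x. ennreal (2 ^ n * (cmod (f (Suc n) x - f n x))\<^sup>2) \<partial>haar) \<le> ennreal ((1/2) ^ n)" .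
  qed auto
  also have "\<dots> < \<infinity>"
    by (subst suminf_ennreal2) (auto intro: summable_geometric)
  finally have "AE x in haar. (\<Sum>n. ennreal (2 ^ n * (cmod (f (Suc n) x - f n x))\<^sup>2)) \<noteq> \<infinity>"
    by (intro nn_integral_PInf_AE) auto
  then have conv: "AE x in haar. convergent (\<lambda>n. f n x)"
    by eventually_elim (rule convergent_of_weighted_squares)
  define l where "l x = lim (\<lambda>n. f n x)" for x
  have [measurable]: "l \<in> borel_measurable haar" unfolding l_def by measurable
  have lim: "(\<integral>\<^sup>+x. ennreal ((cmod (f n x - l x))\<^sup>2) \<partial>haar) \<le> ennreal ((1/4) ^ n)" for n
  proof -
    have "(\<integral>\<^sup>+x. ennreal ((cmod (f n x - l x))\<^sup>2) \<partial>haar)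
        = (\<integral>\<^sup>+x. liminf (\<lambda>i. ennreal ((cmod (f n x - f i x))\<^sup>2)) \<partial>haar)"
    proof (rule nn_integral_cong_AE, use conv in eventually_elim)
      fix x assume "convergent (\<lambda>n. f n x)"
      then have "(\<lambda>i. f i x) \<longlonglongrightarrow> l x" by (simp add: l_def convergent_LIMSEQ_iff)
      then have "(\<lambda>i. ennreal ((cmod (f n x - f i x))\<^sup>2)) \<longlonglongrightarrow> ennreal ((cmod (f n x - l x))\<^sup>2)"
        by (intro tendsto_ennrealI tendsto_intros)
      then show "ennreal ((cmod (f n x - l x))\<^sup>2) = liminf (\<lambda>i. ennreal ((cmod (f n x - f i x))\<^sup>2))"
        by (rule lim_imp_Liminf[OF trivial_limit_sequentially, symmetric])
    qed
    also have "\<dots> \<le> liminf (\<lambda>i. \<integral>\<^sup>+x. ennreal ((cmod (f n x - f i x))\<^sup>2) \<partial>haar)"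
      by (rule nn_integral_liminf) measurable
    also have "\<dots> \<le> liminf (\<lambda>i. ennreal ((1/4) ^ n))"
      by (rule Liminf_mono) (auto simp: eventually_sequentially intro!: exI[of _ n] close)
    finally show ?thesis by (simp add: Liminf_const)
  qed
  have "square_integrable (\<lambda>x. f 0 x - l x)"
    using le_less_trans[OF lim[of 0] ennreal_less_top] by (simp add: square_integrable_def integrable_iff_bounded)
  from square_integrable_diff[OF f[of 0] this] have l: "square_integrable l" by simp
  have "(\<lambda>n. X (r n)) \<longlonglongrightarrow> abs_L2 l"
  proof (rule tendstoI)
    have "dist (X (r n)) (abs_L2 l) \<le> (1/2) ^ n" for n
    proof -
      have "(dist (X (r n)) (abs_L2 l))\<^sup>2 \<le> (1/4) ^ n"
        using lim[of n] by (simp add: Xf dist_abs_L2[OF f l, symmetric])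
      also have "(1/4::real) ^ n = ((1/2) ^ n)\<^sup>2"
        by (simp add: power2_eq_square power_mult_distrib[symmetric])
      finally show ?thesis by (rule power2_le_imp_le) simp
    qed
    moreover fix e :: real assume "e > 0"
    then have "\<forall>\<^sub>F n in sequentially. (1/2) ^ n < e"
      by (intro order_tendstoD(2)[OF LIMSEQ_realpow_zero]) auto
    ultimately show "\<forall>\<^sub>F n in sequentially. dist (X (r n)) (abs_L2 l) < e"
      by (auto elim!: eventually_mono intro: le_less_trans)
  qed
  then have "X \<longlonglongrightarrow> abs_L2 l"
    using Cauchy_converges_subseq[OF \<open>Cauchy X\<close> r] by (simp add: o_def)
  then show "convergent X" by (rule convergentI)
qed

section \<open>The algebra of convolution operators\<close>

lemma integral_haar_translate:
  fixes f :: "'g::locally_compact_group \<Rightarrow> 'b::{banach, second_countable_topology}"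
  assumes "f \<in> borel_measurable borel"
  shows "(\<integral>x. f (- y + x) \<partial>haar) = (\<integral>x. f x \<partial>haar)"
proof -
  have "(\<integral>x. f x \<partial>distr haar haar (\<lambda>x. - y + x)) = (\<integral>x. f (- y + x) \<partial>haar)"
    by (rule integral_distr[OF measurable_left_translation]) (simp add: assms)
  then show ?thesis by (simp only: distr_haar)
qed

lemma Fubini_haar_integral:
  fixes F :: "'g::{locally_compact_group, second_countable_topology} \<Rightarrow> 'g \<Rightarrow> 'b::{banach, second_countable_topology}"
  assumes [measurable]: "(\<lambda>(x, y). F x y) \<in> borel_measurable (haar \<Otimes>\<^sub>M haar)"
    and fin: "(\<integral>\<^sup>+x. \<integral>\<^sup>+y. ennreal (norm (F x y)) \<partial>haar \<partial>haar) < \<infinity>"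
  shows "(\<integral>x. \<integral>y. F x y \<partial>haar \<partial>haar) = (\<integral>y. \<integral>x. F x y \<partial>haar \<partial>haar)"
proof -
  interpret pair_sigma_finite "haar :: 'g measure" "haar :: 'g measure"
    by (rule pair_sigma_finite_haar)
  have "(\<integral>\<^sup>+p. ennreal (norm (F (fst p) (snd p))) \<partial>(haar \<Otimes>\<^sub>M haar)) < \<infinity>"
    using fin by (subst sigma_finite_measure.nn_integral_fst[OF sigma_finite_haar, symmetric]) (auto simp: split_beta')
  then have "integrable (haar \<Otimes>\<^sub>M haar) (\<lambda>(x, y). F x y)"
    by (simp add: integrable_iff_bounded split_beta')
  then show ?thesis by (rule Fubini_integral[symmetric])
qed

context
  fixes f g :: "'g::{locally_compact_group, second_countable_topology} \<Rightarrow> complex"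
  assumes f: "integrable haar f" and g: "integrable haar g"
begin

lemma fg_measurable [measurable]: "f \<in> borel_measurable borel" "g \<in> borel_measurable borel"
  using f g by (auto dest: borel_measurable_integrable)

lemma nn_integral_abs_convolution:
  "(\<integral>\<^sup>+x. \<integral>\<^sup>+y. ennreal (cmod (f y * g (- y + x))) \<partial>haar \<partial>haar) < \<infinity>"
proof -
  have "(\<integral>\<^sup>+x. \<integral>\<^sup>+y. ennreal (cmod (f y * g (- y + x))) \<partial>haar \<partial>haar)
      = (\<integral>\<^sup>+y. \<integral>\<^sup>+x. ennreal (cmod (f y * g (- y + x))) \<partial>haar \<partial>haar)"
    by (rule Fubini_haar) measurable
  also have "\<dots> = (\<integral>\<^sup>+y. ennreal (cmod (f y)) * (\<integral>\<^sup>+x. ennreal (cmod (g x)) \<partial>haar) \<partial>haar)"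
  proof (rule nn_integral_cong)
    fix y
    have "(\<integral>\<^sup>+x. ennreal (cmod (f y * g (- y + x))) \<partial>haar)
        = ennreal (cmod (f y)) * (\<integral>\<^sup>+x. ennreal (cmod (g (- y + x))) \<partial>haar)"
      by (subst nn_integral_cmult[symmetric]) (auto simp: norm_mult ennreal_mult)
    then show "(\<integral>\<^sup>+x. ennreal (cmod (f y * g (- y + x))) \<partial>haar)
        = ennreal (cmod (f y)) * (\<integral>\<^sup>+x. ennreal (cmod (g x)) \<partial>haar)"
      using nn_integral_haar_translate[of "\<lambda>x. ennreal (cmod (g x))" y] by simp
  qed
  also have "\<dots> = (\<integral>\<^sup>+y. ennreal (cmod (f y)) \<partial>haar) * (\<integral>\<^sup>+x. ennreal (cmod (g x)) \<partial>haar)"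
    by (rule nn_integral_multc) measurable
  also have "\<dots> < \<infinity>"
    using f g by (simp add: integrable_iff_bounded ennreal_mult_less_top)
  finally show ?thesis .
qed

lemma integrable_convolution: "integrable haar (convolution f g)"
proof -
  have m: "f \<in> borel_measurable haar" "g \<in> borel_measurable haar" by simp_all
  have "(\<integral>\<^sup>+x. ennreal (cmod (convolution f g x)) \<partial>haar)
      \<le> (\<integral>\<^sup>+x. \<integral>\<^sup>+y. ennreal (cmod (f y * g (- y + x))) \<partial>haar \<partial>haar)"
    by (intro nn_integral_mono convolution_le_nn m)
  then show ?thesis
    using nn_integral_abs_convolution measurable_convolution[OF m]
    by (auto simp: integrable_iff_bounded intro: le_less_trans)
qed

text \<open>The convolution \<open>a\<close> of the moduli of \<open>f\<close> and \<open>g\<close>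
  has finite integral, so its real version \<open>F\<close> can be convolved with \<open>h\<close>
  at almost every \<open>x\<close>. This is the absolute convergence that Fubini needs at that
  \<open>x\<close>; left invariance then shifts the inner variable by \<open>y\<close>.\<close>

lemma convolution_assoc:
  assumes h: "square_integrable h"
  shows "AE x in haar. convolution (convolution f g) h x = convolution f (convolution g h) x"
proof -
  interpret sigma_finite_measure "haar :: 'g measure" by (rule sigma_finite_haar)
  have [measurable]: "h \<in> borel_measurable borel" using h by (simp add: square_integrable_def)
  define a where "a w = (\<integral>\<^sup>+y. ennreal (cmod (f y * g (- y + w))) \<partial>haar)" for w
  have [measurable]: "a \<in> borel_measurable borel"
    unfolding a_def[abs_def] by measurable
  have a: "(\<integral>\<^sup>+w. a w \<partial>haar) < \<infinity>" unfolding a_def by (rule nn_integral_abs_convolution)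
  define F where "F w = complex_of_real (enn2real (a w))" for w
  have "AE w in haar. a w \<noteq> \<infinity>" using a by (intro nn_integral_PInf_AE) auto
  then have Fa: "AE w in haar. ennreal (cmod (F w)) = a w"
    by eventually_elim (auto simp: F_def less_top)
  then have "(\<integral>\<^sup>+w. ennreal (cmod (F w)) \<partial>haar) = (\<integral>\<^sup>+w. a w \<partial>haar)"
    by (rule nn_integral_cong_AE)
  then have F: "integrable haar F"
    using a by (simp add: integrable_iff_bounded F_def[abs_def])
  show ?thesis
    using AE_integrable_convolution[OF F h]
  proof eventually_elim
    fix x assume "integrable haar (\<lambda>w. F w * h (- w + x))"
    then have "(\<integral>\<^sup>+w. ennreal (cmod (F w)) * ennreal (cmod (h (- w + x))) \<partial>haar) < \<infinity>"
      by (simp add: integrable_iff_bounded norm_mult ennreal_mult)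
    also have "(\<integral>\<^sup>+w. ennreal (cmod (F w)) * ennreal (cmod (h (- w + x))) \<partial>haar)
        = (\<integral>\<^sup>+w. a w * ennreal (cmod (h (- w + x))) \<partial>haar)"
      by (rule nn_integral_cong_AE) (use Fa in eventually_elim, simp)
    also have "\<dots> = (\<integral>\<^sup>+w. \<integral>\<^sup>+y. ennreal (norm (f y * g (- y + w) * h (- w + x))) \<partial>haar \<partial>haar)"
      unfolding a_def by (intro nn_integral_cong)
        (subst nn_integral_multc[symmetric], auto simp: norm_mult ennreal_mult)
    finally have fin: "(\<integral>\<^sup>+w. \<integral>\<^sup>+y. ennreal (norm (f y * g (- y + w) * h (- w + x))) \<partial>haar \<partial>haar) < \<infinity>" .
    have "convolution (convolution f g) h x = (\<integral>w. \<integral>y. f y * g (- y + w) * h (- w + x) \<partial>haar \<partial>haar)"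
      by (simp add: convolution_def)
    also have "\<dots> = (\<integral>y. \<integral>w. f y * g (- y + w) * h (- w + x) \<partial>haar \<partial>haar)"
      by (rule Fubini_haar_integral[OF _ fin]) measurable
    also have "\<dots> = (\<integral>y. f y * convolution g h (- y + x) \<partial>haar)"
    proof (rule Bochner_Integration.integral_cong[OF refl])
      fix y
      have "(\<integral>w. f y * g (- y + w) * h (- w + x) \<partial>haar) = f y * (\<integral>w. g (- y + w) * h (- w + x) \<partial>haar)"
        by (simp add: mult.assoc)
      also have "(\<integral>w. g (- y + w) * h (- w + x) \<partial>haar)
          = (\<integral>w. g (- y + w) * h (- (- y + w) + (- y + x)) \<partial>haar)"
        by (simp add: minus_add add.assoc)
      also have "\<dots> = (\<integral>z. g z * h (- z + (- y + x)) \<partial>haar)"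
        by (rule integral_haar_translate[of "\<lambda>z. g z * h (- z + (- y + x))"]) measurable
      finally show "(\<integral>w. f y * g (- y + w) * h (- w + x) \<partial>haar) = f y * convolution g h (- y + x)"
        by (simp add: convolution_def)
    qed
    finally show "convolution (convolution f g) h x = convolution f (convolution g h) x"
      by (simp add: convolution_def[of f])
  qed
qed

end

lemma convolve_L2_abs:
  "integrable haar f \<Longrightarrow> square_integrable h \<Longrightarrow> convolve_L2 f (abs_L2 h) = abs_L2 (convolution f h)"
  by (simp add: convolve_L2.abs_eq)

lemma convolve_L2_convolution:
  assumes f: "integrable haar f" and g: "integrable haar g"
  shows "convolve_L2 (convolution f g) x = convolve_L2 f (convolve_L2 g x)"
proof -
  obtain h where h: "square_integrable h" "x = abs_L2 h" by (rule L2_cases)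
  note gh = square_integrable_convolution[OF g h(1)] and fg = integrable_convolution[OF f g]
  show ?thesis
    unfolding h(2) convolve_L2_abs[OF fg h(1)] convolve_L2_abs[OF g h(1)] convolve_L2_abs[OF f gh]
    by (intro abs_L2_cong_AE square_integrable_convolution fg h f gh convolution_assoc g)
qed

text \<open>Writes the form as an integral against the measure \<open>k dx\<close>, on which the
  invariance under inversion can act.\<close>

lemma inner_convolve_L2:
  fixes k :: "'g::{locally_compact_group, second_countable_topology} \<Rightarrow> real"
  assumes k: "integrable haar k" "\<And>x. 0 < k x" and h: "square_integrable h" and g: "square_integrable g"
  shows "inner (convolve_L2 (\<lambda>y. complex_of_real (k y)) (abs_L2 h)) (abs_L2 g)
    = (\<integral>y. k y * (\<integral>x. inner (h (- y + x)) (g x) \<partial>haar) \<partial>haar)"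
proof -
  let ?k = "\<lambda>y. complex_of_real (k y)"
  have ki: "integrable haar ?k" using k(1) by (rule integrable_of_real)
  have [measurable]: "k \<in> borel_measurable borel" "h \<in> borel_measurable borel" "g \<in> borel_measurable borel"
    using k(1) h g by (auto simp: square_integrable_def dest: borel_measurable_integrable)
  let ?F = "\<lambda>x y. k y * inner (h (- y + x)) (g x)"
  let ?n = "\<lambda>h. \<integral>\<^sup>+x. ennreal ((cmod (h x))\<^sup>2) \<partial>haar"
  have nfin: "?n h < \<infinity>" "?n g < \<infinity>" using h g by (simp_all add: square_integrable_iff_nn_integral)
  have "(\<integral>\<^sup>+x. \<integral>\<^sup>+y. ennreal (norm (?F x y)) \<partial>haar \<partial>haar) = (\<integral>\<^sup>+y. \<integral>\<^sup>+x. ennreal (norm (?F x y)) \<partial>haar \<partial>haar)"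
    by (rule Fubini_haar) measurable
  also have "\<dots> \<le> (\<integral>\<^sup>+y. ennreal (k y) * (?n h + ?n g) \<partial>haar)"
  proof (rule nn_integral_mono)
    fix y
    have bound: "ennreal (norm (?F x y)) \<le> ennreal (k y) *
        (ennreal ((cmod (h (- y + x)))\<^sup>2) + ennreal ((cmod (g x))\<^sup>2))" for x
    proof -
      have "\<bar>inner a b\<bar> \<le> (cmod a)\<^sup>2 + (cmod b)\<^sup>2" for a b :: complex
      proof -
        have "\<bar>inner a b\<bar> \<le> cmod a * cmod b" by (rule Cauchy_Schwarz_ineq2)
        then show ?thesis
          using sum_squares_bound[of "cmod a" "cmod b"]
            mult_nonneg_nonneg[OF norm_ge_zero norm_ge_zero, of a b] by linarith
      qed
      then have "norm (?F x y) \<le> k y * ((cmod (h (- y + x)))\<^sup>2 + (cmod (g x))\<^sup>2)"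
        using k(2)[of y] by (simp add: abs_mult)
      then show ?thesis
        using k(2)[of y] by (simp add: ennreal_leI flip: ennreal_mult ennreal_plus)
    qed
    have "(\<integral>\<^sup>+x. ennreal (norm (?F x y)) \<partial>haar) \<le> (\<integral>\<^sup>+x. ennreal (k y) *
        (ennreal ((cmod (h (- y + x)))\<^sup>2) + ennreal ((cmod (g x))\<^sup>2)) \<partial>haar)"
      by (rule nn_integral_mono) (rule bound)
    also have "\<dots> = ennreal (k y) * ((\<integral>\<^sup>+x. ennreal ((cmod (h (- y + x)))\<^sup>2) \<partial>haar) + ?n g)"
      by (subst nn_integral_cmult) (auto simp: nn_integral_add)
    also have "(\<integral>\<^sup>+x. ennreal ((cmod (h (- y + x)))\<^sup>2) \<partial>haar) = ?n h"
      by (rule nn_integral_haar_translate[of "\<lambda>x. ennreal ((cmod (h x))\<^sup>2)"]) measurable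
    finally show "(\<integral>\<^sup>+x. ennreal (norm (?F x y)) \<partial>haar) \<le> ennreal (k y) * (?n h + ?n g)" .
  qed
  also have "\<dots> = (\<integral>\<^sup>+y. ennreal (k y) \<partial>haar) * (?n h + ?n g)"
    by (rule nn_integral_multc) measurable
  also have "\<dots> < \<infinity>"
    using nfin k by (simp add: nn_integral_eq_integral less_imp_le ennreal_mult_less_top)
  finally have fin: "(\<integral>\<^sup>+x. \<integral>\<^sup>+y. ennreal (norm (?F x y)) \<partial>haar \<partial>haar) < \<infinity>" .
  have "inner (convolve_L2 ?k (abs_L2 h)) (abs_L2 g) = (\<integral>x. inner (convolution ?k h x) (g x) \<partial>haar)"
    using ki h g by (simp add: convolve_L2_abs inner_L2.abs_eq square_integrable_convolution)
  also have "\<dots> = (\<integral>x. \<integral>y. ?F x y \<partial>haar \<partial>haar)"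
  proof (rule integral_cong_AE)
    have "convolution ?k h \<in> borel_measurable borel"
      using measurable_convolution[of ?k h] by simp
    then show "(\<lambda>x. inner (convolution ?k h x) (g x)) \<in> borel_measurable haar" by simp
    interpret sigma_finite_measure "haar :: 'g measure" by (rule sigma_finite_haar)
    have "(\<lambda>x. \<integral>y. ?F x y \<partial>haar) \<in> borel_measurable borel" by measurable
    then show "(\<lambda>x. \<integral>y. ?F x y \<partial>haar) \<in> borel_measurable haar" by simp
    show "AE x in haar. inner (convolution ?k h x) (g x) = (\<integral>y. ?F x y \<partial>haar)"
      using AE_integrable_convolution[OF ki h]
    proof eventually_elim
      fix x assume "integrable haar (\<lambda>y. ?k y * h (- y + x))"
      then have "inner (convolution ?k h x) (g x) = (\<integral>y. inner (?k y * h (- y + x)) (g x) \<partial>haar)"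
        unfolding convolution_def by (rule integral_inner_left[symmetric])
      then show "inner (convolution ?k h x) (g x) = (\<integral>y. ?F x y \<partial>haar)"
        by (simp flip: scaleR_conv_of_real)
    qed
  qed
  also have "\<dots> = (\<integral>y. \<integral>x. ?F x y \<partial>haar \<partial>haar)"
    by (rule Fubini_haar_integral[OF _ fin]) measurable
  finally show ?thesis by simp
qed

text \<open>The form is the integral of \<open>\<Phi>\<close> against \<open>k dx\<close>, where
  \<open>\<Phi> y\<close> pairs the left translate of \<open>h\<close> by \<open>y\<close> with
  \<open>g\<close>. Replacing \<open>y\<close> by \<open>- y\<close> is allowed by
  \<open>sym\<close>, and left invariance moves the translation from \<open>h\<close> to
  \<open>g\<close>.\<close>

lemma convolve_L2_symmetric:
  fixes k :: "'g::{locally_compact_group, second_countable_topology} \<Rightarrow> real"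
  assumes k: "integrable haar k" "\<And>x. 0 < k x"
    and sym: "distr (density haar (\<lambda>x. ennreal (k x))) haar uminus = density haar (\<lambda>x. ennreal (k x))"
  shows "inner (convolve_L2 (\<lambda>y. complex_of_real (k y)) x) z = inner x (convolve_L2 (\<lambda>y. complex_of_real (k y)) z)"
proof -
  obtain h g where h: "square_integrable h" "x = abs_L2 h" and g: "square_integrable g" "z = abs_L2 g"
    by (metis L2_cases)
  have [measurable]: "k \<in> borel_measurable borel" "h \<in> borel_measurable borel" "g \<in> borel_measurable borel"
    using k(1) h g by (auto simp: square_integrable_def dest: borel_measurable_integrable)
  define \<Phi> where "\<Phi> y = (\<integral>x. inner (h (- y + x)) (g x) \<partial>haar)" for y
  interpret sigma_finite_measure "haar :: 'g measure" by (rule sigma_finite_haar)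
  have \<Phi>m [measurable]: "\<Phi> \<in> borel_measurable borel"
    unfolding \<Phi>_def[abs_def] by measurable
  have um: "uminus \<in> measurable (density haar (\<lambda>x. ennreal (k x))) (haar :: 'g measure)" by simp
  have dens: "(\<integral>y. \<Psi> y \<partial>density haar (\<lambda>x. ennreal (k x))) = (\<integral>y. k y * \<Psi> y \<partial>haar)"
    if "\<Psi> \<in> borel_measurable borel" for \<Psi> :: "'g \<Rightarrow> real"
    using that k(2) by (subst integral_density) (auto simp: less_imp_le)
  have "inner (convolve_L2 (\<lambda>y. complex_of_real (k y)) x) z = (\<integral>y. k y * \<Phi> y \<partial>haar)"
    unfolding h(2) g(2) \<Phi>_def by (rule inner_convolve_L2[OF k h(1) g(1)])
  also have "\<dots> = (\<integral>y. \<Phi> y \<partial>distr (density haar (\<lambda>x. ennreal (k x))) haar uminus)"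
    by (simp only: sym dens[OF \<Phi>m])
  also have "\<dots> = (\<integral>y. \<Phi> (- y) \<partial>density haar (\<lambda>x. ennreal (k x)))"
    by (rule integral_distr[OF um]) simp
  also have "\<dots> = (\<integral>y. k y * \<Phi> (- y) \<partial>haar)"
    by (rule dens) measurable
  also have "\<dots> = (\<integral>y. k y * (\<integral>x. inner (g (- y + x)) (h x) \<partial>haar) \<partial>haar)"
  proof (rule Bochner_Integration.integral_cong[OF refl])
    fix y
    have "\<Phi> (- y) = (\<integral>x. inner (h (y + (- y + x))) (g (- y + x)) \<partial>haar)"
      unfolding \<Phi>_def minus_minus
      by (rule integral_haar_translate[symmetric, of "\<lambda>x. inner (h (y + x)) (g x)"]) measurable
    then show "k y * \<Phi> (- y) = k y * (\<integral>x. inner (g (- y + x)) (h x) \<partial>haar)"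
      by (simp add: inner_commute)
  qed
  finally show ?thesis
    by (simp only: h(2) g(2) inner_convolve_L2[OF k g(1) h(1)] inner_commute[of "abs_L2 h"])
qed

section \<open>From contractions to the asymptotic center property\<close>

text \<open>Plain functions on \<open>'g L2\<close>, so that products are compositions and powers
  are \<open>^^\<close>; the elements of the algebra are recovered by
  \<open>L1_operators_cstar\<close>.\<close>

definition L1_operators ::
  "('g::{locally_compact_group, second_countable_topology} L2 \<Rightarrow> 'g L2) set" where
  "L1_operators = convolve_L2 ` {f. integrable haar f}"

lemma L1_operators_comp:
  assumes "B \<in> L1_operators" "C \<in> L1_operators"
  shows "(\<lambda>x. B (C x)) \<in> L1_operators"
proof -
  obtain f g where "integrable haar f" "B = convolve_L2 f" "integrable haar g" "C = convolve_L2 g"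
    using assms by (auto simp: L1_operators_def)
  then show ?thesis
    unfolding L1_operators_def
    by (intro image_eqI[of _ _ "convolution f g"]) (auto simp: convolve_L2_convolution integrable_convolution)
qed

lemma L1_operators_add:
  assumes "B \<in> L1_operators" "C \<in> L1_operators"
  shows "(\<lambda>x. B x + C x) \<in> L1_operators"
proof -
  obtain f g where "integrable haar f" "B = convolve_L2 f" "integrable haar g" "C = convolve_L2 g"
    using assms by (auto simp: L1_operators_def)
  moreover from this have "convolve_L2 (\<lambda>x. f x + g x) x = B x + C x" for x
    using left_regular_apply[of "\<lambda>x. f x + g x" x]
    by (simp only: left_regular_add cblinfun_add_apply left_regular_apply)
  ultimately show ?thesis
    unfolding L1_operators_def by (intro image_eqI[of _ _ "\<lambda>x. f x + g x"]) auto
qed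

lemma L1_operators_scaleR:
  assumes "B \<in> L1_operators"
  shows "(\<lambda>x. r *\<^sub>R B x) \<in> L1_operators"
proof -
  obtain f where f: "integrable haar f" "B = convolve_L2 f"
    using assms by (auto simp: L1_operators_def)
  then have "convolve_L2 (\<lambda>x. complex_of_real r * f x) x = r *\<^sub>R B x" for x
    using left_regular_apply[of "\<lambda>x. complex_of_real r * f x" x]
    by (simp only: left_regular_mult cblinfun_scaleC_apply left_regular_apply scaleR_scaleC)
  with f show ?thesis
    unfolding L1_operators_def by (intro image_eqI[of _ _ "\<lambda>x. complex_of_real r * f x"]) auto
qed

lemma L1_operators_diff:
  assumes "B \<in> L1_operators" "C \<in> L1_operators"
  shows "(\<lambda>x. B x - C x) \<in> L1_operators"
  using L1_operators_add[OF assms(1) L1_operators_scaleR[OF assms(2), of "- 1"]] by simp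

text \<open>The exponent starts at one because the identity is in general not convolution by an
  integrable function.\<close>

lemma L1_operators_funpow:
  assumes "T \<in> L1_operators"
  shows "T ^^ Suc n \<in> L1_operators"
  by (induction n) (use assms L1_operators_comp[OF assms] in \<open>simp_all add: comp_def\<close>)

definition cstar_apply ::
  "'g::{locally_compact_group, second_countable_topology} reduced_cstar \<Rightarrow> 'g L2 \<Rightarrow> 'g L2" where
  "cstar_apply a = cblinfun_apply (Rep_reduced_cstar a)"

lemma linear_cstar_apply: "linear (cstar_apply a)"
  unfolding cstar_apply_def by (rule bounded_linear.linear[OF bounded_linear_cblinfun_apply])

lemma norm_cstar_apply: "norm (cstar_apply a x) \<le> norm a * norm x"
  unfolding cstar_apply_def norm_reduced_cstar.rep_eq by (rule norm_cblinfun)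

lemma linear_cstar_apply_left: "linear (\<lambda>a. cstar_apply a x)"
  by (rule linearI)
    (simp_all add: cstar_apply_def plus_reduced_cstar.rep_eq cblinfun_add_apply
      scaleR_scaleC scaleC_reduced_cstar.rep_eq cblinfun_scaleC_apply)

lemma L1_operators_cstar:
  assumes "B \<in> L1_operators"
  obtains a where "cstar_apply a = B"
proof -
  obtain f where f: "integrable haar f" "B = convolve_L2 f"
    using assms by (auto simp: L1_operators_def)
  have "left_regular f \<in> reduced_cstar_operators"
    unfolding reduced_cstar_operators_def by (rule subsetD[OF closure_subset]) (use f(1) in simp)
  then have "cstar_apply (Abs_reduced_cstar (left_regular f)) = B"
    by (simp add: cstar_apply_def Abs_reduced_cstar_inverse left_regular_apply fun_eq_iff f(2))
  then show ?thesis by (rule that)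
qed

text \<open>All elements involved are polynomials in the symmetric operator \<open>T\<close>, so
  their norms in the algebra are controlled by quadratic forms, and the vector states at the
  concentrated vectors meet the criterion \<open>not_asymptotic_center_property\<close>.\<close>

theorem L1_contraction_imp_not_acp:
  fixes T :: "'g::{locally_compact_group, second_countable_topology} L2 \<Rightarrow> 'g L2"
  assumes "positive_contraction_no_fixpoint T" and T: "T \<in> L1_operators"
  shows "\<not> asymptotic_center_property TYPE('g reduced_fourier_stieltjes)"
proof -
  interpret positive_contraction_no_fixpoint T by fact
  obtain \<xi> N where \<xi>: "\<And>j. norm (\<xi> j) = 1" and N: "strict_mono N" "1 \<le> N 0"
    and U\<xi>: "\<And>j k. inner ((U ^^ k) (\<xi> j)) (\<xi> j) \<le> 2 / (real k + 1)"
    and lim: "(\<lambda>j. inner ((T ^^ N j) (\<xi> j)) (\<xi> j) - inner ((T ^^ N (Suc j)) (\<xi> j)) (\<xi> j)) \<longlonglongrightarrow> 1"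
    by (rule concentrated_sequence) blast
  have "\<exists>\<phi> :: 'g reduced_fourier_stieltjes. norm \<phi> \<le> 1 \<and>
      (\<forall>a. Re (cblinfun_apply \<phi> a) = inner (cstar_apply a (\<xi> j)) (\<xi> j))" for j
  proof -
    have "linear (\<lambda>a. inner (cstar_apply a (\<xi> j)) (\<xi> j))"
      using linear_compose[OF linear_cstar_apply_left[of "\<xi> j"] bounded_linear.linear[OF bounded_linear_inner_left]]
      by (simp add: o_def)
    moreover have "inner (cstar_apply a (\<xi> j)) (\<xi> j) \<le> norm a" for a
      using norm_cauchy_schwarz[of "cstar_apply a (\<xi> j)" "\<xi> j"] norm_cstar_apply[of a "\<xi> j"] \<xi> by simp
    ultimately show ?thesis
      by (rule real_functional_complexification) blast
  qed
  then obtain \<phi> :: "nat \<Rightarrow> 'g reduced_fourier_stieltjes"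
    where \<phi>: "\<And>j. norm (\<phi> j) \<le> 1"
      and Re_\<phi>: "\<And>j a. Re (cblinfun_apply (\<phi> j) a) = inner (cstar_apply a (\<xi> j)) (\<xi> j)"
    by metis
  \<comment> \<open>With \<open>h = 1 - U ^^ Suc k\<close>, the next element is
    \<open>1 - (1 - T) (1 - h) = h + T - T h\<close>, which involves no identity summand.\<close>
  have "(\<lambda>x. x - (U ^^ Suc k) x) \<in> L1_operators" for k
  proof (induction k)
    case 0
    then show ?case using T by (simp add: U_def)
  next
    case (Suc k)
    let ?h = "\<lambda>x. x - (U ^^ Suc k) x"
    have "(\<lambda>x. x - (U ^^ Suc (Suc k)) x) = (\<lambda>x. ?h x + (T x - T (?h x)))"
    proof
      fix x
      show "x - (U ^^ Suc (Suc k)) x = ?h x + (T x - T (?h x))"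
        by (simp add: linear_diff[OF linear] U_def[of "U ((U ^^ k) x)"])
    qed
    then show ?case
      using L1_operators_add[OF Suc L1_operators_diff[OF T L1_operators_comp[OF T Suc]]] by simp
  qed
  then obtain h :: "nat \<Rightarrow> 'g reduced_cstar"
    where h: "\<And>k. cstar_apply (h k) = (\<lambda>x. x - (U ^^ Suc k) x)"
    using choice[of "\<lambda>k a. cstar_apply a = (\<lambda>x. x - (U ^^ Suc k) x)"] L1_operators_cstar by blast
  have "Suc (N j - 1) = N j" for j using N(2) strict_mono_less_eq[OF N(1), of 0 j] by simp
  then have TN: "T ^^ N j \<in> L1_operators" for j
    by (metis L1_operators_funpow[OF T])
  have "(\<lambda>x. (T ^^ N j) x - (T ^^ N (Suc j)) x) \<in> L1_operators" for j
    by (rule L1_operators_diff[OF TN TN])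
  then obtain b :: "nat \<Rightarrow> 'g reduced_cstar"
    where b: "\<And>j. cstar_apply (b j) = (\<lambda>x. (T ^^ N j) x - (T ^^ N (Suc j)) x)"
    using choice[of "\<lambda>j a. cstar_apply a = (\<lambda>x. (T ^^ N j) x - (T ^^ N (Suc j)) x)"] L1_operators_cstar by blast
  show ?thesis
  proof (rule not_asymptotic_center_property)
    show "norm (\<phi> j) \<le> 1" for j by (rule \<phi>)
    show "1 - 2 / (real (Suc k) + 1) \<le> Re (cblinfun_apply (\<phi> j) (h k))" for j k
      using U\<xi>[of "Suc k" j] \<xi>[of j] unfolding Re_\<phi> h by (simp add: inner_diff_left norm_eq_1 del: funpow.simps)
    have "(\<lambda>k. 2 * inverse (real (Suc (Suc k)))) \<longlonglongrightarrow> 2 * 0"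
      by (intro tendsto_intros LIMSEQ_Suc[OF LIMSEQ_inverse_real_of_nat])
    then show "(\<lambda>k. 2 / (real (Suc k) + 1)) \<longlonglongrightarrow> 0"
      by (simp add: divide_inverse add.commute)
    show "(\<lambda>j. Re (cblinfun_apply (\<phi> j) (b j))) \<longlonglongrightarrow> 1"
      using lim by (simp add: Re_\<phi> b inner_diff_left)
    fix F :: "nat set" and k assume F: "finite F"
    let ?a = "h k - 2 *\<^sub>R sum b F"
    define C where "C x = (x - (U ^^ Suc k) x) - 2 *\<^sub>R (\<Sum>j\<in>F. (T ^^ N j) x - (T ^^ N (Suc j)) x)" for x
    have C: "cstar_apply ?a x = C x" for x
      unfolding C_def linear_diff[OF linear_cstar_apply_left] linear_scale[OF linear_cstar_apply_left]
        linear_sum[OF linear_cstar_apply_left] h b ..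
    \<comment> \<open>The exponent \<open>Suc k\<close> is at least one, so
      \<open>U ^^ Suc k \<le> 1 - T\<close> and hence \<open>1 - U ^^ Suc k \<ge> T \<ge> S\<close>.
      Subtracting \<open>2 S\<close> leaves at least \<open>- S \<ge> - 1\<close>; the upper bound
      is clear from positivity.\<close>
    have form: "\<bar>inner (C x) x\<bar> \<le> inner x x" for x
    proof -
      define S where "S = (\<Sum>j\<in>F. inner ((T ^^ N j) x) x - inner ((T ^^ N (Suc j)) x) x)"
      have "inner (C x) x = inner x x - inner ((U ^^ Suc k) x) x - 2 * S"
        by (simp only: C_def S_def inner_diff_left inner_scaleR_left inner_sum_left)
      moreover have "0 \<le> S" "S \<le> inner (T x) x"
        unfolding S_def by (rule telescoping_form_bounds[OF F N])+
      moreover have "0 \<le> inner ((U ^^ Suc k) x) x" by (rule mixed_pow_nonneg)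
      moreover have "inner ((U ^^ Suc k) x) x \<le> inner x x - inner (T x) x"
        using U_pow_antimono[of 1 "Suc k" x] by (simp add: U_def inner_diff_left del: funpow.simps) (simp add: U_def inner_diff_left)
      ultimately show ?thesis using le[of x] unfolding abs_le_iff by argo
    qed
    have "inner (C x) y = inner x (C y)" for x y
      by (simp only: C_def inner_diff_left inner_diff_right inner_scaleR_left inner_scaleR_right
          inner_sum_left inner_sum_right sym_pow sym_U_pow)
    moreover have "linear C" using linear_cstar_apply[of ?a] by (simp add: C[abs_def])
    ultimately have "norm (C x) \<le> norm x" for x
      using norm_le_of_symmetric_form[of C x] form by blast
    then show "norm ?a \<le> 1"
      unfolding norm_reduced_cstar.rep_eq
      by (intro norm_cblinfun_bound) (simp_all add: C cstar_apply_def[symmetric])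
  qed
qed

theorem corollary3p6:
  assumes "asymptotic_center_property
    TYPE('g::{locally_compact_group, second_countable_topology} reduced_fourier_stieltjes)"
  shows "compact (UNIV :: 'g set)"
proof (rule ccontr)
  assume "\<not> compact (UNIV :: 'g set)"
  then have infinite: "\<not> emeasure (haar :: 'g measure) UNIV < \<infinity>"
    using haar_finite_imp_compact by blast
  obtain k\<^sub>0 :: "'g \<Rightarrow> real" where k\<^sub>0: "\<And>x. 0 < k\<^sub>0 x" "integrable haar k\<^sub>0"
    "distr (density haar (\<lambda>x. ennreal (k\<^sub>0 x))) haar uminus = density haar (\<lambda>x. ennreal (k\<^sub>0 x))"
    by (rule exists_symmetric_kernel) blast
  let ?k\<^sub>0 = "\<lambda>y. complex_of_real (k\<^sub>0 y)"
  have ki: "integrable haar ?k\<^sub>0" using k\<^sub>0(2) by (rule integrable_of_real)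
  define M where "M = norm (left_regular ?k\<^sub>0)"
  \<comment> \<open>The square root of a strictly positive integrable function is a strictly
    positive element of L2. A positive kernel cannot send it to zero, so the operator is
    nonzero.\<close>
  have M: "M > 0"
  proof -
    obtain v :: "'g \<Rightarrow> real" where v: "\<And>x. 0 < v x" "integrable haar v" "v \<in> borel_measurable borel"
      using exists_positive_integrable by metis
    define f where "f x = complex_of_real (sqrt (v x))" for x
    have "f \<in> borel_measurable borel" unfolding f_def[abs_def] using v(3) by measurable
    then have f: "square_integrable f"
      using v by (simp add: square_integrable_def f_def less_imp_le)
    have "\<not> (AE x in haar. convolution ?k\<^sub>0 f x = 0)"
    proof
      assume "AE x in haar. convolution ?k\<^sub>0 f x = 0"
      then have "AE x in (haar :: 'g measure). False"
        using AE_integrable_convolution[OF ki f]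
      proof eventually_elim
        fix x assume "convolution ?k\<^sub>0 f x = 0" and i: "integrable haar (\<lambda>y. ?k\<^sub>0 y * f (- y + x))"
        then have "(\<integral>y. k\<^sub>0 y * sqrt (v (- y + x)) \<partial>haar) = 0"
          by (simp add: convolution_def f_def flip: of_real_mult)
        moreover have "integrable haar (\<lambda>y. k\<^sub>0 y * sqrt (v (- y + x)))"
          using i by (simp add: f_def complex_of_real_integrable_eq flip: of_real_mult)
        ultimately have "AE y in haar. k\<^sub>0 y * sqrt (v (- y + x)) = 0"
          using k\<^sub>0(1) v(1) by (subst (asm) integral_nonneg_eq_0_iff_AE) (auto simp: less_imp_le)
        then have "AE y in (haar :: 'g measure). False"
        proof eventually_elim
          fix y assume "k\<^sub>0 y * sqrt (v (- y + x)) = 0"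
          then show False using k\<^sub>0(1)[of y] v(1)[of "- y + x"] by auto
        qed
        then show False using haar_not_AE_False by blast
      qed
      then show False using haar_not_AE_False by blast
    qed
    then have "cblinfun_apply (left_regular ?k\<^sub>0) (abs_L2 f) \<noteq> 0"
      by (simp add: left_regular_apply convolve_L2_abs ki f abs_L2_eq_0_iff square_integrable_convolution)
    then have "left_regular ?k\<^sub>0 \<noteq> 0" by (auto simp: zero_cblinfun.rep_eq cblinfun_apply.rep_eq)
    then show ?thesis by (simp add: M_def)
  qed
  define k where "k y = k\<^sub>0 y / M" for y
  let ?k = "\<lambda>y. complex_of_real (k y)"
  have "integrable haar k" unfolding k_def[abs_def] using k\<^sub>0(2) by simp
  then have kint: "integrable haar k" "integrable haar ?k" by (auto intro: integrable_of_real)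
  define K where "K = convolve_L2 ?k"
  have KM: "K x = (1 / M) *\<^sub>R convolve_L2 ?k\<^sub>0 x" for x
  proof -
    have "?k = (\<lambda>y. complex_of_real (1 / M) * ?k\<^sub>0 y)" by (simp add: k_def fun_eq_iff)
    then have "K x = cblinfun_apply (left_regular (\<lambda>y. complex_of_real (1 / M) * ?k\<^sub>0 y)) x"
      by (simp only: K_def left_regular_apply)
    then show ?thesis
      by (simp only: left_regular_mult[OF ki] cblinfun_scaleC_apply left_regular_apply scaleR_scaleC)
  qed
  have Knorm: "norm (K x) \<le> norm x" for x
    using norm_cblinfun[of "left_regular ?k\<^sub>0" x] M
    by (simp add: KM left_regular_apply M_def[symmetric] divide_le_eq mult.commute)
  have Ksym: "inner (K x) y = inner x (K y)" for x y
    by (simp add: KM convolve_L2_symmetric[OF k\<^sub>0(2,1,3)])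
  have Klin: "linear K"
    unfolding K_def by (rule bounded_linear.linear[OF bounded_linear_convolve_L2])
  have K_abs: "K (abs_L2 f) = abs_L2 (convolution ?k f)" if "square_integrable f" for f
    unfolding K_def by (rule convolve_L2_abs[OF kint(2) that])
  interpret kern: positive_kernel k
  proof
    show "0 < k x" for x using k\<^sub>0(1) M by (simp add: k_def)
    show "integrable haar k" by (rule kint)
    fix f :: "'g \<Rightarrow> complex" assume f: "square_integrable f"
    have "norm (abs_L2 (convolution ?k f)) \<le> norm (abs_L2 f)"
      using Knorm[of "abs_L2 f"] by (simp only: K_abs[OF f])
    then show "(\<integral>x. (cmod (convolution ?k f x))\<^sup>2 \<partial>haar) \<le> (\<integral>x. (cmod (f x))\<^sup>2 \<partial>haar)"
      using f by (simp add: norm_L2.abs_eq square_integrable_convolution kint)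
  qed
  have contr: "positive_contraction_no_fixpoint (\<lambda>x. K (K x))"
  proof (intro positive_contraction_no_fixpoint.intro positive_contraction.intro
      positive_contraction_no_fixpoint_axioms.intro)
    show "linear (\<lambda>x. K (K x))" using linear_compose[OF Klin Klin] by (simp add: o_def)
    show "inner (K (K x)) y = inner x (K (K y))" for x y by (simp add: Ksym)
    have form: "inner (K (K x)) x = (norm (K x))\<^sup>2" for x
      by (simp add: Ksym[of "K x" x] power2_norm_eq_inner)
    show "0 \<le> inner (K (K x)) x" for x by (simp add: form)
    show "inner (K (K x)) x \<le> inner x x" for x
      unfolding form power2_norm_eq_inner[symmetric] using Knorm by (simp add: power_mono)
    show "x = 0" if fix_x: "K (K x) = x" for x
    proof (rule ccontr)
      assume "x \<noteq> 0"
      obtain f where f: "square_integrable f" "x = abs_L2 f" by (rule L2_cases)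
      have f1: "square_integrable (convolution ?k f)"
        by (rule square_integrable_convolution[OF kint(2) f(1)])
      have f2: "square_integrable (convolution ?k (convolution ?k f))"
        by (rule square_integrable_convolution[OF kint(2) f1])
      have "abs_L2 (\<lambda>x. convolution ?k (convolution ?k f) x - f x) = 0"
        using fix_x by (simp add: f(2) K_abs f(1) f1 flip: abs_L2_diff[OF f2 f(1)])
      then have "AE x in haar. convolution ?k (convolution ?k f) x = f x"
        by (simp add: abs_L2_eq_0_iff[OF square_integrable_diff[OF f2 f(1)]])
      then obtain p where p: "kern.fixpoint p" "\<And>x. ennreal (cmod (f x)) \<le> p x"
        by (rule kern.fixpoint_of_square[OF f(1)]) blast
      have "\<not> (AE x in haar. p x = 0)"
      proof
        assume "AE x in haar. p x = 0"
        then have "AE x in haar. f x = 0"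
          by eventually_elim (use p(2) in \<open>metis ennreal_eq_0_iff le_zero_eq norm_le_zero_iff\<close>)
        then show False using \<open>x \<noteq> 0\<close> f by (simp add: abs_L2_eq_0_iff)
      qed
      then show False using kern.fixpoint_imp_finite[OF p(1)] infinite by blast
    qed
    show "\<exists>x. norm x = 1 \<and> 1 - \<epsilon> \<le> inner (K (K x)) x" if "0 < \<epsilon>" for \<epsilon>
    proof (rule ccontr)
      assume neg: "\<nexists>x. norm x = 1 \<and> 1 - \<epsilon> \<le> inner (K (K x)) x"
      \<comment> \<open>If the claim failed for \<open>\<epsilon>\<close>, then \<open>s\<close>
        would bound \<open>K\<close> on unit vectors, whereas \<open>K\<close> was scaled to norm
        one. The maximum with 0 covers \<open>\<epsilon> > 1\<close>.\<close>
      define s where "s = sqrt (max 0 (1 - \<epsilon>))"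
      have s: "0 \<le> s" "s < 1" using \<open>0 < \<epsilon>\<close> by (simp_all add: s_def)
      have unit: "norm (K x) \<le> s" if "norm x = 1" for x
      proof -
        have "(norm (K x))\<^sup>2 \<le> max 0 (1 - \<epsilon>)" using neg that unfolding form by force
        then show ?thesis unfolding s_def by (rule real_le_rsqrt)
      qed
      have "norm (K x) \<le> s * norm x" for x
      proof (cases "x = 0")
        case False
        have "norm (K ((1 / norm x) *\<^sub>R x)) \<le> s" using False by (intro unit) simp
        then show ?thesis using False by (simp add: linear_scale[OF Klin] divide_le_eq)
      qed (simp add: linear_0[OF Klin])
      then have "norm (cblinfun_apply (left_regular ?k\<^sub>0) x) \<le> (s * M) * norm x" for x
        using M by (simp add: left_regular_apply KM divide_le_eq mult_ac)
      then have "M \<le> s * M" unfolding M_def[symmetric]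
        using norm_cblinfun_bound[of "s * M" "left_regular ?k\<^sub>0"] s M by (simp add: M_def)
      then show False using s M by simp
    qed
  qed
  have KL: "K \<in> L1_operators"
    unfolding K_def L1_operators_def using kint(2) by blast
  show False
    using L1_contraction_imp_not_acp[OF contr L1_operators_comp[OF KL KL]] assms by (rule notE)
qed

end
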